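(* Let $n\ge1$. Every continuous, epi-translation invariant valuation $Z:\mathrm{Conv}_{\mathrm{sc}}(\mathbb{R}^n)\to\mathbb{R}$ that is epi-homogeneous of degree $1$ can be approximated by a sequence $(Z_j)_j$ of valuations on $\mathrm{Conv}_{\mathrm{sc}}(\mathbb{R}^n)$ that converges to $Z$ uniformly on compact subsets of $\mathrm{Conv}_{\mathrm{sc}}(\mathbb{R}^n)$ and has the following properties: 1. $Z_j$ is a continuous, epi-translation invariant valuation for each $j\in\mathbb{N}$. 2. For every $j\in\mathbb{N}$ there exist two functions $\ell_j,w_j\in\mathrm{Conv}_{\mathrm{cd}}(\mathbb{R}^n)$ such that $$Z_j(u)=\int_{\mathrm{dom}(\ell_j)}u^*(\nabla\ell_j(x))\,dx-\int_{\mathrm{dom}(w_j)}u^*(\nabla w_j(x))\,dx$$ for all $u\in\mathrm{Conv}_{\mathrm{cd}}(\mathbb{R}^n)$.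
   Context: $\mathrm{Conv}(\mathbb{R}^n)$ is the set of all convex, lower semi-continuous, proper (not identically $+\infty$) functions $u:\mathbb{R}^n\to(-\infty,+\infty]$, and $\mathrm{dom}(u)=\{x\in\mathbb{R}^n:u(x)<+\infty\}$. $\mathrm{Conv}_{\mathrm{sc}}(\mathbb{R}^n)=\{u\in\mathrm{Conv}(\mathbb{R}^n):\lim_{|x|\to\infty}u(x)/|x|=+\infty\}$, and $\mathrm{Conv}_{\mathrm{cd}}(\mathbb{R}^n)$ is the set of all $u\in\mathrm{Conv}_{\mathrm{sc}}(\mathbb{R}^n)$ such that $\mathrm{dom}(u)$ is compact. The Fenchel-Legendre transform of $u$ is $u^*(y)=\sup_{x\in\mathbb{R}^n}(x\cdot y-u(x))$, $y\in\mathbb{R}^n$; it is finite everywhere for $u\in\mathrm{Conv}_{\mathrm{sc}}(\mathbb{R}^n)$. All these spaces carry the (metrizable) topology of epi-convergence: $u_j$ epi-converges to $u$ if for every $x\in\mathbb{R}^n$ (i) $u(x)\le\liminf_j u_j(x_j)$ for every sequence $x_j\to x$, and (ii) there is a sequence $x_j\to x$ with $u(x)=\lim_j u_j(x_j)$. A functional $Z:\mathrm{Conv}_{\mathrm{sc}}(\mathbb{R}^n)\to\mathbb{R}$ is a valuation if $Z(u\wedge v)+Z(u\vee v)=Z(u)+Z(v)$ whenever $u,v$, their pointwise minimum $u\wedge v$ and their pointwise maximum $u\vee v$ all belong to $\mathrm{Conv}_{\mathrm{sc}}(\mathbb{R}^n)$. It is epi-translation invariant if $Z(u(\cdot-x)+c)=Z(u)$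 for all $u$, all $x\in\mathbb{R}^n$ and $c\in\mathbb{R}$. It is epi-homogeneous of degree $i$ if $Z(t\cdot u(\cdot/t))=t^iZ(u)$ for all $u$ and all $t>0$, where $t\cdot u(\cdot/t)$ denotes the function $x\mapsto t\,u(x/t)$. A convex function is differentiable almost everywhere on the interior of its domain, and the boundary of the (convex) domain has Lebesgue measure zero, so gradients such as $\nabla\ell_j(x)$ are defined for a.e. $x$ in the domain. *)

theory Defs
  imports "HOL-Analysis.Analysis"
begin

definition eff_dom :: "(real^'n \<Rightarrow> ereal) \<Rightarrow> (real^'n) set" where
  "eff_dom u = {x. u x < \<infinity>}"

text \<open>In the convexity condition, the values are different from \<open>-\<infinity>\<close>, so no undefined
  difference of infinities can occur; for \<open>t = 0\<close> and \<open>t = 1\<close> the convention \<open>0 * \<infinity> = 0\<close>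
  makes the inequality trivial.\<close>

definition Conv :: "(real^'n \<Rightarrow> ereal) set" where
  "Conv = {u. (\<forall>x. u x \<noteq> -\<infinity>) \<and> (\<exists>x. u x \<noteq> \<infinity>) \<and>
     (\<forall>x y. \<forall>t\<in>{0..1}.
        u ((1 - t) *\<^sub>R x + t *\<^sub>R y) \<le> ereal (1 - t) * u x + ereal t * u y) \<and>
     (\<forall>x. u x \<le> Liminf (at x) u)}"

definition Conv_sc :: "(real^'n \<Rightarrow> ereal) set" where
  "Conv_sc = {u \<in> Conv. ((\<lambda>x. u x / ereal (norm x)) \<longlongrightarrow> \<infinity>) at_infinity}"

definition Conv_cd :: "(real^'n \<Rightarrow> ereal) set" where
  "Conv_cd = {u \<in> Conv_sc. compact (eff_dom u)}"

definition fenchel :: "(real^'n \<Rightarrow> ereal) \<Rightarrow> real^'n \<Rightarrow> ereal" where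
  "fenchel u y = (SUP x. ereal (x \<bullet> y) - u x)"

definition epi_converges :: "(nat \<Rightarrow> real^'n \<Rightarrow> ereal) \<Rightarrow> (real^'n \<Rightarrow> ereal) \<Rightarrow> bool" where
  "epi_converges us u \<longleftrightarrow> (\<forall>x.
     (\<forall>xs. xs \<longlonglongrightarrow> x \<longrightarrow> u x \<le> liminf (\<lambda>j. us j (xs j))) \<and>
     (\<exists>xs. xs \<longlonglongrightarrow> x \<and> (\<lambda>j. us j (xs j)) \<longlonglongrightarrow> u x))"

text \<open>The topology of epi-convergence on a set \<open>S\<close> of functions: a set is open iff every
  sequence in \<open>S\<close> that epi-converges to one of its points is eventually in it. For \<open>S \<subseteq> Conv\<close> epi-convergence is
  metrizable, and a metrizable topology is determined by its convergent sequences, so this is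
  the usual topology, and it agrees with the one that \<open>S\<close> inherits from \<open>Conv\<close>.\<close>

definition epi_open :: "(real^'n \<Rightarrow> ereal) set \<Rightarrow> (real^'n \<Rightarrow> ereal) set \<Rightarrow> bool" where
  "epi_open S U \<longleftrightarrow> U \<subseteq> S \<and>
     (\<forall>us u. (\<forall>j. us j \<in> S) \<and> u \<in> U \<and> epi_converges us u \<longrightarrow>
        (\<forall>\<^sub>F j in sequentially. us j \<in> U))"

definition epi_topology :: "(real^'n \<Rightarrow> ereal) set \<Rightarrow> (real^'n \<Rightarrow> ereal) topology" where
  "epi_topology S = topology (epi_open S)"

lemma istopology_epi_open: "istopology (epi_open S)"
  unfolding istopology_def
proof (intro conjI allI impI)
  fix U V assume "epi_open S U" "epi_open S V"
  then show "epi_open S (U \<inter> V)"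
    unfolding epi_open_def by (simp add: eventually_conj_iff) blast
next
  fix \<U> assume U: "\<forall>U\<in>\<U>. epi_open S U"
  show "epi_open S (\<Union>\<U>)"
    unfolding epi_open_def
  proof (intro conjI allI impI)
    show "\<Union>\<U> \<subseteq> S" using U unfolding epi_open_def by blast
  next
    fix us u
    assume A: "(\<forall>j. us j \<in> S) \<and> u \<in> \<Union>\<U> \<and> epi_converges us u"
    then obtain W where W: "W \<in> \<U>" "u \<in> W" by blast
    with U A have "\<forall>\<^sub>F j in sequentially. us j \<in> W"
      unfolding epi_open_def by blast
    then show "\<forall>\<^sub>F j in sequentially. us j \<in> \<Union>\<U>"
      by (rule eventually_mono) (use W in blast)
  qed
qed

lemma openin_epi_topology: "openin (epi_topology S) U \<longleftrightarrow> epi_open S U"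
  by (simp add: epi_topology_def istopology_epi_open)

lemma topspace_epi_topology [simp]: "topspace (epi_topology S) = S"
proof -
  have "epi_open S S" by (simp add: epi_open_def)
  then show ?thesis
    by (auto simp: topspace_def openin_epi_topology) (auto simp: epi_open_def)
qed

text \<open>Functionals on \<open>Conv_sc\<close> are total functions of which only the values on \<open>Conv_sc\<close> matter.\<close>

definition is_valuation :: "((real^'n \<Rightarrow> ereal) \<Rightarrow> real) \<Rightarrow> bool" where
  "is_valuation Z \<longleftrightarrow> (\<forall>u v. u \<in> Conv_sc \<and> v \<in> Conv_sc \<and>
     (\<lambda>x. min (u x) (v x)) \<in> Conv_sc \<and> (\<lambda>x. max (u x) (v x)) \<in> Conv_sc \<longrightarrow>
     Z (\<lambda>x. min (u x) (v x)) + Z (\<lambda>x. max (u x) (v x)) = Z u + Z v)"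

definition epi_translation_invariant :: "((real^'n \<Rightarrow> ereal) \<Rightarrow> real) \<Rightarrow> bool" where
  "epi_translation_invariant Z \<longleftrightarrow>
     (\<forall>u\<in>Conv_sc. \<forall>x c. Z (\<lambda>y. u (y - x) + ereal c) = Z u)"

definition epi_homogeneous :: "nat \<Rightarrow> ((real^'n \<Rightarrow> ereal) \<Rightarrow> real) \<Rightarrow> bool" where
  "epi_homogeneous i Z \<longleftrightarrow>
     (\<forall>u\<in>Conv_sc. \<forall>t>0. Z (\<lambda>x. ereal t * u (x /\<^sub>R t)) = t ^ i * Z u)"

definition epi_continuous :: "((real^'n \<Rightarrow> ereal) \<Rightarrow> real) \<Rightarrow> bool" where
  "epi_continuous Z \<longleftrightarrow> continuous_map (epi_topology Conv_sc) euclideanreal Z"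

text \<open>Meaningful at interior points of \<open>eff_dom l\<close> where \<open>l\<close> is differentiable, hence at almost
  every point of \<open>eff_dom l\<close> for convex \<open>l\<close>; elsewhere the value is irrelevant.\<close>

definition grad :: "(real^'n \<Rightarrow> ereal) \<Rightarrow> real^'n \<Rightarrow> real^'n" where
  "grad l x = (THE D. GDERIV (\<lambda>z. real_of_ereal (l z)) x :> D)"

text \<open>For \<open>u \<in> Conv_sc\<close> the transform is finite everywhere, so \<open>real_of_ereal\<close> loses nothing
  in the integrand \<open>u\<^sup>*(\<nabla>l(x))\<close>.\<close>

definition grad_integrand ::
    "(real^'n \<Rightarrow> ereal) \<Rightarrow> (real^'n \<Rightarrow> ereal) \<Rightarrow> real^'n \<Rightarrow> real" where
  "grad_integrand u l x = real_of_ereal (fenchel u (grad l x))"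

end

theory Submission
  imports Defs "HOL-Complex_Analysis.Great_Picard"
begin

text \<open>Put \<open>Y f = Z (f\<^sup>*)\<close> for finite convex \<open>f\<close>: a continuous, positively homogeneous valuation that ignores affine
  summands. Let \<open>Y\<close> be additive in \<open>B\<close>, let \<open>c\<close> be affine and \<open>f = max B c\<close>. The maximum and the minimum of
  \<open>g + f + m B\<close> and \<open>g + c + m f\<close> are \<open>g + (m + 1) f\<close> and \<open>g + c + m B\<close>, so the valuation property makes
  \<open>Y (g + m f)\<close> an arithmetic progression in \<open>m\<close>, whose difference is \<open>Y f\<close> by homogeneity and continuity. Hence \<open>Y\<close>
  is additive on maxima of affine functions and, by continuity, on all convex functions.

  By continuity at \<open>0\<close>, \<open>Y f\<close> depends only on the restriction of \<open>f\<close> to a ball. A compactness argument and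
  the Hahn--Banach theorem in finite codimension then approximate \<open>Y\<close>, uniformly for bounded \<open>f\<close>, by finite
  combinations \<open>\<Sum> d y * f y\<close> that annihilate affine functions. Finally, a finite sum of positive point masses
  is the image of Lebesgue measure on a long thin tube under the gradient of a piecewise affine convex function.\<close>

subsection \<open>Finite convex functions\<close>

text \<open>\<open>Y\<close> need not come from a measure: for n = 1 it can be the integral of any
  continuous compactly supported function against the second derivative of \<open>f\<close>, and
  then it is in general unbounded in the supremum norm on differences of convex functions. What
  remains is compactness of the convex functions whose Lipschitz constant and value at 0 are bounded
  by 1: two of them that agree at enough points have nearly equal \<open>Y\<close>. This controls
  \<open>Y\<close> on a subspace of finite codimension, where Hahn--Banach leaves exactly a
  correction by point evaluations. The correction must annihilate affine functions because these are
  dual to epi-translations. Gradient images of Lebesgue measure are positive, so a signed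
  combination of evaluations takes two functions \<open>l\<close> and \<open>w\<close>.\<close>

lemma convex_on_UNIV_iff_segment:
  "convex_on UNIV f \<longleftrightarrow>
    (\<forall>x y t. 0 \<le> t \<longrightarrow> t \<le> 1 \<longrightarrow> f ((1 - t) *\<^sub>R x + t *\<^sub>R y) \<le> (1 - t) * f x + t * f y)"
  (is "_ \<longleftrightarrow> ?R")
proof
  assume "convex_on UNIV f"
  then show ?R by (auto intro: convex_onD)
next
  assume R: ?R
  have "f (u *\<^sub>R x + v *\<^sub>R y) \<le> u * f x + v * f y" if "0 \<le> u" "0 \<le> v" "u + v = 1" for u v x y
    using R[rule_format, of v x y] that by (auto simp: eq_diff_eq[symmetric])
  then show "convex_on UNIV f" by (simp add: convex_on_def)
qed

lemma convex_on_affine: "convex_on UNIV (\<lambda>x. a \<bullet> x + b)"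
  by (auto simp: convex_on_UNIV_iff_segment inner_simps algebra_simps)

lemma convex_on_max:
  assumes "convex_on S f" "convex_on S g"
  shows "convex_on S (\<lambda>x. max (f x) (g x))"
  unfolding convex_on_def
proof (intro conjI ballI allI impI)
  show "convex S" using assms convex_on_imp_convex by blast
next
  fix x y and u v :: real assume *: "x \<in> S" "y \<in> S" "0 \<le> u" "0 \<le> v" "u + v = 1"
  have "f (u *\<^sub>R x + v *\<^sub>R y) \<le> u * f x + v * f y" "g (u *\<^sub>R x + v *\<^sub>R y) \<le> u * g x + v * g y"
    using assms * by (auto simp: convex_on_def)
  moreover have "u * f x + v * f y \<le> u * max (f x) (g x) + v * max (f y) (g y)"
    "u * g x + v * g y \<le> u * max (f x) (g x) + v * max (f y) (g y)"
    using * by (auto intro!: add_mono mult_left_mono)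
  ultimately show "max (f (u *\<^sub>R x + v *\<^sub>R y)) (g (u *\<^sub>R x + v *\<^sub>R y))
      \<le> u * max (f x) (g x) + v * max (f y) (g y)" by linarith
qed

lemma convex_on_SUP:
  fixes F :: "'i \<Rightarrow> 'a::real_vector \<Rightarrow> real"
  assumes "I \<noteq> {}" "\<And>x. bdd_above ((\<lambda>i. F i x) ` I)" "\<And>i. i \<in> I \<Longrightarrow> convex_on UNIV (F i)"
  shows "convex_on UNIV (\<lambda>x. SUP i\<in>I. F i x)"
  unfolding convex_on_UNIV_iff_segment
proof (intro allI impI)
  fix x y and t :: real assume t: "0 \<le> t" "t \<le> 1"
  show "(SUP i\<in>I. F i ((1 - t) *\<^sub>R x + t *\<^sub>R y)) \<le> (1 - t) * (SUP i\<in>I. F i x) + t * (SUP i\<in>I. F i y)"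
  proof (rule cSUP_least[OF assms(1)])
    fix i assume i: "i \<in> I"
    have "F i ((1 - t) *\<^sub>R x + t *\<^sub>R y) \<le> (1 - t) * F i x + t * F i y"
      using assms(3)[OF i] t by (simp add: convex_on_UNIV_iff_segment)
    also have "\<dots> \<le> (1 - t) * (SUP i\<in>I. F i x) + t * (SUP i\<in>I. F i y)"
      using t i by (intro add_mono mult_left_mono cSUP_upper assms(2)) auto
    finally show "F i ((1 - t) *\<^sub>R x + t *\<^sub>R y) \<le> \<dots>" .
  qed
qed

lemma convex_on_lim:
  fixes F :: "nat \<Rightarrow> 'a::real_vector \<Rightarrow> real"
  assumes "\<And>j. convex_on UNIV (F j)" "\<And>x. (\<lambda>j. F j x) \<longlonglongrightarrow> f x"
  shows "convex_on UNIV f"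
  unfolding convex_on_UNIV_iff_segment
proof (intro allI impI)
  fix x y and t :: real assume t: "0 \<le> t" "t \<le> 1"
  have "(\<lambda>j. (1 - t) * F j x + t * F j y) \<longlonglongrightarrow> (1 - t) * f x + t * f y"
    by (intro tendsto_intros assms)
  then show "f ((1 - t) *\<^sub>R x + t *\<^sub>R y) \<le> (1 - t) * f x + t * f y"
    by (rule LIMSEQ_le[OF assms(2)]) (use assms(1) t in \<open>auto simp: convex_on_UNIV_iff_segment\<close>)
qed

section \<open>Separation, subgradients and Lipschitz bounds\<close>

lemma convex_continuous:
  fixes f :: "'a::euclidean_space \<Rightarrow> real"
  assumes "convex_on UNIV f" shows "continuous_on S f"
  using convex_on_continuous[OF open_UNIV assms] continuous_on_subset by blast

text \<open>A hyperplane separates \<open>C\<close> from the strict epigraph. It cannot tilt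
  downwards, as the epigraph is unbounded above, and it cannot be vertical, as \<open>f\<close> is
  finite everywhere; division by its last coordinate \<open>q\<close> turns it into an affine
  function. \<open>C\<close> will be a single point for subgradients and the hypograph of a concave
  cone in \<open>fenchel_recovery\<close>.\<close>

lemma convex_separating_affine:
  fixes f :: "'a::euclidean_space \<Rightarrow> real"
  assumes f: "convex_on UNIV f" and C: "convex C" "C \<noteq> {}" and le: "\<And>y t. (y, t) \<in> C \<Longrightarrow> t \<le> f y"
  obtains s c where "\<And>y. s \<bullet> y + c \<le> f y" "\<And>y t. (y, t) \<in> C \<Longrightarrow> t \<le> s \<bullet> y + c"
proof -
  let ?E = "{(y, t). f y < t}"
  have E: "convex ?E"
    unfolding convex_alt
  proof (intro ballI allI impI, clarsimp)
    fix a b c d and u :: real assume *: "f a < b" "f c < d" "0 \<le> u" "u \<le> 1"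
    have "f ((1 - u) *\<^sub>R a + u *\<^sub>R c) \<le> (1 - u) * f a + u * f c"
      using f * by (simp add: convex_on_UNIV_iff_segment)
    also have "\<dots> < (1 - u) * b + u * d"
      using * by (cases "u = 0") (auto intro!: add_le_less_mono mult_left_mono)
    finally show "f ((1 - u) *\<^sub>R a + u *\<^sub>R c) < (1 - u) * b + u * d" .
  qed
  have "(0, f 0 + 1) \<in> ?E" by simp
  then have "?E \<noteq> {}" by blast
  moreover have "C \<inter> ?E = {}" using le by fastforce
  ultimately obtain a b where ab: "a \<noteq> 0" "\<forall>x\<in>C. a \<bullet> x \<le> b" "\<forall>x\<in>?E. b \<le> a \<bullet> x"
    using separating_hyperplane_sets[OF C(1) E C(2)] by blast
  obtain p q where a: "a = (p, q)" by (cases a)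
  have up: "b \<le> p \<bullet> y + q * t" if "f y < t" for y t using ab(3) that by (auto simp: a)
  have q0: "q \<ge> 0"
  proof (rule ccontr)
    assume "\<not> q \<ge> 0"
    then have q: "q < 0" by simp
    define t where "t = max (f 0 + 1) ((b - 1) / q)"
    have "b \<le> q * t" using up[of 0 t] by (simp add: t_def)
    moreover have "q * t \<le> b - 1"
      using q by (simp add: t_def field_simps neg_le_divide_eq max_def)
    ultimately show False by simp
  qed
  have "q \<noteq> 0"
  proof
    assume q: "q = 0"
    then have p: "p \<noteq> 0" using ab(1) a by (auto simp: zero_prod_def)
    have "b \<le> p \<bullet> y" for y using up[of y "f y + 1"] q by simp
    from this[of "((b - 1) / (p \<bullet> p)) *\<^sub>R p"] show False using p by simp
  qed
  with q0 have q: "q > 0" by simp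
  show thesis
  proof (rule that[of "- (1 / q) *\<^sub>R p" "b / q"])
    fix y
    have "b \<le> p \<bullet> y + q * f y"
    proof (rule field_le_epsilon)
      fix e :: real assume "e > 0"
      then show "b \<le> p \<bullet> y + q * f y + e" using up[of y "f y + e / q"] q by (simp add: algebra_simps)
    qed
    then show "- (1 / q) *\<^sub>R p \<bullet> y + b / q \<le> f y" using q by (simp add: field_simps)
  next
    fix y t assume "(y, t) \<in> C"
    then have "p \<bullet> y + q * t \<le> b" using ab(2) by (auto simp: a)
    then show "t \<le> - (1 / q) *\<^sub>R p \<bullet> y + b / q" using q by (simp add: field_simps)
  qed
qed

lemma convex_subgradient:
  fixes f :: "'a::euclidean_space \<Rightarrow> real"
  assumes "convex_on UNIV f"
  obtains s where "\<And>y. f x + s \<bullet> (y - x) \<le> f y"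
proof -
  obtain s c where s: "\<And>y. s \<bullet> y + c \<le> f y" "\<And>y t. (y, t) \<in> {(x, f x)} \<Longrightarrow> t \<le> s \<bullet> y + c"
    using convex_separating_affine[OF assms, of "{(x, f x)}"] by auto
  show thesis
  proof (rule that)
    fix y show "f x + s \<bullet> (y - x) \<le> f y" using s(1)[of y] s(2)[of x "f x"] by (simp add: inner_simps)
  qed
qed

text \<open>One unit from \<open>x\<close> in the direction of \<open>s\<close> the supporting
  function has risen by \<open>norm s\<close>, while \<open>f\<close> changes by at most
  \<open>2 * c\<close>; hence the margin 1 in the radius.\<close>

lemma subgradient_norm_le:
  fixes f :: "'a::euclidean_space \<Rightarrow> real"
  assumes "\<And>y. f x + s \<bullet> (y - x) \<le> f y" "x \<in> cball 0 r" "\<And>y. y \<in> cball 0 (r + 1) \<Longrightarrow> \<bar>f y\<bar> \<le> c"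
  shows "norm s \<le> 2 * c"
proof (cases "s = 0")
  case True
  have "0 \<le> c" using assms(3)[of x] assms(2) by auto
  then show ?thesis using True by simp
next
  case False
  let ?y = "x + (1 / norm s) *\<^sub>R s"
  have "norm ?y \<le> norm x + norm ((1 / norm s) *\<^sub>R s)" by (rule norm_triangle_ineq)
  also have "\<dots> \<le> r + 1" using assms(2) False by simp
  finally have "\<bar>f ?y\<bar> \<le> c" using assms(3) by simp
  moreover have "\<bar>f x\<bar> \<le> c" using assms(2,3) by simp
  moreover have "s \<bullet> (?y - x) = norm s" using False by (simp add: dot_square_norm power2_eq_square)
  ultimately show ?thesis using assms(1)[of ?y] by linarith
qed

text \<open>The supremum of the affine functions that support \<open>f\<close> at points of the ball
  keeps \<open>f\<close> there, and its slopes are subgradients from the ball, hence bounded. It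
  later replaces a convex function by a globally Lipschitz one without changing the value of a local
  functional.\<close>

lemma convex_Lipschitz_extension:
  fixes f :: "'a::euclidean_space \<Rightarrow> real"
  assumes f: "convex_on UNIV f" and r: "0 \<le> r" and c: "\<And>y. y \<in> cball 0 (r + 1) \<Longrightarrow> \<bar>f y\<bar> \<le> c"
  obtains g where "convex_on UNIV g" "\<And>x y. \<bar>g x - g y\<bar> \<le> 2 * c * norm (x - y)"
    "\<And>x. x \<in> cball 0 r \<Longrightarrow> g x = f x"
proof -
  have "\<exists>s. \<forall>y. f x + s \<bullet> (y - x) \<le> f y" for x
    by (rule convex_subgradient[OF f, of x]) blast
  then obtain s where s: "\<And>x y. f x + s x \<bullet> (y - x) \<le> f y" by metis
  define F where "F z x = f z + s z \<bullet> (x - z)" for z x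
  define g where "g x = (SUP z\<in>cball 0 r. F z x)" for x
  have Fe: "F z = (\<lambda>x. s z \<bullet> x + (f z - s z \<bullet> z))" for z by (auto simp: F_def inner_simps)
  have ne: "cball 0 r \<noteq> ({}::'a set)" using r by auto
  have bdd: "bdd_above ((\<lambda>z. F z x) ` cball 0 r)" for x
    using s by (auto simp: F_def intro!: bdd_aboveI[of _ "f x"])
  have ns: "norm (s z) \<le> 2 * c" if "z \<in> cball 0 r" for z
    using subgradient_norm_le[OF s that c] .
  have lip: "g x \<le> g y + 2 * c * norm (x - y)" for x y
    unfolding g_def
  proof (rule cSUP_least[OF ne])
    fix z :: 'a assume z: "z \<in> cball 0 r"
    have "F z x = F z y + s z \<bullet> (x - y)" by (simp add: F_def inner_simps)
    also have "\<dots> \<le> F z y + norm (s z) * norm (x - y)" using norm_cauchy_schwarz by simp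
    also have "\<dots> \<le> (SUP z\<in>cball 0 r. F z y) + 2 * c * norm (x - y)"
      using z ns by (intro add_mono mult_right_mono cSUP_upper bdd) auto
    finally show "F z x \<le> (SUP z\<in>cball 0 r. F z y) + 2 * c * norm (x - y)" .
  qed
  show thesis
  proof (rule that[of g])
    show "convex_on UNIV g"
      unfolding g_def by (rule convex_on_SUP[OF ne bdd]) (simp add: Fe convex_on_affine)
    show "\<bar>g x - g y\<bar> \<le> 2 * c * norm (x - y)" for x y
      using lip[of x y] lip[of y x] by (simp add: norm_minus_commute abs_le_iff)
    show "g x = f x" if "x \<in> cball 0 r" for x
    proof (rule antisym)
      show "g x \<le> f x" unfolding g_def by (rule cSUP_least[OF ne]) (use s in \<open>auto simp: F_def\<close>)
      have "f x = F x x" by (simp add: F_def)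
      also have "\<dots> \<le> g x" unfolding g_def by (rule cSUP_upper[OF that bdd])
      finally show "f x \<le> g x" .
    qed
  qed
qed

lemma convex_Lipschitz_on_cball:
  fixes f :: "'a::euclidean_space \<Rightarrow> real"
  assumes f: "convex_on UNIV f" and r: "0 \<le> r" and c: "\<And>y. y \<in> cball 0 (r + 1) \<Longrightarrow> \<bar>f y\<bar> \<le> c"
    and xy: "x \<in> cball 0 r" "y \<in> cball 0 r"
  shows "\<bar>f x - f y\<bar> \<le> 2 * c * norm (x - y)"
proof -
  obtain g where "\<And>x y. \<bar>g x - g y\<bar> \<le> 2 * c * norm (x - y)" "\<And>x. x \<in> cball 0 r \<Longrightarrow> g x = f x"
    using convex_Lipschitz_extension[OF f r c] by metis
  then show ?thesis using xy by metis
qed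

text \<open>Pointwise bounds suffice because convexity bounds every member above on a cube by its
  values at the finitely many vertices; the midpoint inequality at \<open>0\<close> for
  \<open>y\<close> and \<open>- y\<close> turns this into a lower bound.\<close>

lemma convex_family_bounded_on_cball:
  fixes F :: "('a::euclidean_space \<Rightarrow> real) set"
  assumes F: "\<And>f. f \<in> F \<Longrightarrow> convex_on UNIV f" and b: "\<And>y. \<exists>c. \<forall>f\<in>F. \<bar>f y\<bar> \<le> c"
  obtains c where "\<And>f y. f \<in> F \<Longrightarrow> y \<in> cball 0 r \<Longrightarrow> \<bar>f y\<bar> \<le> c"
proof -
  obtain b where b: "\<And>y f. f \<in> F \<Longrightarrow> \<bar>f y\<bar> \<le> b y" using b by metis
  define d where "d = \<bar>r\<bar> + 1"
  have d: "d > 0" by (simp add: d_def)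
  obtain S :: "'a set" where S: "finite S"
    "cbox (0 - (\<Sum>i\<in>Basis. d *\<^sub>R i)) (0 + (\<Sum>i\<in>Basis. d *\<^sub>R i)) = convex hull S"
    using cube_convex_hull[OF d] by blast
  have sub: "cball 0 r \<subseteq> convex hull S"
  proof
    fix y :: 'a assume "y \<in> cball 0 r"
    then have "norm y \<le> d" by (simp add: d_def)
    then have "\<bar>y \<bullet> i\<bar> \<le> d" if "i \<in> Basis" for i using Basis_le_norm[OF that] order_trans by blast
    then have "y \<in> cbox (0 - (\<Sum>i\<in>Basis. d *\<^sub>R i)) (0 + (\<Sum>i\<in>Basis. d *\<^sub>R i))"
      by (simp add: mem_box abs_le_iff inner_sum_left sum.delta inner_Basis if_distrib cong: if_cong)
         (metis (no_types, lifting) minus_le_iff)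
    then show "y \<in> convex hull S" by (simp only: S(2))
  qed
  define M where "M = (\<Sum>v\<in>S. b v)"
  have up: "f y \<le> \<bar>M\<bar>" if f: "f \<in> F" and y: "y \<in> cball 0 r" for f y
  proof -
    have "\<forall>v\<in>S. f v \<le> \<bar>M\<bar>"
    proof
      fix v assume "v \<in> S"
      have "b v \<le> M" unfolding M_def
        by (rule member_le_sum[OF \<open>v \<in> S\<close> _ S(1)]) (use b[OF f] abs_ge_zero order_trans in blast)
      then show "f v \<le> \<bar>M\<bar>" using b[OF f, of v] by linarith
    qed
    then have "\<forall>x\<in>convex hull S. f x \<le> \<bar>M\<bar>"
      by (intro convex_on_convex_hull_bound convex_on_subset[OF F[OF f]]) auto
    then show ?thesis using sub y by blast
  qed
  show thesis
  proof (rule that[of "\<bar>M\<bar> + 2 * b 0"])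
    fix f :: "'a \<Rightarrow> real" and y :: 'a assume f: "f \<in> F" and y: "y \<in> cball 0 r"
    have "f ((1 - 1/2) *\<^sub>R y + (1/2) *\<^sub>R (- y)) \<le> (1 - 1/2) * f y + (1/2) * f (- y)"
      using F[OF f, unfolded convex_on_UNIV_iff_segment, rule_format, of "1/2" y "- y"] by simp
    then have "2 * f 0 \<le> f y + f (- y)" by simp
    moreover have "f (- y) \<le> \<bar>M\<bar>" "f y \<le> \<bar>M\<bar>" using up[OF f] y by auto
    ultimately show "\<bar>f y\<bar> \<le> \<bar>M\<bar> + 2 * b 0" using b[OF f, of 0] by linarith
  qed
qed

lemma convex_bounded_on_cball:
  fixes f :: "'a::euclidean_space \<Rightarrow> real"
  assumes "convex_on UNIV f"
  obtains c where "\<And>y. y \<in> cball 0 r \<Longrightarrow> \<bar>f y\<bar> \<le> c"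
  using convex_family_bounded_on_cball[of "{f}"] assms by (metis order_refl singletonD singletonI)

text \<open>On a ball the functions share one bound and hence one Lipschitz constant, so convergence
  on a finite net is enough.\<close>

lemma convex_pointwise_imp_uniform:
  fixes F :: "nat \<Rightarrow> 'a::euclidean_space \<Rightarrow> real"
  assumes F: "\<And>j. convex_on UNIV (F j)" and lim: "\<And>x. (\<lambda>j. F j x) \<longlonglongrightarrow> f x" and e: "e > 0"
  shows "\<forall>\<^sub>F j in sequentially. \<forall>x\<in>cball 0 r. \<bar>F j x - f x\<bar> < e"
proof -
  define r' where "r' = \<bar>r\<bar>"
  have r': "0 \<le> r'" "cball 0 r \<subseteq> cball (0::'a) r'" by (auto simp: r'_def)
  have f: "convex_on UNIV f" by (rule convex_on_lim[OF F lim])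
  have "\<exists>c. \<forall>g\<in>insert f (range F). \<bar>g y\<bar> \<le> c" for y
  proof -
    obtain K where K: "\<And>j. norm (F j y) \<le> K"
      using convergent_imp_Bseq[OF convergentI[OF lim[of y]]] by (metis BseqE)
    then show ?thesis by (intro exI[of _ "max K \<bar>f y\<bar>"]) (auto simp: max.coboundedI1)
  qed
  then obtain c where c: "\<And>g y. g \<in> insert f (range F) \<Longrightarrow> y \<in> cball 0 (r' + 1) \<Longrightarrow> \<bar>g y\<bar> \<le> c"
    using convex_family_bounded_on_cball[of "insert f (range F)" "r' + 1"] F f by (metis insertE rangeE)
  have lip: "\<bar>g x - g y\<bar> \<le> 2 * c * norm (x - y)"
    if "g \<in> insert f (range F)" "x \<in> cball 0 r'" "y \<in> cball 0 r'" for g x y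
    by (rule convex_Lipschitz_on_cball[OF _ r'(1) c[OF that(1)] that(2,3)]) (use that F f in auto)
  have "c \<ge> 0" using c[of f 0] r'(1) by force
  \<comment> \<open>Three errors occur: two changes over a distance \<open>d\<close>, each at most
    \<open>2 * c * d\<close> and so at most \<open>e / 4\<close>, and the error at a net point. The
    summand 1 covers \<open>c = 0\<close>.\<close>
  define d where "d = e / (8 * c + 1)"
  have d: "d > 0" using e \<open>c \<ge> 0\<close> by (simp add: d_def)
  have "2 * c * d \<le> e / 4" unfolding d_def using \<open>c \<ge> 0\<close> e by (simp add: field_simps)
  obtain K where K: "finite K" "K \<subseteq> cball (0::'a) r'" "cball 0 r' \<subseteq> (\<Union>x\<in>K. ball x d)"
    using compact_imp_seq_compact[OF compact_cball] seq_compact_imp_totally_bounded d by metis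
  have "\<forall>\<^sub>F j in sequentially. \<forall>x\<in>K. \<bar>F j x - f x\<bar> < e / 4"
  proof (intro eventually_ball_finite[OF K(1)] ballI)
    fix x :: 'a show "\<forall>\<^sub>F j in sequentially. \<bar>F j x - f x\<bar> < e / 4"
      using tendstoD[OF lim[of x], of "e / 4"] e by (simp add: dist_real_def)
  qed
  then show ?thesis
  proof (rule eventually_mono, intro ballI)
    fix j and x :: 'a assume j: "\<forall>x\<in>K. \<bar>F j x - f x\<bar> < e / 4" and x: "x \<in> cball 0 r"
    then obtain z where z: "z \<in> K" "x \<in> ball z d" using K(3) r'(2) by blast
    have zx: "z \<in> cball 0 r'" "x \<in> cball 0 r'" using z K(2) x r'(2) by auto
    have "2 * c * norm (x - z) \<le> 2 * c * d"
      using z(2) \<open>c \<ge> 0\<close> by (intro mult_left_mono) (auto simp: dist_norm norm_minus_commute)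
    then have "2 * c * norm (x - z) \<le> e / 4" using \<open>2 * c * d \<le> e / 4\<close> by simp
    then have "\<bar>F j x - F j z\<bar> \<le> e / 4" "\<bar>f x - f z\<bar> \<le> e / 4"
      using lip[of "F j" x z] lip[of f x z] zx by (auto intro: order_trans)
    then show "\<bar>F j x - f x\<bar> < e" using j[rule_format, OF z(1)] by linarith
  qed
qed

text \<open>Arzela--Ascoli on the whole space: a subsequence converges on a countable dense set, and
  the common Lipschitz bound carries the Cauchy property to every point.\<close>

lemma Lipschitz_convex_subsequence:
  fixes F :: "nat \<Rightarrow> 'a::euclidean_space \<Rightarrow> real"
  assumes F: "\<And>j. convex_on UNIV (F j)" and lip: "\<And>j x y. \<bar>F j x - F j y\<bar> \<le> norm (x - y)"
    and zero: "\<And>j. \<bar>F j 0\<bar> \<le> 1"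
  obtains r f where "strict_mono (r :: nat \<Rightarrow> nat)" "convex_on UNIV f" "\<And>x. (\<lambda>j. F (r j) x) \<longlonglongrightarrow> f x"
proof -
  obtain D :: "'a set" where D: "countable D" "\<And>X. open X \<Longrightarrow> X \<noteq> {} \<Longrightarrow> \<exists>d \<in> D. d \<in> X"
    using countable_dense_setE by metis
  have bd: "\<bar>F j x\<bar> \<le> 1 + norm x" for j x using lip[of j x 0] zero[of j] by simp
  \<comment> \<open>The extraction asks for one bound at all points of the countable set; dividing
    by \<open>1 + norm x\<close> provides it, and the factor is removed again afterwards.\<close>
  have "norm (F j x / (1 + norm x)) \<le> 1" for j x
  proof -
    have "0 < 1 + norm x" by (simp add: add_pos_nonneg)
    then show ?thesis using bd[of j x] by (simp add: field_simps)
  qed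
  then obtain r where r: "strict_mono (r :: nat \<Rightarrow> nat)"
    "\<And>x. x \<in> D \<Longrightarrow> \<exists>l. (\<lambda>n. F (r n) x / (1 + norm x)) \<longlonglongrightarrow> l"
    using function_convergent_subsequence[OF D(1), of "\<lambda>j x. F j x / (1 + norm x)" 1] by metis
  have conv: "convergent (\<lambda>n. F (r n) x)" if x: "x \<in> D" for x
  proof -
    obtain l where "(\<lambda>n. F (r n) x / (1 + norm x)) \<longlonglongrightarrow> l" using r(2)[OF x] by blast
    then have "(\<lambda>n. F (r n) x / (1 + norm x) * (1 + norm x)) \<longlonglongrightarrow> l * (1 + norm x)"
      by (rule tendsto_mult_right)
    moreover have "1 + norm x \<noteq> 0" by (metis add_pos_nonneg less_irrefl norm_ge_zero zero_less_one)
    ultimately show ?thesis by (auto simp: convergent_def)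
  qed
  have "Cauchy (\<lambda>n. F (r n) x)" for x
  proof (rule metric_CauchyI)
    fix e :: real assume "e > 0"
    then obtain z where z: "z \<in> D" "z \<in> ball x (e / 3)" using D(2)[of "ball x (e / 3)"] by auto
    obtain N where N: "\<And>m n. m \<ge> N \<Longrightarrow> n \<ge> N \<Longrightarrow> dist (F (r m) z) (F (r n) z) < e / 3"
      using metric_CauchyD[OF convergent_Cauchy[OF conv[OF z(1)]], of "e / 3"] \<open>e > 0\<close> by auto
    have *: "\<bar>F (r m) x - F (r m) z\<bar> < e / 3" for m
      using lip[of "r m" x z] z(2) by (simp add: dist_norm)
    have "dist (F (r m) x) (F (r n) x) < e" if "m \<ge> N" "n \<ge> N" for m n
      using N[OF that] *[of m] *[of n] unfolding dist_real_def by linarith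
    then show "\<exists>M. \<forall>m\<ge>M. \<forall>n\<ge>M. dist (F (r m) x) (F (r n) x) < e" by blast
  qed
  then have "\<exists>l. (\<lambda>n. F (r n) x) \<longlonglongrightarrow> l" for x
    by (meson Cauchy_convergent_iff convergent_def)
  then obtain f where f: "\<And>x. (\<lambda>n. F (r n) x) \<longlonglongrightarrow> f x" by metis
  show thesis by (rule that[OF r(1) convex_on_lim[OF F f] f])
qed

text \<open>Supporting functions at a dense set are enough, since subgradients are locally bounded.
  Countability lets the maximum be built by adding one affine function at a time.\<close>

lemma convex_countable_affine_minorants:
  fixes f :: "'a::euclidean_space \<Rightarrow> real"
  assumes f: "convex_on UNIV f"
  obtains a b where "\<And>(i::nat) y. a i \<bullet> y + b i \<le> f y" "\<And>y e. e > 0 \<Longrightarrow> \<exists>i. f y - e < a i \<bullet> y + b i"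
proof -
  obtain D :: "'a set" where D: "countable D" "\<And>X. open X \<Longrightarrow> X \<noteq> {} \<Longrightarrow> \<exists>d \<in> D. d \<in> X"
    using countable_dense_setE by metis
  have "D \<noteq> {}" using D(2)[of UNIV] by auto
  then have D': "range (from_nat_into D) = D" using D(1) by (rule range_from_nat_into)
  have "\<exists>s. \<forall>y. f x + s \<bullet> (y - x) \<le> f y" for x
    by (rule convex_subgradient[OF f, of x]) blast
  then obtain s where s: "\<And>x y. f x + s x \<bullet> (y - x) \<le> f y" by metis
  let ?x = "from_nat_into D"
  show thesis
  proof (rule that[of "\<lambda>i. s (?x i)" "\<lambda>i. f (?x i) - s (?x i) \<bullet> ?x i"])
    fix i y show "s (?x i) \<bullet> y + (f (?x i) - s (?x i) \<bullet> ?x i) \<le> f y"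
      using s[of "?x i" y] by (simp add: inner_simps)
  next
    fix y :: 'a and e :: real assume e: "e > 0"
    define r where "r = norm y + 1"
    obtain c where c: "\<And>z. z \<in> cball 0 (r + 1) \<Longrightarrow> \<bar>f z\<bar> \<le> c"
      using convex_bounded_on_cball[OF f] by metis
    have c0: "c \<ge> 0" using c[of 0] by (force simp: r_def)
    \<comment> \<open>From \<open>y\<close> to \<open>z\<close> both \<open>f\<close> and the
      supporting function change by at most \<open>2 * c * d\<close>, so
      \<open>4 * c * d < e\<close> is wanted; \<open>d \<le> 1\<close> keeps \<open>z\<close> in the
      ball of radius \<open>r\<close>.\<close>
    define d where "d = min 1 (e / (4 * c + 1))"
    have d: "d > 0" using e c0 by (simp add: d_def)
    have "4 * c * d \<le> 4 * c * (e / (4 * c + 1))"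
      using c0 by (intro mult_left_mono) (auto simp: d_def)
    also have "\<dots> < e" using c0 e by (simp add: field_simps)
    finally have cd: "4 * c * d < e" .
    obtain z where z: "z \<in> D" "z \<in> ball y d" using D(2)[of "ball y d"] d by auto
    then obtain i where i: "z = ?x i" using D' by blast
    have "norm z \<le> norm y + norm (z - y)" by norm
    then have zr: "z \<in> cball 0 r" using z(2) by (auto simp: dist_norm norm_minus_commute r_def d_def)
    have yr: "y \<in> cball 0 r" by (simp add: r_def)
    have "\<bar>s z \<bullet> (y - z)\<bar> \<le> norm (s z) * norm (y - z)" by (rule Cauchy_Schwarz_ineq2)
    also have "\<dots> \<le> 2 * c * d"
      using subgradient_norm_le[OF s zr c] z(2) c0 by (intro mult_mono) (auto simp: dist_norm)
    finally have "- (2 * c * d) \<le> s z \<bullet> (y - z)" by linarith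
    moreover have "\<bar>f y - f z\<bar> \<le> 2 * c * norm (y - z)"
      by (rule convex_Lipschitz_on_cball[OF f _ c yr zr]) (auto simp: r_def)
    moreover have "2 * c * norm (y - z) \<le> 2 * c * d"
      using z(2) c0 by (intro mult_left_mono) (auto simp: dist_norm)
    ultimately have "f y - e < s z \<bullet> y + (f z - s z \<bullet> z)"
      using cd by (simp only: inner_diff_right)
    then show "\<exists>i. f y - e < s (?x i) \<bullet> y + (f (?x i) - s (?x i) \<bullet> ?x i)" using i by blast
  qed
qed

subsection \<open>The Legendre transform\<close>

text \<open>By \<open>fenchel_le_iff\<close> the real upper bounds of a transform correspond to
  affine minorants. Comparing extended reals through these bounds keeps suprema and differences of
  infinities out of the identities below.\<close>

lemma ereal_eqI_upper:
  fixes a b :: ereal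
  assumes "\<And>c. a \<le> ereal c \<longleftrightarrow> b \<le> ereal c"
  shows "a = b"
proof (rule antisym)
  show "a \<le> b"
  proof (rule ereal_le_real)
    fix z assume "b \<le> ereal z" then show "a \<le> ereal z" using assms by simp
  qed
  show "b \<le> a"
  proof (rule ereal_le_real)
    fix z assume "a \<le> ereal z" then show "b \<le> ereal z" using assms by simp
  qed
qed

lemma fenchel_le_iff: "fenchel u y \<le> ereal c \<longleftrightarrow> (\<forall>x. ereal (x \<bullet> y - c) \<le> u x)"
proof -
  have "ereal (x \<bullet> y) - u x \<le> ereal c \<longleftrightarrow> ereal (x \<bullet> y - c) \<le> u x" for x
    by (cases "u x") auto
  then show ?thesis unfolding fenchel_def SUP_le_iff by simp
qed

lemma fenchel_ge: "ereal (x \<bullet> y - f x) \<le> fenchel (\<lambda>x. ereal (f x)) y"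
  unfolding fenchel_def by (rule SUP_upper2[of x]) auto

definition real_fenchel :: "(real^'n \<Rightarrow> ereal) \<Rightarrow> real^'n \<Rightarrow> real" where
  "real_fenchel u y = real_of_ereal (fenchel u y)"

lemma Conv_le_convex:
  assumes u: "u \<in> Conv" and "u x \<le> ereal a" "u y \<le> ereal b" and t: "0 \<le> t" "t \<le> 1"
  shows "u ((1 - t) *\<^sub>R x + t *\<^sub>R y) \<le> ereal ((1 - t) * a + t * b)"
proof -
  have "u ((1 - t) *\<^sub>R x + t *\<^sub>R y) \<le> ereal (1 - t) * u x + ereal t * u y"
    using u t by (auto simp: Conv_def)
  also have "\<dots> \<le> ereal (1 - t) * ereal a + ereal t * ereal b"
    using t assms(2,3) by (intro add_mono ereal_mult_left_mono) auto
  finally show ?thesis by simp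
qed

lemma Conv_lsc:
  assumes u: "u \<in> Conv" and m: "m < u x"
  shows "\<forall>\<^sub>F y in nhds x. m < u y"
proof -
  have "u x \<le> Liminf (at x) u" using u by (auto simp: Conv_def)
  then have "\<forall>\<^sub>F y in at x. m < u y" using m by (auto simp: le_Liminf_iff)
  then show ?thesis using m by (auto simp: eventually_at_filter elim: eventually_mono)
qed

lemma closed_epigraph_Conv:
  assumes u: "u \<in> Conv"
  shows "closed {(x, t). u x \<le> ereal t}"
  unfolding closed_sequential_limits
proof (intro allI impI, elim conjE)
  fix p and l :: "(real^'a) \<times> real" assume p: "\<forall>n. p n \<in> {(x, t). u x \<le> ereal t}" and lim: "p \<longlonglongrightarrow> l"
  have le: "u (fst (p n)) \<le> ereal (snd (p n))" for n using p by (auto simp: split_beta)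
  have "u (fst l) \<le> ereal (snd l)"
  proof (rule ccontr)
    assume "\<not> ?thesis"
    then obtain m where m: "ereal (snd l) < m" "m < u (fst l)" using dense not_le by metis
    have "\<forall>\<^sub>F n in sequentially. m < u (fst (p n))"
      by (rule eventually_compose_filterlim[OF Conv_lsc[OF u m(2)] tendsto_fst[OF lim]])
    moreover have "\<forall>\<^sub>F n in sequentially. ereal (snd (p n)) < m"
      by (rule order_tendstoD(2)[OF tendsto_ereal[OF tendsto_snd[OF lim]] m(1)])
    ultimately have "\<forall>\<^sub>F n in sequentially. False"
    proof eventually_elim
      case (elim n)
      then show False using le[of n] by (meson less_trans not_le)
    qed
    then show False by simp
  qed
  then show "l \<in> {(x, t). u x \<le> ereal t}" by (simp add: split_beta)
qed

lemma convex_epigraph_Conv: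
  assumes u: "u \<in> Conv"
  shows "convex {(x, t). u x \<le> ereal t}"
  unfolding convex_alt
  by (auto intro: Conv_le_convex[OF u])

lemma Conv_ereal:
  assumes f: "convex_on UNIV f"
  shows "(\<lambda>x. ereal (f x)) \<in> Conv"
  unfolding Conv_def
proof (intro CollectI conjI allI ballI)
  fix x y t assume "t \<in> {0..1::real}"
  then show "ereal (f ((1 - t) *\<^sub>R x + t *\<^sub>R y)) \<le> ereal (1 - t) * ereal (f x) + ereal t * ereal (f y)"
    using f by (simp add: convex_on_UNIV_iff_segment)
next
  fix x
  have "isCont f x" using convex_continuous[OF f, of UNIV] by (simp add: continuous_on_eq_continuous_at)
  then have "((\<lambda>x. ereal (f x)) \<longlongrightarrow> ereal (f x)) (at x)" by (simp add: isCont_def)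
  then have "Liminf (at x) (\<lambda>x. ereal (f x)) = ereal (f x)" by (intro lim_imp_Liminf) auto
  then show "ereal (f x) \<le> Liminf (at x) (\<lambda>x. ereal (f x))" by (simp only: order_refl)
qed auto

text \<open>Finiteness of \<open>f\<close> is dual to superlinear growth: testing the supremum at
  the point of norm \<open>K\<close> in the direction of \<open>x\<close> gives the lower bound
  \<open>K * norm x - c\<close>, where \<open>c\<close> bounds \<open>f\<close> on the ball of
  radius \<open>K\<close>.\<close>

lemma fenchel_in_Conv_sc:
  fixes f :: "real^'n \<Rightarrow> real"
  assumes f: "convex_on UNIV f"
  shows "fenchel (\<lambda>x. ereal (f x)) \<in> Conv_sc"
proof -
  let ?F = "fenchel (\<lambda>x. ereal (f x))"
  have F: "?F x = (SUP z. ereal (z \<bullet> x - f z))" for x by (simp add: fenchel_def)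
  have "?F \<in> Conv"
    unfolding Conv_def
  proof (intro CollectI conjI allI ballI)
    fix x show "?F x \<noteq> -\<infinity>" using fenchel_ge[of 0 x f] by auto
  next
    obtain s where s: "\<And>y. f 0 + s \<bullet> (y - 0) \<le> f y" using convex_subgradient[OF f] by metis
    have "?F s \<le> ereal (- f 0)"
      unfolding fenchel_le_iff using s by (auto simp: inner_commute add.commute)
    then show "\<exists>x. ?F x \<noteq> \<infinity>" by (intro exI[of _ s]) auto
  next
    fix x y and t :: real assume t: "t \<in> {0..1}"
    show "?F ((1 - t) *\<^sub>R x + t *\<^sub>R y) \<le> ereal (1 - t) * ?F x + ereal t * ?F y"
      unfolding F[of "(1 - t) *\<^sub>R x + t *\<^sub>R y"]
    proof (rule SUP_least)
      fix z
      have "ereal (z \<bullet> ((1 - t) *\<^sub>R x + t *\<^sub>R y) - f z)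
          = ereal (1 - t) * ereal (z \<bullet> x - f z) + ereal t * ereal (z \<bullet> y - f z)"
        by (simp add: inner_simps algebra_simps)
      also have "\<dots> \<le> ereal (1 - t) * ?F x + ereal t * ?F y"
        using t by (intro add_mono ereal_mult_left_mono fenchel_ge) auto
      finally show "ereal (z \<bullet> ((1 - t) *\<^sub>R x + t *\<^sub>R y) - f z) \<le> \<dots>" .
    qed
  next
    fix x
    show "?F x \<le> Liminf (at x) ?F"
      unfolding F[of x]
    proof (rule SUP_least)
      fix z
      have "((\<lambda>x. ereal (z \<bullet> x - f z)) \<longlongrightarrow> ereal (z \<bullet> x - f z)) (at x)"
        by (intro tendsto_intros)
      then have "ereal (z \<bullet> x - f z) = Liminf (at x) (\<lambda>x. ereal (z \<bullet> x - f z))"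
        by (intro lim_imp_Liminf[symmetric]) auto
      also have "\<dots> \<le> Liminf (at x) ?F" by (intro Liminf_mono always_eventually allI fenchel_ge)
      finally show "ereal (z \<bullet> x - f z) \<le> Liminf (at x) ?F" .
    qed
  qed
  moreover have "((\<lambda>x. ?F x / ereal (norm x)) \<longlongrightarrow> \<infinity>) at_infinity"
    unfolding tendsto_PInfty
  proof
    fix r :: real
    \<comment> \<open>The surplus 1 over \<open>\<bar>r\<bar>\<close> outweighs \<open>c\<close> as
      soon as \<open>norm x \<ge> c + 1\<close>.\<close>
    define K where "K = \<bar>r\<bar> + 1"
    obtain c where c: "\<And>y. y \<in> cball 0 K \<Longrightarrow> \<bar>f y\<bar> \<le> c" using convex_bounded_on_cball[OF f] by metis
    have c0: "c \<ge> 0" using c[of 0] by (force simp: K_def)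
    show "\<forall>\<^sub>F x in at_infinity. ereal r < ?F x / ereal (norm x)"
      unfolding eventually_at_infinity
    proof (intro exI[of _ "c + 1"] allI impI)
      fix x :: "real^'n" assume x: "c + 1 \<le> norm x"
      then have nx: "norm x > 0" using c0 by linarith
      let ?y = "(K / norm x) *\<^sub>R x"
      have "f ?y \<le> c" using c[of ?y] nx by (auto simp: K_def)
      moreover have "?y \<bullet> x = K * norm x" using nx by (simp add: dot_square_norm power2_eq_square)
      ultimately have "ereal (K * norm x - c) \<le> ?F x"
        using fenchel_ge[of ?y x f] by (metis diff_left_mono ereal_less_eq(3) order_trans)
      then have "ereal (K * norm x - c) / ereal (norm x) \<le> ?F x / ereal (norm x)"
        using nx by (intro ereal_divide_right_mono) auto
      moreover have "ereal (K * norm x - c) / ereal (norm x) = ereal ((K * norm x - c) / norm x)"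
        using nx by simp
      moreover have "r < (K * norm x - c) / norm x"
      proof -
        have "r * norm x \<le> \<bar>r\<bar> * norm x" using nx by (intro mult_right_mono) auto
        then show ?thesis
          using x unfolding pos_less_divide_eq[OF nx] K_def distrib_right by linarith
      qed
      ultimately show "ereal r < ?F x / ereal (norm x)"
        by (metis less_ereal.simps(1) less_le_trans)
    qed
  qed
  ultimately show ?thesis by (simp add: Conv_sc_def)
qed

text \<open>Far away superlinear growth beats the slope \<open>K\<close>; on the remaining ball
  lower semicontinuity and compactness give a bound. As \<open>K\<close> is arbitrary,
  \<open>u\<close> has an affine minorant of every slope, which makes its transform finite.\<close>

lemma Conv_sc_lower_bound:
  assumes u: "u \<in> Conv_sc"
  obtains c where "\<And>x. ereal (K * norm x - c) \<le> u x"
proof -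
  have uC: "u \<in> Conv" and lim: "((\<lambda>x. u x / ereal (norm x)) \<longlongrightarrow> \<infinity>) at_infinity"
    using u by (auto simp: Conv_sc_def)
  obtain b where b: "\<And>x. b \<le> norm x \<Longrightarrow> ereal K < u x / ereal (norm x)"
    using lim unfolding tendsto_PInfty eventually_at_infinity by metis
  define R where "R = max b 1"
  have far: "ereal (K * norm x) \<le> u x" if "R \<le> norm x" for x
  proof (cases "u x")
    case (real r)
    have "x \<noteq> 0" using that by (auto simp: R_def)
    then have "K < r / norm x" using b[of x] that real by (simp add: R_def)
    then have "K * norm x < r" using \<open>x \<noteq> 0\<close> by (simp add: pos_less_divide_eq)
    then show ?thesis using real by simp
  next
    case MInf
    then show ?thesis using uC by (auto simp: Conv_def)
  qed simp
  have "\<exists>m U. open U \<and> x \<in> U \<and> (\<forall>y\<in>U. ereal m < u y)" for x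
  proof -
    have "-\<infinity> < u x" using uC by (simp add: Conv_def)
    then obtain m where "ereal m < u x" using ereal_dense2 by blast
    then show ?thesis using Conv_lsc[OF uC, of "ereal m" x] unfolding eventually_nhds by blast
  qed
  then obtain m U where mU: "\<And>x. open (U x)" "\<And>x. x \<in> U x" "\<And>x y. y \<in> U x \<Longrightarrow> ereal (m x) < u y" by metis
  obtain D where D: "D \<subseteq> cball 0 R" "finite D" "cball 0 R \<subseteq> (\<Union>x\<in>D. U x)"
    by (rule compactE_image[OF compact_cball, of "cball 0 R" U]) (use mU in auto)
  \<comment> \<open>The first summand pays for \<open>K * norm x\<close> on the ball, the second
    lies beyond all the finitely many local lower bounds.\<close>
  define c where "c = \<bar>K\<bar> * R + (\<Sum>x\<in>D. \<bar>m x\<bar>)"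
  show thesis
  proof (rule that)
    fix x
    have s: "0 \<le> (\<Sum>x\<in>D. \<bar>m x\<bar>)" by (simp add: sum_nonneg)
    show "ereal (K * norm x - c) \<le> u x"
    proof (cases "R \<le> norm x")
      case True
      have "0 \<le> c" using s by (auto simp: c_def R_def)
      then have "ereal (K * norm x - c) \<le> ereal (K * norm x)" by simp
      then show ?thesis using far[OF True] by (rule order_trans)
    next
      case False
      then have "x \<in> cball 0 R" by simp
      then obtain z where z: "z \<in> D" "x \<in> U z" using D(3) by blast
      have "\<bar>m z\<bar> \<le> (\<Sum>x\<in>D. \<bar>m x\<bar>)" by (rule member_le_sum[OF z(1) _ D(2)]) auto
      moreover have "K * norm x \<le> \<bar>K\<bar> * R" using False by (intro mult_mono) auto
      ultimately have "K * norm x - c \<le> m z" by (simp add: c_def)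
      then show ?thesis using mU(3)[OF z(2)] by (metis ereal_less_eq(3) less_imp_le order_trans)
    qed
  qed
qed

lemma fenchel_eq_ereal:
  assumes u: "u \<in> Conv_sc"
  shows "fenchel u y = ereal (real_fenchel u y)"
proof -
  obtain c where c: "\<And>x. ereal (norm y * norm x - c) \<le> u x" using Conv_sc_lower_bound[OF u] by metis
  have "fenchel u y \<le> ereal c"
    unfolding fenchel_le_iff
  proof
    fix x
    have "x \<bullet> y - c \<le> norm y * norm x - c" using norm_cauchy_schwarz[of x y] by (simp add: mult.commute)
    then show "ereal (x \<bullet> y - c) \<le> u x" using c[of x] by (metis ereal_less_eq(3) order_trans)
  qed
  moreover have "fenchel u y \<noteq> -\<infinity>"
  proof
    obtain x where x: "u x \<noteq> \<infinity>" "u x \<noteq> -\<infinity>" using u by (auto simp: Conv_sc_def Conv_def)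
    assume "fenchel u y = -\<infinity>"
    moreover have "ereal (x \<bullet> y) - u x \<le> fenchel u y" unfolding fenchel_def by (rule SUP_upper) simp
    ultimately show False using x by (cases "u x") auto
  qed
  ultimately show ?thesis unfolding real_fenchel_def by (cases "fenchel u y") auto
qed

lemma real_fenchel_le_iff: "u \<in> Conv_sc \<Longrightarrow> real_fenchel u y \<le> c \<longleftrightarrow> (\<forall>x. ereal (x \<bullet> y - c) \<le> u x)"
  using fenchel_le_iff[of u y c] by (simp add: fenchel_eq_ereal)

lemma Fenchel_inequality: "u \<in> Conv_sc \<Longrightarrow> ereal (x \<bullet> y - real_fenchel u y) \<le> u x"
  using real_fenchel_le_iff[of u y "real_fenchel u y"] by simp

lemma convex_on_real_fenchel:
  assumes u: "u \<in> Conv_sc"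
  shows "convex_on UNIV (real_fenchel u)"
  unfolding convex_on_UNIV_iff_segment real_fenchel_le_iff[OF u]
proof (intro allI impI)
  fix a b and t :: real and x assume t: "0 \<le> t" "t \<le> 1"
  show "ereal (x \<bullet> ((1 - t) *\<^sub>R a + t *\<^sub>R b) - ((1 - t) * real_fenchel u a + t * real_fenchel u b)) \<le> u x"
  proof (cases "u x")
    case (real r)
    have "(1 - t) * (x \<bullet> a - real_fenchel u a) + t * (x \<bullet> b - real_fenchel u b) \<le> (1 - t) * r + t * r"
      using Fenchel_inequality[OF u, of x] real t by (intro add_mono mult_left_mono) auto
    then show ?thesis using real by (simp add: inner_simps algebra_simps)
  next
    case MInf
    then show ?thesis using u by (auto simp: Conv_sc_def Conv_def)
  qed simp
qed

text \<open>Fenchel--Moreau: a point strictly below the graph is separated from the closed convex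
  epigraph. By \<open>key\<close> an affine minorant of \<open>u\<close> above
  \<open>\<alpha>\<close> at \<open>x0\<close> suffices, and a non-vertical hyperplane is the graph
  of one.\<close>

lemma fenchel_involution:
  assumes u: "u \<in> Conv_sc"
  shows "fenchel (\<lambda>y. ereal (real_fenchel u y)) = u"
proof
  fix x0
  have uC: "u \<in> Conv" using u by (simp add: Conv_sc_def)
  show "fenchel (\<lambda>y. ereal (real_fenchel u y)) x0 = u x0"
  proof (rule antisym)
    show "fenchel (\<lambda>y. ereal (real_fenchel u y)) x0 \<le> u x0"
      unfolding fenchel_def using Fenchel_inequality[OF u, of x0] by (intro SUP_least) (simp add: inner_commute)
    have key: "ereal \<alpha> < fenchel (\<lambda>y. ereal (real_fenchel u y)) x0" if y: "\<And>x. ereal (x \<bullet> y - c) \<le> u x" "\<alpha> < x0 \<bullet> y - c" for \<alpha> y c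
    proof -
      have "real_fenchel u y \<le> c" using y(1) by (simp add: real_fenchel_le_iff[OF u])
      then have "\<alpha> < y \<bullet> x0 - real_fenchel u y" using y(2) by (simp add: inner_commute)
      then show ?thesis using fenchel_ge[of y x0 "real_fenchel u"] by (metis less_ereal.simps(1) less_le_trans)
    qed
    show "u x0 \<le> fenchel (\<lambda>y. ereal (real_fenchel u y)) x0"
    proof (rule ccontr)
      assume "\<not> ?thesis"
      then obtain \<alpha> where \<alpha>: "fenchel (\<lambda>y. ereal (real_fenchel u y)) x0 < ereal \<alpha>" "ereal \<alpha> < u x0"
        using ereal_dense2 not_le by metis
      let ?E = "{(x, t). u x \<le> ereal t}"
      have "(x0, \<alpha>) \<notin> ?E" using \<alpha>(2) by auto
      then obtain P b where P: "P \<bullet> (x0, \<alpha>) < b" "\<forall>z\<in>?E. b < P \<bullet> z"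
        using separating_hyperplane_closed_point[OF convex_epigraph_Conv[OF uC] closed_epigraph_Conv[OF uC]] by blast
      obtain p q where pq: "P = (p, q)" by (cases P)
      have below: "p \<bullet> x0 + q * \<alpha> < b" using P(1) by (simp add: pq)
      have above: "b < p \<bullet> x + q * t" if "u x \<le> ereal t" for x t using P(2) that by (auto simp: pq)
      obtain x1 where "u x1 \<noteq> \<infinity>" "u x1 \<noteq> -\<infinity>" using uC by (auto simp: Conv_def)
      then obtain t1 where t1: "u x1 = ereal t1" by (cases "u x1") auto
      have q: "q \<ge> 0"
      proof (rule ccontr)
        assume "\<not> q \<ge> 0"
        then have q: "q < 0" by simp
        define t where "t = max t1 ((b - p \<bullet> x1) / q)"
        have "b < p \<bullet> x1 + q * t" by (rule above) (simp add: t1 t_def)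
        moreover have "q * t \<le> q * ((b - p \<bullet> x1) / q)"
          using q by (intro mult_left_mono_neg) (auto simp: t_def)
        ultimately show False using q by simp
      qed
      show False
      proof (cases "q = 0")
        case False
        with q have q: "q > 0" by simp
        have "ereal \<alpha> < fenchel (\<lambda>y. ereal (real_fenchel u y)) x0"
        proof (rule key[of "- (1 / q) *\<^sub>R p" "- (b / q)"])
          fix x
          show "ereal (x \<bullet> (- (1 / q) *\<^sub>R p) - - (b / q)) \<le> u x"
          proof (cases "u x")
            case (real r)
            then have "b < p \<bullet> x + q * r" by (intro above) simp
            then show ?thesis using q real by (simp add: field_simps inner_commute)
          next
            case MInf
            then show ?thesis using uC by (auto simp: Conv_def)
          qed simp
        next
          show "\<alpha> < x0 \<bullet> (- (1 / q) *\<^sub>R p) - - (b / q)"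
            using below q by (simp add: field_simps inner_commute)
        qed
        then show False using \<alpha>(1) by simp
      next
        case True
        \<comment> \<open>A vertical hyperplane only separates \<open>x0\<close> from the domain. A
          multiple \<open>k\<close> of its equation, added to the constant minorant
          \<open>- c0\<close>, is again a minorant, and \<open>k\<close> is large enough to lift it
          above \<open>\<alpha>\<close> at \<open>x0\<close>.\<close>
        obtain c0 where c0: "\<And>x. ereal (0 * norm x - c0) \<le> u x" using Conv_sc_lower_bound[OF u] by metis
        define k where "k = (\<bar>\<alpha>\<bar> + \<bar>c0\<bar> + 1) / (b - p \<bullet> x0)"
        have bp: "b - p \<bullet> x0 > 0" using below True by simp
        have k: "k \<ge> 0" "k * (b - p \<bullet> x0) = \<bar>\<alpha>\<bar> + \<bar>c0\<bar> + 1" using bp by (auto simp: k_def)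
        have "ereal \<alpha> < fenchel (\<lambda>y. ereal (real_fenchel u y)) x0"
        proof (rule key[of "- k *\<^sub>R p" "c0 - k * b"])
          fix x
          show "ereal (x \<bullet> (- k *\<^sub>R p) - (c0 - k * b)) \<le> u x"
          proof (cases "u x")
            case (real r)
            then have "b < p \<bullet> x" using above[of x r] True by simp
            then have "k * (b - p \<bullet> x) \<le> 0" using k(1) by (intro mult_nonneg_nonpos) auto
            moreover have "- c0 \<le> r" using c0[of x] real by simp
            ultimately show ?thesis using real by (simp add: algebra_simps inner_commute)
          next
            case MInf
            then show ?thesis using uC by (auto simp: Conv_def)
          qed simp
        next
          have "x0 \<bullet> (- k *\<^sub>R p) - (c0 - k * b) = k * (b - p \<bullet> x0) - c0" by (simp add: algebra_simps inner_commute)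
          then show "\<alpha> < x0 \<bullet> (- k *\<^sub>R p) - (c0 - k * b)" unfolding k(2) by linarith
        qed
        then show False using \<alpha>(1) by simp
      qed
    qed
  qed
qed

lemma fenchel_min: "fenchel (\<lambda>x. min (u x) (v x)) y = max (fenchel u y) (fenchel v y)"
  by (rule ereal_eqI_upper) (auto simp: fenchel_le_iff)

text \<open>A segment joining a point of \<open>{u \<le> \<langle>\<cdot>, y\<rangle> - c}\<close> to one of \<open>{v \<le> \<langle>\<cdot>, y\<rangle> - c}\<close> is covered by these closed
  sets, hence meets their intersection.\<close>

lemma fenchel_max:
  assumes u: "u \<in> Conv" and v: "v \<in> Conv" and uv: "(\<lambda>x. min (u x) (v x)) \<in> Conv"
  shows "fenchel (\<lambda>x. max (u x) (v x)) y = min (fenchel u y) (fenchel v y)"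
proof (rule ereal_eqI_upper)
  fix c
  have "fenchel u y \<le> ereal c \<or> fenchel v y \<le> ereal c" if m: "fenchel (\<lambda>x. max (u x) (v x)) y \<le> ereal c"
  proof (rule ccontr)
    assume "\<not> ?thesis"
    then obtain a b where ab: "u a < ereal (a \<bullet> y - c)" "v b < ereal (b \<bullet> y - c)"
      by (auto simp: fenchel_le_iff not_le)
    obtain r where r: "u a < ereal r" "r < a \<bullet> y - c" using ereal_dense2[OF ab(1)] by auto
    obtain s where s: "v b < ereal s" "s < b \<bullet> y - c" using ereal_dense2[OF ab(2)] by auto
    \<comment> \<open>The strict inequalities leave room for a level \<open>d > c\<close>: the two
      sets can then be defined by weak inequalities, hence are closed, and a common point still
      contradicts the bound at \<open>c\<close>.\<close>
    define d where "d = min (a \<bullet> y - r) (b \<bullet> y - s)"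
    have d: "c < d" "u a \<le> ereal (a \<bullet> y - d)" "v b \<le> ereal (b \<bullet> y - d)"
    proof -
      show "c < d" using r(2) s(2) by (simp add: d_def)
      have "ereal r \<le> ereal (a \<bullet> y - d)" "ereal s \<le> ereal (b \<bullet> y - d)" by (auto simp: d_def)
      then show "u a \<le> ereal (a \<bullet> y - d)" "v b \<le> ereal (b \<bullet> y - d)"
        using r(1) s(1) by (meson less_imp_le order_trans)+
    qed
    have closed: "closed {x. w x \<le> ereal (x \<bullet> y - d)}" if "w \<in> Conv" for w
    proof -
      have "closed ((\<lambda>x. (x, x \<bullet> y - d)) -` {(x, t). w x \<le> ereal t})"
        by (intro closed_vimage closed_epigraph_Conv that continuous_intros)
      then show ?thesis by (simp add: vimage_def)
    qed
    have "closed_segment a b \<subseteq> {x. u x \<le> ereal (x \<bullet> y - d)} \<union> {x. v x \<le> ereal (x \<bullet> y - d)}"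
    proof
      fix x assume "x \<in> closed_segment a b"
      then obtain t where t: "0 \<le> t" "t \<le> 1" "x = (1 - t) *\<^sub>R a + t *\<^sub>R b" by (auto simp: in_segment)
      have "min (u x) (v x) \<le> ereal ((1 - t) * (a \<bullet> y - d) + t * (b \<bullet> y - d))"
        unfolding t(3) by (rule Conv_le_convex[OF uv]) (use d t in \<open>auto simp: min_le_iff_disj\<close>)
      also have "(1 - t) * (a \<bullet> y - d) + t * (b \<bullet> y - d) = x \<bullet> y - d" by (simp add: t(3) inner_simps algebra_simps)
      finally show "x \<in> {x. u x \<le> ereal (x \<bullet> y - d)} \<union> {x. v x \<le> ereal (x \<bullet> y - d)}" by (auto simp: min_le_iff_disj)
    qed
    moreover have "a \<in> {x. u x \<le> ereal (x \<bullet> y - d)} \<inter> closed_segment a b" "b \<in> {x. v x \<le> ereal (x \<bullet> y - d)} \<inter> closed_segment a b"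
      using d by auto
    ultimately have "{x. u x \<le> ereal (x \<bullet> y - d)} \<inter> {x. v x \<le> ereal (x \<bullet> y - d)} \<inter> closed_segment a b \<noteq> {}"
      using connected_segment[of a b] closed[OF u] closed[OF v] unfolding connected_closed by blast
    then obtain x where x: "max (u x) (v x) \<le> ereal (x \<bullet> y - d)" by auto
    moreover have "ereal (x \<bullet> y - c) \<le> max (u x) (v x)" using m by (auto simp: fenchel_le_iff)
    ultimately have "ereal (x \<bullet> y - c) \<le> ereal (x \<bullet> y - d)" by (rule order_trans[rotated])
    then show False using d by simp
  qed
  then show "fenchel (\<lambda>x. max (u x) (v x)) y \<le> ereal c \<longleftrightarrow> min (fenchel u y) (fenchel v y) \<le> ereal c"
    by (auto simp: min_le_iff_disj fenchel_le_iff le_max_iff_disj)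
qed

lemma fenchel_add_affine:
  "fenchel (\<lambda>x. ereal (f x + (a \<bullet> x + b))) = (\<lambda>x. fenchel (\<lambda>x. ereal (f x)) (x - a) + ereal (- b))"
proof (rule ext, rule ereal_eqI_upper)
  fix x c
  have "fenchel (\<lambda>x. ereal (f x)) (x - a) + ereal (- b) \<le> ereal c \<longleftrightarrow> fenchel (\<lambda>x. ereal (f x)) (x - a) \<le> ereal (c + b)"
    by (cases "fenchel (\<lambda>x. ereal (f x)) (x - a)") auto
  then show "fenchel (\<lambda>x. ereal (f x + (a \<bullet> x + b))) x \<le> ereal c \<longleftrightarrow>
      fenchel (\<lambda>x. ereal (f x)) (x - a) + ereal (- b) \<le> ereal c"
    by (simp add: fenchel_le_iff inner_simps inner_commute algebra_simps)
qed

lemma fenchel_scale: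
  assumes t: "t > 0"
  shows "fenchel (\<lambda>x. ereal (t * f x)) = (\<lambda>x. ereal t * fenchel (\<lambda>x. ereal (f x)) (x /\<^sub>R t))"
proof (rule ext, rule ereal_eqI_upper)
  fix x c
  have "ereal t * fenchel (\<lambda>x. ereal (f x)) (x /\<^sub>R t) \<le> ereal c \<longleftrightarrow> fenchel (\<lambda>x. ereal (f x)) (x /\<^sub>R t) \<le> ereal (c / t)"
    using t by (cases "fenchel (\<lambda>x. ereal (f x)) (x /\<^sub>R t)") (auto simp: field_simps)
  then show "fenchel (\<lambda>x. ereal (t * f x)) x \<le> ereal c \<longleftrightarrow> ereal t * fenchel (\<lambda>x. ereal (f x)) (x /\<^sub>R t) \<le> ereal c"
    using t by (simp add: fenchel_le_iff field_simps)
qed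

lemma fenchel_translate:
  "fenchel (\<lambda>y. u (y - x) + ereal c) z = fenchel u z + ereal (x \<bullet> z - c)"
proof (rule ereal_eqI_upper)
  fix d
  have "fenchel (\<lambda>y. u (y - x) + ereal c) z \<le> ereal d \<longleftrightarrow> (\<forall>y. ereal (y \<bullet> z - d) \<le> u (y - x) + ereal c)"
    by (rule fenchel_le_iff)
  also have "\<dots> \<longleftrightarrow> (\<forall>y. ereal ((y + x) \<bullet> z - d) \<le> u y + ereal c)"
    by (metis add_diff_cancel diff_add_cancel)
  also have "\<dots> \<longleftrightarrow> (\<forall>y. ereal (y \<bullet> z - (d - (x \<bullet> z - c))) \<le> u y)"
  proof (intro all_cong1)
    fix y show "ereal ((y + x) \<bullet> z - d) \<le> u y + ereal c \<longleftrightarrow> ereal (y \<bullet> z - (d - (x \<bullet> z - c))) \<le> u y"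
      by (cases "u y") (auto simp: inner_simps algebra_simps)
  qed
  also have "\<dots> \<longleftrightarrow> fenchel u z \<le> ereal (d - (x \<bullet> z - c))" by (rule fenchel_le_iff[symmetric])
  also have "\<dots> \<longleftrightarrow> fenchel u z + ereal (x \<bullet> z - c) \<le> ereal d"
    by (cases "fenchel u z") auto
  finally show "fenchel (\<lambda>y. u (y - x) + ereal c) z \<le> ereal d \<longleftrightarrow> fenchel u z + ereal (x \<bullet> z - c) \<le> ereal d" .
qed

subsection \<open>Epi-convergence\<close>

text \<open>The witness at \<open>j\<close> serves the largest \<open>k \<le> j\<close> that has
  one; the cap keeps the set finite. Every fixed \<open>k\<close> eventually belongs to it, so the
  quality of the witnesses tends to infinity.\<close>

lemma diagonal_witnesses:
  fixes Q :: "nat \<Rightarrow> nat \<Rightarrow> 'b \<Rightarrow> bool"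
  assumes "\<And>k. \<forall>\<^sub>F j in sequentially. \<exists>z. Q k j z"
  obtains zs where "\<And>k. \<forall>\<^sub>F j in sequentially. \<exists>k'\<ge>k. Q k' j (zs j)"
proof -
  define A where "A j = {k. k \<le> j \<and> (\<exists>z. Q k j z)}" for j
  have fin: "finite (A j)" for j by (rule finite_subset[of _ "{..j}"]) (auto simp: A_def)
  define zs where "zs j = (SOME z. Q (Max (A j)) j z)" for j
  show thesis
  proof (rule that)
    fix k
    show "\<forall>\<^sub>F j in sequentially. \<exists>k'\<ge>k. Q k' j (zs j)"
      using assms[of k] eventually_ge_at_top[of k]
    proof eventually_elim
      case (elim j)
      then have k: "k \<in> A j" by (auto simp: A_def)
      then have "Max (A j) \<in> A j" using fin by (intro Max_in) auto
      then have "\<exists>z. Q (Max (A j)) j z" by (simp add: A_def)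
      then have "Q (Max (A j)) j (zs j)" unfolding zs_def by (rule someI_ex)
      then show ?case using Max_ge[OF fin k] by blast
    qed
  qed
qed

text \<open>Subtracting the linear function with slope \<open>x\<close> from \<open>F j\<close>
  gives \<open>G\<close>, which is at least \<open>- \<beta> - \<delta> - \<delta> * norm y\<close>
  everywhere: near \<open>0\<close> by uniform convergence, further out by convexity along rays. An
  affine function between this concave cone and \<open>G\<close> has a slope \<open>s\<close> of
  norm at most \<open>\<delta>\<close>, and \<open>x + s\<close> is the point wanted.\<close>

lemma fenchel_recovery:
  fixes F :: "nat \<Rightarrow> real^'n \<Rightarrow> real"
  assumes F: "\<And>j. convex_on UNIV (F j)" and lim: "\<And>y. (\<lambda>j. F j y) \<longlonglongrightarrow> f y"
    and le: "fenchel (\<lambda>y. ereal (f y)) x \<le> ereal \<beta>" and \<delta>: "\<delta> > 0"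
  shows "\<forall>\<^sub>F j in sequentially. \<exists>z. norm (z - x) \<le> \<delta> \<and> fenchel (\<lambda>y. ereal (F j y)) z \<le> ereal (\<beta> + \<delta>)"
proof -
  have f: "f y \<ge> y \<bullet> x - \<beta>" for y using le by (simp add: fenchel_le_iff)
  \<comment> \<open>\<open>M\<close> bounds the drop from \<open>G 0\<close> to the lower bound on
    the ball. With radius \<open>M / \<delta>\<close>, convexity allows \<open>G\<close> to fall
    beyond the ball with slope at most \<open>\<delta>\<close> only.\<close>
  define M where "M = f 0 + \<beta> + 2 * \<delta>"
  have M: "M > 0" using f[of 0] \<delta> by (simp add: M_def)
  define \<rho> where "\<rho> = M / \<delta>"
  have \<rho>: "\<rho> > 0" "M = \<rho> * \<delta>" using M \<delta> by (auto simp: \<rho>_def)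
  show ?thesis
    using convex_pointwise_imp_uniform[OF F lim \<delta>, of \<rho>]
  proof eventually_elim
    case (elim j)
    define G where "G y = F j y + ((- x) \<bullet> y + 0)" for y
    have G: "convex_on UNIV G" unfolding G_def by (intro convex_on_add F convex_on_affine)
    have near: "- \<beta> - \<delta> \<le> G y" if "y \<in> cball 0 \<rho>" for y
      using elim[rule_format, OF that] f[of y] by (simp add: G_def inner_commute)
    have G0: "G 0 \<le> f 0 + \<delta>" using elim[rule_format, of 0] \<rho> by (simp add: G_def)
    have low: "- \<beta> - \<delta> - \<delta> * norm y \<le> G y" for y
    proof (cases "norm y \<le> \<rho>")
      case True
      then show ?thesis using near[of y] \<delta> by (smt (verit) mem_cball_0 mult_nonneg_nonneg norm_ge_zero)
    next
      case False
      define t where "t = \<rho> / norm y"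
      have "norm y > 0" using False \<rho> by linarith
      then have t: "0 < t" "t \<le> 1" "t * norm y = \<rho>"
        using False \<rho>(1) unfolding t_def by (simp_all only: divide_pos_pos pos_divide_le_eq, auto)
      have "- \<beta> - \<delta> \<le> G (t *\<^sub>R y)" using t \<rho> by (intro near) simp
      also have "\<dots> \<le> (1 - t) * G 0 + t * G y"
        using G[unfolded convex_on_UNIV_iff_segment, rule_format, of t 0 y] t by simp
      finally have "- \<beta> - \<delta> \<le> (1 - t) * G 0 + t * G y" .
      moreover have "(1 - t) * G 0 \<le> (1 - t) * (M - \<beta> - \<delta>)"
        using G0 t by (intro mult_left_mono) (auto simp: M_def)
      ultimately have "- \<beta> - \<delta> \<le> (1 - t) * (M - \<beta> - \<delta>) + t * G y" by linarith
      then have "0 \<le> t * (G y + \<beta> + \<delta>) + (1 - t) * M" by (simp add: algebra_simps)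
      moreover have "(1 - t) * M \<le> t * (\<delta> * norm y)"
      proof -
        have "t * (\<delta> * norm y) = M" using t(3) \<rho>(2) by (metis mult.assoc mult.commute)
        moreover have "(1 - t) * M \<le> 1 * M" using t M by (intro mult_right_mono) auto
        ultimately show ?thesis by simp
      qed
      ultimately have "0 \<le> t * (G y + \<beta> + \<delta> + \<delta> * norm y)" by (simp add: algebra_simps)
      then show ?thesis using t(1) by (simp add: zero_le_mult_iff)
    qed
    define k where "k y = \<delta> * dist 0 y + (0 \<bullet> y + (\<beta> + \<delta>))" for y :: "real^'n"
    have k: "convex_on UNIV k"
      unfolding k_def using \<delta> by (intro convex_on_add convex_on_cmul convex_on_dist convex_on_affine) auto
    define C where "C = {(y, t). t \<le> - k y}"
    have "convex C"
      unfolding convex_alt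
    proof (intro ballI allI impI, clarsimp simp: C_def)
      fix a b c d and u :: real assume *: "b \<le> - k a" "d \<le> - k c" "0 \<le> u" "u \<le> 1"
      have "k ((1 - u) *\<^sub>R a + u *\<^sub>R c) \<le> (1 - u) * k a + u * k c"
        using k * by (simp add: convex_on_UNIV_iff_segment)
      also have "\<dots> \<le> (1 - u) * (- b) + u * (- d)"
        using * by (intro add_mono mult_left_mono) auto
      finally show "(1 - u) * b + u * d \<le> - k ((1 - u) *\<^sub>R a + u *\<^sub>R c)" by simp
    qed
    moreover have "(0, - k 0) \<in> C" by (simp add: C_def)
    then have "C \<noteq> {}" by blast
    moreover have "t \<le> G y" if "(y, t) \<in> C" for y t using that low[of y] by (simp add: C_def k_def)
    ultimately obtain s c where s: "\<And>y. s \<bullet> y + c \<le> G y" "\<And>y t. (y, t) \<in> C \<Longrightarrow> t \<le> s \<bullet> y + c"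
      using convex_separating_affine[OF G] by metis
    have s2: "- (\<delta> * norm y) - (\<beta> + \<delta>) \<le> s \<bullet> y + c" for y
      using s(2)[of y "- k y"] by (simp add: C_def k_def)
    have ns: "norm s \<le> \<delta>"
    proof (rule ccontr)
      assume "\<not> norm s \<le> \<delta>"
      then have *: "norm s > 0" "norm s - \<delta> > 0" using \<delta> by auto
      \<comment> \<open>Along \<open>- s\<close> the affine function falls faster than the cone; at
        the multiple \<open>m\<close> the difference exceeds all the constants.\<close>
      define m where "m = (\<bar>c\<bar> + \<bar>\<beta>\<bar> + \<bar>\<delta>\<bar> + 1) / (norm s * (norm s - \<delta>))"
      have m: "m > 0" "m * (norm s * (norm s - \<delta>)) = \<bar>c\<bar> + \<bar>\<beta>\<bar> + \<bar>\<delta>\<bar> + 1"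
        using * by (auto simp: m_def)
      have a: "s \<bullet> (- m *\<^sub>R s) = - (m * (norm s * norm s))" by (simp add: dot_square_norm power2_eq_square)
      have b: "norm (- m *\<^sub>R s) = m * norm s" using m(1) by simp
      have "- (\<delta> * (m * norm s)) - (\<beta> + \<delta>) \<le> - (m * (norm s * norm s)) + c"
        using s2[of "- m *\<^sub>R s"] by (simp only: a b)
      then have "m * (norm s * (norm s - \<delta>)) \<le> c + \<beta> + \<delta>" by (simp add: algebra_simps)
      then show False unfolding m(2) by linarith
    qed
    have "fenchel (\<lambda>y. ereal (F j y)) (x + s) \<le> ereal (\<beta> + \<delta>)"
      unfolding fenchel_le_iff
    proof
      fix y show "ereal (y \<bullet> (x + s) - (\<beta> + \<delta>)) \<le> ereal (F j y)"
        using s(1)[of y] s2[of 0] by (simp add: G_def inner_simps inner_commute)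
    qed
    then show ?case using ns by (intro exI[of _ "x + s"]) simp
  qed
qed

text \<open>One half of the duality between pointwise convergence and epi-convergence; the other
  half is \<open>real_fenchel_tendsto\<close>. The liminf inequality holds for each affine function
  under the supremum, and recovery sequences are chosen diagonally from
  \<open>fenchel_recovery\<close>.\<close>

lemma epi_converges_fenchel:
  fixes F :: "nat \<Rightarrow> real^'n \<Rightarrow> real"
  assumes F: "\<And>j. convex_on UNIV (F j)" and lim: "\<And>y. (\<lambda>j. F j y) \<longlonglongrightarrow> f y"
  shows "epi_converges (\<lambda>j. fenchel (\<lambda>y. ereal (F j y))) (fenchel (\<lambda>y. ereal (f y)))"
proof -
  let ?u = "fenchel (\<lambda>y. ereal (f y))" and ?us = "\<lambda>j. fenchel (\<lambda>y. ereal (F j y))"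
  have inf: "?u x \<le> liminf (\<lambda>j. ?us j (xs j))" if xs: "xs \<longlonglongrightarrow> x" for x xs
    unfolding fenchel_def[of "\<lambda>y. ereal (f y)"]
  proof (rule SUP_least)
    fix y
    have "(\<lambda>j. ereal (y \<bullet> xs j - F j y)) \<longlonglongrightarrow> ereal (y \<bullet> x - f y)"
      by (intro tendsto_intros xs lim)
    then have "ereal (y \<bullet> x - f y) = liminf (\<lambda>j. ereal (y \<bullet> xs j - F j y))"
      by (intro lim_imp_Liminf[symmetric]) auto
    also have "\<dots> \<le> liminf (\<lambda>j. ?us j (xs j))" by (intro Liminf_mono always_eventually allI fenchel_ge)
    finally show "ereal (y \<bullet> x) - ereal (f y) \<le> liminf (\<lambda>j. ?us j (xs j))" by simp
  qed
  have rec: "\<exists>xs. xs \<longlonglongrightarrow> x \<and> (\<lambda>j. ?us j (xs j)) \<longlonglongrightarrow> ?u x" for x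
  proof (cases "?u x")
    case PInf
    have "(\<lambda>j. ?us j x) \<longlonglongrightarrow> \<infinity>"
      using inf[of "\<lambda>j. x" x] PInf by (simp add: Liminf_PInfty)
    then show ?thesis using PInf by (intro exI[of _ "\<lambda>j. x"]) simp
  next
    case MInf
    then show ?thesis using fenchel_ge[of 0 x f] by auto
  next
    case (real \<beta>)
    define e where "e k = inverse (real (Suc k))" for k
    have e1: "e k > 0" for k by (simp add: e_def)
    have e2: "e k' \<le> e k" if "k \<le> k'" for k k'
      unfolding e_def by (rule le_imp_inverse_le) (use that in auto)
    have e0: "\<exists>k. e k < r" if "r > 0" for r unfolding e_def by (rule reals_Archimedean[OF that])
    have "\<forall>\<^sub>F j in sequentially. \<exists>z. norm (z - x) \<le> e k \<and> ?us j z \<le> ereal (\<beta> + e k)" for k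
      by (rule fenchel_recovery[OF F lim _ e1]) (simp only: real order_refl)
    then obtain zs where zs: "\<And>k. \<forall>\<^sub>F j in sequentially. \<exists>k'\<ge>k. norm (zs j - x) \<le> e k' \<and> ?us j (zs j) \<le> ereal (\<beta> + e k')"
      by (rule diagonal_witnesses[of "\<lambda>k j z. norm (z - x) \<le> e k \<and> ?us j z \<le> ereal (\<beta> + e k)"]) (rule that)
    have zs': "\<forall>\<^sub>F j in sequentially. norm (zs j - x) \<le> e k \<and> ?us j (zs j) \<le> ereal (\<beta> + e k)" for k
      using zs[of k]
    proof (rule eventually_mono, elim exE conjE)
      fix j k' assume *: "k \<le> k'" "norm (zs j - x) \<le> e k'" "?us j (zs j) \<le> ereal (\<beta> + e k')"
      have "ereal (\<beta> + e k') \<le> ereal (\<beta> + e k)" using e2[OF *(1)] by simp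
      then show "norm (zs j - x) \<le> e k \<and> ?us j (zs j) \<le> ereal (\<beta> + e k)"
        using * e2[OF *(1)] by (meson order_trans)
    qed
    have lz: "zs \<longlonglongrightarrow> x"
    proof (rule tendstoI)
      fix r :: real assume "r > 0"
      then obtain k where "e k < r" using e0 by blast
      then show "\<forall>\<^sub>F j in sequentially. dist (zs j) x < r"
        using zs'[of k] by (auto simp: dist_norm elim: eventually_mono)
    qed
    have "(\<lambda>j. ?us j (zs j)) \<longlonglongrightarrow> ereal \<beta>"
    proof (rule order_tendstoI)
      fix a assume "a < ereal \<beta>"
      then show "\<forall>\<^sub>F j in sequentially. a < ?us j (zs j)"
        using inf[OF lz] real by (auto simp: le_Liminf_iff)
    next
      fix a assume "ereal \<beta> < a"
      then obtain b where b: "\<beta> < b" "ereal b < a" using ereal_dense2 by fastforce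
      then obtain k where k: "e k < b - \<beta>" using e0[of "b - \<beta>"] by auto
      show "\<forall>\<^sub>F j in sequentially. ?us j (zs j) < a"
        using zs'[of k]
      proof (rule eventually_mono, elim conjE)
        fix j assume "?us j (zs j) \<le> ereal (\<beta> + e k)"
        also have "ereal (\<beta> + e k) < ereal b" using k by simp
        finally show "?us j (zs j) < a" using b(2) by (rule less_trans)
      qed
    qed
    then show ?thesis using lz real by auto
  qed
  show ?thesis unfolding epi_converges_def using inf rec by blast
qed

text \<open>Epi-convergence speaks of full sequences, so points given along a subsequence are
  completed by the constant \<open>x\<close> at the missing indices.\<close>

lemma epi_converges_le:
  assumes epi: "epi_converges us u" and r: "strict_mono (r :: nat \<Rightarrow> nat)" and xs: "xs \<longlonglongrightarrow> x"
    and b: "b \<longlonglongrightarrow> c" and le: "\<forall>\<^sub>F j in sequentially. us (r j) (xs j) \<le> ereal (b j)"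
  shows "u x \<le> ereal c"
proof -
  define X where "X i = (if i \<in> range r then xs (inv r i) else x)" for i
  have inj: "inj r" using r by (rule strict_mono_imp_inj_on)
  have Xr: "X (r j) = xs j" for j by (simp add: X_def inv_f_f[OF inj])
  have "X \<longlonglongrightarrow> x"
  proof (rule tendstoI)
    fix e :: real assume "e > 0"
    then obtain N where N: "\<And>j. j \<ge> N \<Longrightarrow> dist (xs j) x < e" using xs by (metis metric_LIMSEQ_D)
    show "\<forall>\<^sub>F i in sequentially. dist (X i) x < e"
    proof (rule eventually_sequentiallyI[of "r N"])
      fix i assume i: "r N \<le> i"
      show "dist (X i) x < e"
      proof (cases "i \<in> range r")
        case True
        then obtain j where j: "i = r j" by blast
        then have "N \<le> j" using i r by (simp add: strict_mono_less_eq)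
        then show ?thesis using N j Xr by simp
      qed (use \<open>e > 0\<close> in \<open>simp add: X_def\<close>)
    qed
  qed
  then have "u x \<le> liminf (\<lambda>i. us i (X i))" using epi by (auto simp: epi_converges_def)
  also have "\<dots> \<le> liminf ((\<lambda>i. us i (X i)) \<circ> r)" by (rule liminf_subseq_mono[OF r])
  also have "\<dots> \<le> liminf (\<lambda>j. ereal (b j))"
    by (rule Liminf_mono) (use le in \<open>simp add: o_def Xr\<close>)
  also have "\<dots> = ereal c" using b by (intro lim_imp_Liminf) auto
  finally show ?thesis .
qed

text \<open>A recovery sequence gives the lower estimate. Points that violate the upper estimate
  along a subsequence might escape to infinity; those beyond radius \<open>R\<close> are moved along
  the segment towards a recovery sequence until their norm is \<open>R\<close>. Superlinear growth
  of \<open>u\<close> puts the limit of a further subsequence strictly inside this radius, so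
  eventually nothing was moved along it, and the liminf inequality contradicts the
  violation.\<close>

lemma real_fenchel_tendsto:
  fixes us :: "nat \<Rightarrow> real^'n \<Rightarrow> ereal"
  assumes us: "\<And>j. us j \<in> Conv_sc" and u: "u \<in> Conv_sc" and epi: "epi_converges us u"
  shows "(\<lambda>j. real_fenchel (us j) y) \<longlonglongrightarrow> real_fenchel u y"
proof -
  define \<beta> where "\<beta> = real_fenchel u y"
  have lower: "\<forall>\<^sub>F j in sequentially. \<beta> - e < real_fenchel (us j) y" if "e > 0" for e
  proof -
    have "\<not> real_fenchel u y \<le> \<beta> - e" using that by (simp add: \<beta>_def)
    then obtain x where x: "u x < ereal (x \<bullet> y - (\<beta> - e))" by (auto simp: real_fenchel_le_iff[OF u] not_le)
    obtain xs where xs: "xs \<longlonglongrightarrow> x" "(\<lambda>j. us j (xs j)) \<longlonglongrightarrow> u x" using epi by (auto simp: epi_converges_def)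
    obtain m where m: "u x < ereal m" "m < x \<bullet> y - (\<beta> - e)" using ereal_dense2[OF x] by auto
    have "(\<lambda>j. xs j \<bullet> y - (\<beta> - e)) \<longlonglongrightarrow> x \<bullet> y - (\<beta> - e)" by (intro tendsto_intros xs)
    then have "\<forall>\<^sub>F j in sequentially. m < xs j \<bullet> y - (\<beta> - e)" using m(2) by (rule order_tendstoD)
    moreover have "\<forall>\<^sub>F j in sequentially. us j (xs j) < ereal m" using xs(2) m(1) by (rule order_tendstoD)
    ultimately show ?thesis
    proof eventually_elim
      case (elim j)
      then have "us j (xs j) < ereal (xs j \<bullet> y - (\<beta> - e))" by (metis less_ereal.simps(1) less_trans)
      then have "\<not> real_fenchel (us j) y \<le> \<beta> - e" using real_fenchel_le_iff[OF us] not_le by blast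
      then show ?case by simp
    qed
  qed
  have upper: "\<forall>\<^sub>F j in sequentially. real_fenchel (us j) y < \<beta> + e" if e: "e > 0" for e
  proof (rule ccontr)
    assume "\<not> ?thesis"
    then have inf: "\<exists>j\<ge>n. \<beta> + e \<le> real_fenchel (us j) y" for n by (auto simp: eventually_sequentially not_less)
    then have "infinite {j. \<beta> + e \<le> real_fenchel (us j) y}" by (auto simp: infinite_nat_iff_unbounded_le)
    then obtain r where r: "strict_mono (r :: nat \<Rightarrow> nat)" "\<And>j. \<beta> + e \<le> real_fenchel (us (r j)) y"
      using infinite_enumerate by blast
    have "\<exists>x. us (r j) x \<le> ereal (x \<bullet> y - (\<beta> + e / 2))" for j
    proof -
      have "\<not> real_fenchel (us (r j)) y \<le> \<beta> + e / 2" using r(2)[of j] e by simp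
      then show ?thesis using real_fenchel_le_iff[OF us] by (meson less_imp_le not_le)
    qed
    then obtain x where x: "\<And>j. us (r j) (x j) \<le> ereal (x j \<bullet> y - (\<beta> + e / 2))" by metis
    obtain x0 t0 where x0: "u x0 = ereal t0"
    proof -
      obtain x where "u x \<noteq> \<infinity>" "u x \<noteq> -\<infinity>" using u by (auto simp: Conv_sc_def Conv_def)
      then show thesis using that by (cases "u x") auto
    qed
    obtain z where z: "z \<longlonglongrightarrow> x0" "(\<lambda>j. us j (z j)) \<longlonglongrightarrow> u x0" using epi by (auto simp: epi_converges_def)
    \<comment> \<open>Large enough for both the violating points and the recovery sequence to
      satisfy \<open>us (r j) w \<le> ereal (w \<bullet> y + C)\<close>, a condition that passes to
      segments.\<close>
    define C where "C = \<bar>\<beta>\<bar> + \<bar>t0\<bar> + \<bar>x0 \<bullet> y\<bar> + 1"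
    obtain c where c: "\<And>x. ereal ((norm y + 1) * norm x - c) \<le> u x" using Conv_sc_lower_bound[OF u] by metis
    \<comment> \<open>The unit of slope beyond \<open>norm y\<close> yields
      \<open>norm w0 \<le> C + c\<close>, which is less than \<open>R\<close>; the summand
      \<open>norm x0\<close> puts the recovery sequence inside as well.\<close>
    define R where "R = \<bar>C\<bar> + \<bar>c\<bar> + norm x0 + 1"
    have "(\<lambda>j. us (r j) (z (r j))) \<longlonglongrightarrow> ereal t0"
      using LIMSEQ_subseq_LIMSEQ[OF z(2) r(1)] x0 by (simp add: o_def)
    then have z1: "\<forall>\<^sub>F j in sequentially. us (r j) (z (r j)) < ereal (t0 + 1/2)"
      by (rule order_tendstoD) simp
    have zr: "(\<lambda>j. z (r j)) \<longlonglongrightarrow> x0" using LIMSEQ_subseq_LIMSEQ[OF z(1) r(1)] by (simp add: o_def)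
    have z2: "\<forall>\<^sub>F j in sequentially. x0 \<bullet> y - 1/2 < z (r j) \<bullet> y"
      by (rule order_tendstoD(1)[of _ "x0 \<bullet> y"]) (auto intro: tendsto_intros zr)
    have z3: "\<forall>\<^sub>F j in sequentially. norm (z (r j)) < R"
      by (rule order_tendstoD(2)[OF tendsto_norm[OF zr]]) (simp add: R_def)
    have ev: "\<forall>\<^sub>F j in sequentially. \<exists>w. norm w \<le> R \<and> us (r j) w \<le> ereal (w \<bullet> y + C) \<and> (norm w < R \<longrightarrow> w = x j)"
      using z1 z2 z3
    proof eventually_elim
      case (elim j)
      have zC: "us (r j) (z (r j)) \<le> ereal (z (r j) \<bullet> y + C)"
      proof -
        have "ereal (t0 + 1/2) \<le> ereal (z (r j) \<bullet> y + C)" using elim(2) by (simp add: C_def)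
        then show ?thesis using elim(1) by (meson less_imp_le order_trans)
      qed
      have xC: "us (r j) (x j) \<le> ereal (x j \<bullet> y + C)"
      proof -
        have "ereal (x j \<bullet> y - (\<beta> + e / 2)) \<le> ereal (x j \<bullet> y + C)" using e by (simp add: C_def)
        then show ?thesis using x[of j] by (meson order_trans)
      qed
      show ?case
      proof (cases "norm (x j) \<le> R")
        case True
        then show ?thesis using xC by blast
      next
        case False
        have "\<exists>t\<ge>0. t \<le> 1 \<and> norm ((1 - t) *\<^sub>R z (r j) + t *\<^sub>R x j) = R"
          by (rule IVT') (use False elim(3) in \<open>auto intro!: continuous_intros\<close>)
        then obtain t where t: "0 \<le> t" "t \<le> 1" "norm ((1 - t) *\<^sub>R z (r j) + t *\<^sub>R x j) = R" by blast
        have "us (r j) \<in> Conv" using us by (simp add: Conv_sc_def)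
        from Conv_le_convex[OF this zC xC t(1,2)]
        have "us (r j) ((1 - t) *\<^sub>R z (r j) + t *\<^sub>R x j) \<le> ereal (((1 - t) *\<^sub>R z (r j) + t *\<^sub>R x j) \<bullet> y + C)"
          by (simp add: inner_simps algebra_simps)
        then show ?thesis using t(3) by (intro exI[of _ "(1 - t) *\<^sub>R z (r j) + t *\<^sub>R x j"]) auto
      qed
    qed
    then obtain N where N: "\<And>j. j \<ge> N \<Longrightarrow> \<exists>w. norm w \<le> R \<and> us (r j) w \<le> ereal (w \<bullet> y + C) \<and> (norm w < R \<longrightarrow> w = x j)"
      by (auto simp: eventually_sequentially)
    then have "\<forall>j. \<exists>w. norm w \<le> R \<and> us (r (j + N)) w \<le> ereal (w \<bullet> y + C) \<and> (norm w < R \<longrightarrow> w = x (j + N))" by simp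
    then obtain w where w: "\<And>j. norm (w j) \<le> R" "\<And>j. us (r (j + N)) (w j) \<le> ereal (w j \<bullet> y + C)"
      "\<And>j. norm (w j) < R \<Longrightarrow> w j = x (j + N)" by metis
    obtain w0 q where q: "strict_mono (q :: nat \<Rightarrow> nat)" "(w \<circ> q) \<longlonglongrightarrow> w0"
      using compact_imp_seq_compact[OF compact_cball[of "0::real^'n" R], unfolded seq_compact_def, rule_format, of w] w(1) by auto
    have wq: "(\<lambda>j. w (q j)) \<longlonglongrightarrow> w0" using q(2) by (simp add: o_def)
    have sm: "strict_mono (\<lambda>j. r (q j + N))" using r(1) q(1) by (simp add: strict_mono_def)
    have "(\<lambda>j. w (q j) \<bullet> y + C) \<longlonglongrightarrow> w0 \<bullet> y + C" by (intro tendsto_intros wq)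
    then have "u w0 \<le> ereal (w0 \<bullet> y + C)"
      by (rule epi_converges_le[OF epi sm wq]) (intro always_eventually allI w(2))
    with c[of w0] have "ereal ((norm y + 1) * norm w0 - c) \<le> ereal (w0 \<bullet> y + C)" by (rule order_trans)
    then have "(norm y + 1) * norm w0 - c \<le> norm w0 * norm y + C" using norm_cauchy_schwarz[of w0 y] by simp
    then have "norm w0 \<le> C + c" by (simp add: algebra_simps)
    then have "norm w0 < R" by (simp add: R_def add_pos_nonneg) (smt (verit) norm_ge_zero)
    then have "\<forall>\<^sub>F j in sequentially. norm (w (q j)) < R" by (rule order_tendstoD(2)[OF tendsto_norm[OF wq]])
    then have "\<forall>\<^sub>F j in sequentially. us (r (q j + N)) (w (q j)) \<le> ereal (w (q j) \<bullet> y - (\<beta> + e / 2))"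
      by (rule eventually_mono) (use w(3) x in metis)
    then have "u w0 \<le> ereal (w0 \<bullet> y - (\<beta> + e / 2))"
      by (intro epi_converges_le[OF epi sm wq, of "\<lambda>j. w (q j) \<bullet> y - (\<beta> + e / 2)"]) (auto intro!: tendsto_intros wq)
    moreover have "ereal (w0 \<bullet> y - \<beta>) \<le> u w0" using Fenchel_inequality[OF u] by (simp add: \<beta>_def)
    ultimately have "ereal (w0 \<bullet> y - \<beta>) \<le> ereal (w0 \<bullet> y - (\<beta> + e / 2))" by (rule order_trans[rotated])
    then show False using e by simp
  qed
  show ?thesis
  proof (rule tendstoI)
    fix e :: real assume "e > 0"
    show "\<forall>\<^sub>F j in sequentially. dist (real_fenchel (us j) y) (real_fenchel u y) < e"
      using lower[OF \<open>e > 0\<close>] upper[OF \<open>e > 0\<close>]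
      by eventually_elim (simp add: dist_real_def \<beta>_def abs_less_iff)
  qed
qed

lemma epi_continuousD:
  assumes Z: "epi_continuous Z" and "\<And>j. us j \<in> Conv_sc" "u \<in> Conv_sc" "epi_converges us u"
  shows "(\<lambda>j. Z (us j)) \<longlonglongrightarrow> Z u"
proof (rule topological_tendstoI)
  fix S :: "real set" assume S: "open S" "Z u \<in> S"
  have "openin (epi_topology Conv_sc) {v \<in> topspace (epi_topology Conv_sc). Z v \<in> S}"
    using Z S(1) unfolding epi_continuous_def by (intro openin_continuous_map_preimage) auto
  then have "epi_open Conv_sc {v \<in> Conv_sc. Z v \<in> S}" by (simp add: openin_epi_topology)
  then have "\<forall>\<^sub>F j in sequentially. us j \<in> {v \<in> Conv_sc. Z v \<in> S}"
    using assms(2-4) S(2) unfolding epi_open_def by blast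
  then show "\<forall>\<^sub>F j in sequentially. Z (us j) \<in> S" by (auto elim: eventually_mono)
qed

text \<open>Openness in \<open>epi_topology\<close> is tested by epi-convergent sequences, so
  sequential continuity is continuity by construction.\<close>

lemma epi_continuousI:
  assumes "\<And>us u. (\<And>j. us j \<in> Conv_sc) \<Longrightarrow> u \<in> Conv_sc \<Longrightarrow> epi_converges us u \<Longrightarrow> (\<lambda>j. Z (us j)) \<longlonglongrightarrow> Z u"
  shows "epi_continuous Z"
  unfolding epi_continuous_def continuous_map_def
proof (intro conjI allI impI)
  fix S assume "openin euclideanreal S"
  then have S: "open S" by simp
  show "openin (epi_topology Conv_sc) {x \<in> topspace (epi_topology Conv_sc). Z x \<in> S}"
    unfolding openin_epi_topology topspace_epi_topology epi_open_def
  proof (intro conjI allI impI)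
    fix us u assume *: "(\<forall>j. us j \<in> Conv_sc) \<and> u \<in> {x \<in> Conv_sc. Z x \<in> S} \<and> epi_converges us u"
    then have "(\<lambda>j. Z (us j)) \<longlonglongrightarrow> Z u" by (intro assms) auto
    then have "\<forall>\<^sub>F j in sequentially. Z (us j) \<in> S" using S * by (auto intro: topological_tendstoD)
    then show "\<forall>\<^sub>F j in sequentially. us j \<in> {x \<in> Conv_sc. Z x \<in> S}"
      by (rule eventually_mono) (use * in auto)
  qed auto
qed auto

lemma epi_continuous_real_fenchel: "epi_continuous (\<lambda>u. real_fenchel u y)"
  by (intro epi_continuousI real_fenchel_tendsto)

subsection \<open>Additivity, locality and discrete approximation of the dual functional\<close>

text \<open>The Hahn--Banach extension over finitely many dimensions, one dimension at a time. A triple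
  \<open>(h, l, c)\<close> records the coordinates \<open>h\<close>, the value \<open>l\<close> of the functional and a bound \<open>c\<close> for the seminorm of one vector.\<close>

lemma finite_codimension_dominated:
  fixes S :: "(('i \<Rightarrow> real) \<times> real \<times> real) set"
  assumes "finite I"
    and "\<And>h l c h' l' c'. (h, l, c) \<in> S \<Longrightarrow> (h', l', c') \<in> S \<Longrightarrow> (\<lambda>i. h i + h' i, l + l', c + c') \<in> S"
    and "\<And>h l c t. (h, l, c) \<in> S \<Longrightarrow> t > 0 \<Longrightarrow> (\<lambda>i. t * h i, t * l, t * c) \<in> S"
    and "\<And>h l c. (h, l, c) \<in> S \<Longrightarrow> (\<lambda>i. - h i, - l, c) \<in> S"
    and "\<And>h l c. (h, l, c) \<in> S \<Longrightarrow> (\<forall>i\<in>I. h i = 0) \<Longrightarrow> l \<le> c"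
  shows "\<exists>d. \<forall>(h, l, c)\<in>S. l - (\<Sum>i\<in>I. d i * h i) \<le> c"
  using assms
proof (induction I arbitrary: S rule: finite_induct)
  case empty
  then show ?case by auto
next
  case (insert i I)
  note add = insert.prems(1) and scale = insert.prems(2) and neg = insert.prems(3) and dom = insert.prems(4)
  \<comment> \<open>For triples normalised to \<open>h i = 1\<close> the coefficient
    \<open>e\<close> has to lie between \<open>l - c\<close> and \<open>l + c\<close>;
    \<open>A\<close> collects the lower bounds, and subtracting two triples shows that none exceeds
    an upper bound.\<close>
  define A where "A = {l - c | h l c. (h, l, c) \<in> S \<and> (\<forall>k\<in>I. h k = 0) \<and> h i = 1}"
  \<comment> \<open>If \<open>A\<close> is empty, then by scaling and negation every triple that
    vanishes on \<open>I\<close> has \<open>h i = 0\<close>, and any coefficient works.\<close>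
  define e where "e = (if A = {} then 0 else Sup A)"
  have le: "l - c \<le> l' + c'" if "(h, l, c) \<in> S" "\<forall>k\<in>I. h k = 0" "h i = 1"
    "(h', l', c') \<in> S" "\<forall>k\<in>I. h' k = 0" "h' i = 1" for h l c h' l' c'
    using dom[OF add[OF that(1) neg[OF that(4)]]] that by auto
  have e1: "l - c \<le> e \<and> e \<le> l + c" if *: "(h, l, c) \<in> S" "\<forall>k\<in>I. h k = 0" "h i = 1" for h l c
  proof -
    have A: "l - c \<in> A" using * by (auto simp: A_def)
    have up: "a \<le> l + c" if "a \<in> A" for a using that le * unfolding A_def by blast
    have "l - c \<le> Sup A" by (rule cSup_upper[OF A bdd_aboveI[OF up]])
    moreover have "Sup A \<le> l + c" by (rule cSup_least) (use A up in auto)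
    ultimately show ?thesis using A by (auto simp: e_def)
  qed
  have pos: "l - e * h i \<le> c \<and> e * h i - l \<le> c"
    if *: "(h, l, c) \<in> S" "\<forall>k\<in>I. h k = 0" "h i > 0" for h l c
  proof -
    have "1 / h i * l - 1 / h i * c \<le> e \<and> e \<le> 1 / h i * l + 1 / h i * c"
      by (rule e1[of "\<lambda>k. 1 / h i * h k"]) (use scale[OF *(1), of "1 / h i"] * in auto)
    then show ?thesis using *(3) by (simp add: field_simps)
  qed
  have e: "l - e * h i \<le> c" if *: "(h, l, c) \<in> S" "\<forall>k\<in>I. h k = 0" for h l c
  proof (cases "h i" "0::real" rule: linorder_cases)
    case less
    then show ?thesis using pos[OF neg[OF *(1)]] * by simp
  next
    case equal
    then show ?thesis using dom[OF *(1)] * by simp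
  next
    case greater
    then show ?thesis using pos[OF *] by simp
  qed
  \<comment> \<open>With the coordinate \<open>i\<close> subtracted, the bound holds as soon as the
    coordinates in \<open>I\<close> vanish, which is what the induction hypothesis asks for.\<close>
  define S' where "S' = (\<lambda>(h, l, c). (h, l - e * h i, c)) ` S"
  have S': "(h, l, c) \<in> S' \<longleftrightarrow> (h, l + e * h i, c) \<in> S" for h l c
  proof
    assume "(h, l + e * h i, c) \<in> S"
    then show "(h, l, c) \<in> S'" unfolding S'_def by (rule rev_image_eqI) simp
  qed (auto simp: S'_def)
  have "\<exists>d. \<forall>(h, l, c)\<in>S'. l - (\<Sum>i\<in>I. d i * h i) \<le> c"
  proof (rule insert.IH)
    show "(\<lambda>i. h i + h' i, l + l', c + c') \<in> S'" if "(h, l, c) \<in> S'" "(h', l', c') \<in> S'" for h l c h' l' c'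
      using add[of h "l + e * h i" c h' "l' + e * h' i" c'] that by (simp add: S' algebra_simps)
    show "(\<lambda>i. t * h i, t * l, t * c) \<in> S'" if "(h, l, c) \<in> S'" "0 < t" for h l c t
      using scale[of h "l + e * h i" c t] that by (simp add: S' algebra_simps)
    show "(\<lambda>i. - h i, - l, c) \<in> S'" if "(h, l, c) \<in> S'" for h l c
      using neg[of h "l + e * h i" c] that by (simp add: S' algebra_simps)
    show "l \<le> c" if "(h, l, c) \<in> S'" "\<forall>i\<in>I. h i = 0" for h l c
      using e[of h "l + e * h i" c] that by (simp add: S')
  qed
  then obtain d where d: "\<And>h l c. (h, l, c) \<in> S' \<Longrightarrow> l - (\<Sum>i\<in>I. d i * h i) \<le> c" by blast
  show ?case
  proof (intro exI[of _ "d(i := e)"] ballI, clarify)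
    fix h l c assume "(h, l, c) \<in> S"
    then have "l - e * h i - (\<Sum>i\<in>I. d i * h i) \<le> c" by (intro d) (simp add: S')
    moreover have "(\<Sum>k\<in>insert i I. (d(i := e)) k * h k) = e * h i + (\<Sum>i\<in>I. d i * h i)"
      using insert.hyps by (simp, intro sum.cong) auto
    ultimately show "l - (\<Sum>k\<in>insert i I. (d(i := e)) k * h k) \<le> c" by linarith
  qed
qed

text \<open>The initial function is left open because the construction serves twice: from an affine
  minorant it exhausts a convex function by additive ones, and from another function
  \<open>g\<close> it reaches \<open>max g f\<close> by steps that preserve
  \<open>Y\<close>.\<close>

primrec affine_max :: "('a::real_inner \<Rightarrow> real) \<Rightarrow> (nat \<Rightarrow> 'a) \<Rightarrow> (nat \<Rightarrow> real) \<Rightarrow> nat \<Rightarrow> 'a \<Rightarrow> real" where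
  "affine_max g a b 0 = g"
| "affine_max g a b (Suc i) = (\<lambda>x. max (affine_max g a b i x) (a i \<bullet> x + b i))"

lemma convex_on_affine_max: "convex_on UNIV g \<Longrightarrow> convex_on UNIV (affine_max g a b i)"
  by (induction i) (auto intro!: convex_on_max convex_on_affine)

lemma affine_max_tendsto:
  assumes le: "\<And>i y. a i \<bullet> y + b i \<le> f y" and ap: "\<And>y e. e > 0 \<Longrightarrow> \<exists>i. f y - e < a i \<bullet> y + b i"
  shows "(\<lambda>i. affine_max g a b i x) \<longlonglongrightarrow> max (g x) (f x)"
proof (rule LIMSEQ_I)
  fix e :: real assume "e > 0"
  have up: "affine_max g a b i x \<le> max (g x) (f x)" for i
    by (induction i) (use le[of _ x] in \<open>auto intro: max.coboundedI2\<close>)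
  have inc: "incseq (\<lambda>i. affine_max g a b i x)" by (auto intro!: incseq_SucI)
  obtain i where i: "f x - e < a i \<bullet> x + b i" using ap[OF \<open>e > 0\<close>] by blast
  have "norm (affine_max g a b j x - max (g x) (f x)) < e" if "j \<ge> Suc i" for j
  proof -
    have "affine_max g a b (Suc i) x \<le> affine_max g a b j x" "affine_max g a b 0 x \<le> affine_max g a b j x"
      using inc that by (auto simp only: incseq_def)
    then have "f x - e < affine_max g a b j x" "g x \<le> affine_max g a b j x" using i by auto
    then show ?thesis using up[of j] \<open>e > 0\<close> by (auto simp: max_def split: if_splits)
  qed
  then show "\<exists>no. \<forall>n\<ge>no. norm (affine_max g a b n x - max (g x) (f x)) < e" by blast
qed

text \<open>The functional \<open>f \<mapsto> Z (f\<^sup>*)\<close> on finite convex functions.\<close>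

locale dual_valuation =
  fixes Y :: "('a::euclidean_space \<Rightarrow> real) \<Rightarrow> real"
  assumes cont: "\<And>F f. (\<And>j. convex_on UNIV (F j)) \<Longrightarrow> convex_on UNIV f \<Longrightarrow>
      (\<And>x. (\<lambda>j. F j x) \<longlonglongrightarrow> f x) \<Longrightarrow> (\<lambda>j. Y (F j)) \<longlonglongrightarrow> Y f"
    and affine: "\<And>f a b. convex_on UNIV f \<Longrightarrow> Y (\<lambda>x. f x + (a \<bullet> x + b)) = Y f"
    and hom: "\<And>f t. convex_on UNIV f \<Longrightarrow> t > 0 \<Longrightarrow> Y (\<lambda>x. t * f x) = t * Y f"
    and valuation: "\<And>f g. convex_on UNIV f \<Longrightarrow> convex_on UNIV g \<Longrightarrow>
      convex_on UNIV (\<lambda>x. min (f x) (g x)) \<Longrightarrow>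
      Y (\<lambda>x. max (f x) (g x)) + Y (\<lambda>x. min (f x) (g x)) = Y f + Y g"
begin

text \<open>Quantifying over all convex \<open>g\<close> for one fixed \<open>f\<close> makes the
  property inheritable: it passes to maxima with an affine function and to pointwise limits.\<close>

definition additive :: "('a \<Rightarrow> real) \<Rightarrow> bool" where
  "additive f \<longleftrightarrow> convex_on UNIV f \<and> (\<forall>g. convex_on UNIV g \<longrightarrow> Y (\<lambda>x. g x + f x) = Y g + Y f)"

lemma zero: "Y (\<lambda>x. 0) = 0"
  using hom[of "\<lambda>x. 0" 2] by (simp add: convex_on_const)

lemma affine_zero: "Y (\<lambda>x. a \<bullet> x + b) = 0"
  using affine[of "\<lambda>x. 0" a b] zero by (simp add: convex_on_const)

lemma additive_affine: "additive (\<lambda>x. a \<bullet> x + b)"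
  by (simp add: additive_def affine affine_zero convex_on_affine)

lemma additiveD: "additive f \<Longrightarrow> convex_on UNIV g \<Longrightarrow> Y (\<lambda>x. g x + f x) = Y g + Y f"
  by (simp add: additive_def)

lemma additive_scaled:
  assumes f: "additive f" and g: "convex_on UNIV g" and t: "t \<ge> 0"
  shows "Y (\<lambda>x. g x + t * f x) = Y g + t * Y f"
proof (cases "t = 0")
  case False
  then have t: "t > 0" using t by simp
  have "Y (\<lambda>x. g x + t * f x) = Y (\<lambda>x. t * (1 / t * g x + f x))" using t by (simp add: algebra_simps)
  also have "\<dots> = t * Y (\<lambda>x. 1 / t * g x + f x)"
    using t f g by (intro hom convex_on_add convex_on_cmul) (auto simp: additive_def)
  also have "Y (\<lambda>x. 1 / t * g x + f x) = Y (\<lambda>x. 1 / t * g x) + Y f"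
    using t g by (intro additiveD f convex_on_cmul) auto
  also have "Y (\<lambda>x. 1 / t * g x) = 1 / t * Y g" using t by (intro hom g) auto
  finally show ?thesis using t by (simp add: algebra_simps)
qed simp

lemma additive_max_affine:
  assumes B: "additive B"
  shows "additive (\<lambda>x. max (B x) (a \<bullet> x + b))"
proof -
  define c where "c x = a \<bullet> x + b" for x
  define f where "f x = max (B x) (c x)" for x
  have cB: "convex_on UNIV B" using B by (simp add: additive_def)
  have cc: "convex_on UNIV c" unfolding c_def by (rule convex_on_affine)
  have cf: "convex_on UNIV f" unfolding f_def by (rule convex_on_max[OF cB cc])
  have "Y (\<lambda>x. g x + f x) = Y g + Y f" if g: "convex_on UNIV g" for g
  proof -
    define \<phi> where "\<phi> m = Y (\<lambda>x. g x + real m * f x)" for m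
    have step: "\<phi> (Suc m) = \<phi> m + (\<phi> 1 - \<phi> 0)" for m
    proof -
      define u v where "u x = (g x + f x) + real m * B x" and "v x = (g x + real m * f x) + c x" for x
      have cu: "convex_on UNIV u" and cv: "convex_on UNIV v"
        unfolding u_def v_def by (intro convex_on_add convex_on_cmul g cf cB cc; simp)+
      have mn: "min (u x) (v x) = (g x + c x) + real m * B x"
        and mx: "max (u x) (v x) = g x + real (Suc m) * f x" for x
      proof -
        have f': "real (Suc m) * f x = f x + real m * f x" by (simp add: algebra_simps)
        have "min (u x) (v x) = (g x + c x) + real m * B x \<and> max (u x) (v x) = g x + real (Suc m) * f x"
        proof (cases "B x \<le> c x")
          case True
          then have "f x = c x" "real m * B x \<le> real m * c x" by (auto simp: f_def mult_left_mono)
          then show ?thesis unfolding u_def v_def f' by (simp add: min_def max_def)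
        next
          case False
          then have "f x = B x" "c x \<le> B x" by (auto simp: f_def)
          then show ?thesis unfolding u_def v_def f' by (simp add: min_def max_def)
        qed
        then show "min (u x) (v x) = (g x + c x) + real m * B x"
          "max (u x) (v x) = g x + real (Suc m) * f x" by auto
      qed
      \<comment> \<open>A minimum of convex functions is rarely convex; \<open>u\<close> and
        \<open>v\<close> are built so that this one is, as the valuation property demands.\<close>
      have "convex_on UNIV (\<lambda>x. min (u x) (v x))"
        unfolding mn by (intro convex_on_add convex_on_cmul g cB cc; simp)
      from valuation[OF cu cv this]
      have "\<phi> (Suc m) + Y (\<lambda>x. (g x + c x) + real m * B x) = Y u + Y v"
        unfolding mn mx \<phi>_def .
      moreover have "Y (\<lambda>x. (g x + c x) + real m * B x) = \<phi> 0 + real m * Y B"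
        using affine[OF g, of a b] by (subst additive_scaled[OF B convex_on_add[OF g cc]]) (simp_all add: c_def \<phi>_def)
      moreover have "Y u = \<phi> 1 + real m * Y B"
        unfolding u_def by (subst additive_scaled[OF B convex_on_add[OF g cf]]) (simp_all add: \<phi>_def)
      moreover have "Y v = \<phi> m"
        unfolding v_def c_def \<phi>_def by (intro affine convex_on_add convex_on_cmul g cf) simp
      ultimately show ?thesis by simp
    qed
    have \<phi>: "\<phi> m = \<phi> 0 + real m * (\<phi> 1 - \<phi> 0)" for m
    proof (induction m)
      case (Suc m)
      then show ?case using step[of m] by (simp add: algebra_simps)
    qed simp
    \<comment> \<open>Division by \<open>Suc m\<close> makes the contribution of \<open>g\<close>
      vanish in the limit, while the arithmetic progression retains only its difference.\<close>
    have "(\<lambda>m. \<phi> (Suc m) / real (Suc m)) \<longlonglongrightarrow> Y f"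
    proof -
      have "\<phi> (Suc m) / real (Suc m) = Y (\<lambda>x. inverse (real (Suc m)) * g x + f x)" for m
      proof -
        have "inverse (real (Suc m)) * \<phi> (Suc m)
            = Y (\<lambda>x. inverse (real (Suc m)) * (g x + real (Suc m) * f x))"
          unfolding \<phi>_def by (rule hom[symmetric]) (intro convex_on_add convex_on_cmul g cf, auto)
        also have "\<dots> = Y (\<lambda>x. inverse (real (Suc m)) * g x + f x)"
          by (simp add: distrib_left mult.assoc[symmetric] del: of_nat_Suc)
        finally show ?thesis by (simp add: divide_inverse mult.commute del: of_nat_Suc)
      qed
      moreover have "(\<lambda>m. Y (\<lambda>x. inverse (real (Suc m)) * g x + f x)) \<longlonglongrightarrow> Y f"
      proof (rule cont)
        show "(\<lambda>m. inverse (real (Suc m)) * g x + f x) \<longlonglongrightarrow> f x" for x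
          using tendsto_add[OF tendsto_mult_right[OF LIMSEQ_inverse_real_of_nat, of "g x"] tendsto_const[of "f x"]] by simp
      qed (intro convex_on_add convex_on_cmul g cf; simp)+
      ultimately show ?thesis by simp
    qed
    moreover have "(\<lambda>m. \<phi> (Suc m) / real (Suc m)) \<longlonglongrightarrow> \<phi> 1 - \<phi> 0"
    proof -
      have "\<phi> (Suc m) / real (Suc m) = inverse (real (Suc m)) * \<phi> 0 + (\<phi> 1 - \<phi> 0)" for m
        by (subst \<phi>) (simp add: add_divide_distrib divide_inverse[of "\<phi> 0"] mult.commute del: of_nat_Suc)
      then show ?thesis
        using tendsto_add[OF tendsto_mult_right[OF LIMSEQ_inverse_real_of_nat, of "\<phi> 0"] tendsto_const[of "\<phi> 1 - \<phi> 0"]] by simp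
    qed
    ultimately have "\<phi> 1 - \<phi> 0 = Y f" using LIMSEQ_unique by blast
    then show ?thesis by (simp add: \<phi>_def)
  qed
  then show ?thesis using cf unfolding additive_def f_def c_def by blast
qed

lemma additive_affine_max: "additive g \<Longrightarrow> additive (affine_max g a b i)"
  by (induction i) (auto intro: additive_max_affine)

lemma convex_imp_additive:
  assumes f: "convex_on UNIV f"
  shows "additive f"
proof -
  obtain a b where ab: "\<And>(i::nat) y. a i \<bullet> y + b i \<le> f y" "\<And>y e. e > 0 \<Longrightarrow> \<exists>i. f y - e < a i \<bullet> y + b i"
    using convex_countable_affine_minorants[OF f] by metis
  define F where "F = affine_max (\<lambda>x. a 0 \<bullet> x + b 0) a b"
  have F: "additive (F i)" for i unfolding F_def by (intro additive_affine_max additive_affine)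
  then have cF: "convex_on UNIV (F i)" for i by (simp add: additive_def)
  have lim: "(\<lambda>i. F i x) \<longlonglongrightarrow> f x" for x
    using affine_max_tendsto[OF ab, where g = "\<lambda>x. a 0 \<bullet> x + b 0" and x = x] ab(1)[of 0 x] by (simp add: F_def max_absorb2)
  have "Y (\<lambda>x. g x + f x) = Y g + Y f" if g: "convex_on UNIV g" for g
  proof (rule LIMSEQ_unique)
    show "(\<lambda>i. Y (\<lambda>x. g x + F i x)) \<longlonglongrightarrow> Y (\<lambda>x. g x + f x)"
      by (rule cont) (intro convex_on_add g cF f tendsto_intros lim)+
    have "(\<lambda>i. Y g + Y (F i)) \<longlonglongrightarrow> Y g + Y f"
      by (intro tendsto_intros cont cF f lim)
    then show "(\<lambda>i. Y (\<lambda>x. g x + F i x)) \<longlonglongrightarrow> Y g + Y f" by (simp add: additiveD[OF F g])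
  qed
  then show ?thesis using f by (simp add: additive_def)
qed

lemma add: "convex_on UNIV f \<Longrightarrow> convex_on UNIV g \<Longrightarrow> Y (\<lambda>x. f x + g x) = Y f + Y g"
  using convex_imp_additive additiveD by blast

section \<open>Locality\<close>

text \<open>Otherwise some \<open>f j\<close> vanish on balls of radius \<open>j + 1\<close> and
  have \<open>Y (f j) \<noteq> 0\<close>. Homogeneity scales these values to absolute value 1;
  however large the functions become, at each point they are eventually 0, against
  continuity.\<close>

lemma vanishes_off_ball:
  obtains r where "r > 0" "\<And>f. convex_on UNIV f \<Longrightarrow> (\<And>x. x \<in> cball 0 r \<Longrightarrow> f x = 0) \<Longrightarrow> Y f = 0"
proof -
  have "\<exists>r>0. \<forall>f. convex_on UNIV f \<longrightarrow> (\<forall>x\<in>cball 0 r. f x = 0) \<longrightarrow> Y f = 0"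
  proof (rule ccontr)
    assume "\<not> ?thesis"
    then have "\<exists>f. convex_on UNIV f \<and> (\<forall>x\<in>cball 0 (real (Suc j)). f x = 0) \<and> Y f \<noteq> 0" for j
      by (metis of_nat_0_less_iff zero_less_Suc)
    then obtain f where f: "\<And>j. convex_on UNIV (f j)" "\<And>j x. x \<in> cball 0 (real (Suc j)) \<Longrightarrow> f j x = 0" "\<And>j. Y (f j) \<noteq> 0"
      by metis
    define h where "h j x = (1 / \<bar>Y (f j)\<bar>) * f j x" for j x
    have "(\<lambda>j. Y (h j)) \<longlonglongrightarrow> Y (\<lambda>x. 0)"
    proof (rule cont)
      show "convex_on UNIV (h j)" for j unfolding h_def by (intro convex_on_cmul f) simp
      show "(\<lambda>j. h j x) \<longlonglongrightarrow> 0" for x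
      proof (rule tendsto_eventually)
        obtain n where n: "norm x \<le> real n" using real_arch_simple by blast
        show "\<forall>\<^sub>F j in sequentially. h j x = 0"
          by (rule eventually_sequentiallyI[of n]) (use n f(2) in \<open>auto simp: h_def\<close>)
      qed
    qed (simp add: convex_on_const)
    then have "(\<lambda>j. \<bar>Y (h j)\<bar>) \<longlonglongrightarrow> 0" using zero tendsto_rabs_zero by simp
    moreover have "\<bar>Y (h j)\<bar> = 1" for j
      unfolding h_def using f(3)[of j] by (subst hom[OF f(1)]) (auto simp: abs_mult)
    ultimately show False by (simp add: LIMSEQ_const_iff)
  qed
  then show thesis using that by blast
qed


text \<open>Adding to \<open>g\<close> and to \<open>max g l\<close> suitable convex functions that vanish on the smaller ball, namely
  \<open>max 0 (g - l + \<Phi>)\<close> and \<open>max 0 (max 0 (g - l) + \<Phi>)\<close> with a steep cone \<open>\<Phi>\<close>, gives the same function.\<close>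

lemma max_affine_outside_ball:
  assumes r: "r > 0" and van: "\<And>f. convex_on UNIV f \<Longrightarrow> (\<And>x. x \<in> cball 0 r \<Longrightarrow> f x = 0) \<Longrightarrow> Y f = 0"
    and g: "convex_on UNIV g" and le: "\<And>x. x \<in> cball 0 (r + 1) \<Longrightarrow> a \<bullet> x + b \<le> g x"
  shows "Y (\<lambda>x. max (g x) (a \<bullet> x + b)) = Y g"
proof -
  define p where "p x = g x + ((- a) \<bullet> x + (- b))" for x
  have p: "convex_on UNIV p" unfolding p_def by (intro convex_on_add g convex_on_affine)
  have pg: "p x = g x - (a \<bullet> x + b)" for x by (simp add: p_def)
  obtain c where c: "\<And>x. x \<in> cball 0 r \<Longrightarrow> \<bar>p x\<bar> \<le> c" using convex_bounded_on_cball[OF p] by metis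
  have p0: "0 \<le> p 0" using le[of 0] r by (simp add: pg)
  have c0: "0 \<le> c" using c[of 0] r p0 by simp
  \<comment> \<open>The steepness meets two demands: \<open>2 * c \<le> N\<close> pushes the cone
    below \<open>- c\<close> on the ball of radius \<open>r\<close>, and \<open>p 0 \<le> N\<close>
    makes it rise at least as fast as \<open>p\<close> can fall beyond radius \<open>r + 1\<close>.
    The cone changes sign halfway, at \<open>r + 1/2\<close>.\<close>
  define N where "N = p 0 + 2 * c"
  have N: "0 \<le> N" "p 0 \<le> N" "2 * c \<le> N" using p0 c0 by (auto simp: N_def)
  define \<Phi> where "\<Phi> x = N * (norm x - (r + 1/2))" for x :: 'a
  have "convex_on UNIV (\<lambda>x. N * (dist 0 x + (0 \<bullet> x + (- (r + 1/2)))))"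
    by (intro convex_on_cmul convex_on_add convex_on_affine convex_on_dist N) simp
  moreover have "\<Phi> = (\<lambda>x. N * (dist 0 x + (0 \<bullet> x + (- (r + 1/2)))))" by (simp add: fun_eq_iff \<Phi>_def)
  ultimately have \<Phi>: "convex_on UNIV \<Phi>" by (simp only:)
  have in_ball: "p x + \<Phi> x \<le> 0" "max 0 (p x) + \<Phi> x \<le> 0" if x: "x \<in> cball 0 r" for x
  proof -
    have "N * (norm x - (r + 1/2)) \<le> N * (- (1/2))" using x N by (intro mult_left_mono) auto
    then have "\<Phi> x \<le> - c" using N by (simp add: \<Phi>_def)
    then show "p x + \<Phi> x \<le> 0" "max 0 (p x) + \<Phi> x \<le> 0" using c[OF x] by auto
  qed
  have out: "0 \<le> p x + \<Phi> x" "0 \<le> \<Phi> x" if x: "p x < 0" for x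
  proof -
    have xr: "r + 1 < norm x" using le[of x] x by (fastforce simp: pg)
    define t where "t = (r + 1) / norm x"
    have nx: "norm x > 0" using xr r by linarith
    have t: "0 \<le> t" "t \<le> 1" "t * norm x = r + 1" using xr r nx by (auto simp: t_def)
    have "0 \<le> p (t *\<^sub>R x)" using le[of "t *\<^sub>R x"] t r by (simp add: pg)
    also have "\<dots> \<le> (1 - t) * p 0 + t * p x"
      using p[unfolded convex_on_UNIV_iff_segment, rule_format, of t 0 x] t by simp
    finally have "0 \<le> norm x * ((1 - t) * p 0 + t * p x)" using nx by simp
    then have "0 \<le> (norm x - t * norm x) * p 0 + (t * norm x) * p x" by (simp add: algebra_simps)
    then have *: "0 \<le> (norm x - (r + 1)) * p 0 + (r + 1) * p x" unfolding t(3) .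
    have "(r + 1) * p x \<le> 1 * p x" using x r by (intro mult_right_mono_neg) auto
    then have "0 \<le> (norm x - (r + 1)) * p 0 + p x" using * by simp
    also have "\<dots> \<le> (norm x - (r + 1)) * N + p x" using xr N by (intro add_mono mult_left_mono) auto
    also have "\<dots> \<le> N * (norm x - (r + 1/2)) + p x"
      using N by (subst mult.commute) (intro add_mono mult_left_mono, auto)
    finally show "0 \<le> p x + \<Phi> x" by (simp add: \<Phi>_def)
    then show "0 \<le> \<Phi> x" using x by simp
  qed
  define M where "M x = max 0 (p x + \<Phi> x)" for x
  define M' where "M' x = max 0 (max 0 (p x) + \<Phi> x)" for x
  have const: "convex_on UNIV (\<lambda>x::'a. 0)" by (simp add: convex_on_const)
  have M: "convex_on UNIV M" unfolding M_def by (intro convex_on_max convex_on_add const p \<Phi>)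
  have M': "convex_on UNIV M'" unfolding M'_def by (intro convex_on_max convex_on_add const p \<Phi>)
  have YM: "Y M = 0" "Y M' = 0" using in_ball by (auto intro!: van M M' simp: M_def M'_def)
  have "max (g x) (a \<bullet> x + b) + M x = g x + M' x" for x
    using out[of x] by (cases "p x < 0") (auto simp: M_def M'_def pg max_def)
  then have "Y (\<lambda>x. max (g x) (a \<bullet> x + b) + M x) = Y (\<lambda>x. g x + M' x)" by simp
  then show ?thesis
    using add[OF convex_on_max[OF g convex_on_affine[of a b]] M] add[OF g M'] YM by simp
qed

text \<open>Both values equal that of the maximum of \<open>f\<close> and \<open>g\<close>: affine
  minorants of \<open>f\<close> lie below \<open>g\<close> on the ball, so adding them to
  \<open>g\<close> one at a time changes neither \<open>Y\<close> nor the values on the ball, and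
  vice versa.\<close>

lemma eq_if_eq_on_cball:
  assumes r: "r > 0" and van: "\<And>f. convex_on UNIV f \<Longrightarrow> (\<And>x. x \<in> cball 0 r \<Longrightarrow> f x = 0) \<Longrightarrow> Y f = 0"
    and f: "convex_on UNIV f" and g: "convex_on UNIV g" and eq: "\<And>x. x \<in> cball 0 (r + 1) \<Longrightarrow> f x = g x"
  shows "Y f = Y g"
proof -
  have *: "Y (\<lambda>x. max (g x) (f x)) = Y g"
    if f: "convex_on UNIV f" and g: "convex_on UNIV g" and eq: "\<And>x. x \<in> cball 0 (r + 1) \<Longrightarrow> f x = g x" for f g
  proof -
    obtain a b where ab: "\<And>(i::nat) y. a i \<bullet> y + b i \<le> f y" "\<And>y e. e > 0 \<Longrightarrow> \<exists>i. f y - e < a i \<bullet> y + b i"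
      using convex_countable_affine_minorants[OF f] by metis
    have G: "Y (affine_max g a b i) = Y g \<and> (\<forall>x\<in>cball 0 (r + 1). affine_max g a b i x = g x)" for i
    proof (induction i)
      case (Suc i)
      have "a i \<bullet> x + b i \<le> g x" if "x \<in> cball 0 (r + 1)" for x using ab(1)[of i x] eq[OF that] by simp
      then show ?case
        using Suc max_affine_outside_ball[OF r van convex_on_affine_max[OF g], of "a i" "b i" a b i] by simp
    qed simp
    have "(\<lambda>i. Y (affine_max g a b i)) \<longlonglongrightarrow> Y (\<lambda>x. max (g x) (f x))"
      by (intro cont convex_on_affine_max convex_on_max g f affine_max_tendsto ab)
    then show ?thesis using G by (simp add: LIMSEQ_const_iff)
  qed
  have "Y (\<lambda>x. max (g x) (f x)) = Y g" by (rule *[OF f g eq])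
  moreover have "Y (\<lambda>x. max (f x) (g x)) = Y f" by (rule *[OF g f]) (simp add: eq)
  ultimately show ?thesis by (simp add: max.commute)
qed

section \<open>Compactness and approximation by point evaluations\<close>

text \<open>One constant bounds both the slopes and the value at \<open>0\<close>. It adds and
  scales with the functions, so that the infimum of the common constants of \<open>f\<close> and
  \<open>g\<close> acts as a seminorm on differences, and for \<open>c = 1\<close> the class is
  compact under pointwise convergence.\<close>

definition Lipschitz_convex :: "('a \<Rightarrow> real) \<Rightarrow> real \<Rightarrow> bool" where
  "Lipschitz_convex f c \<longleftrightarrow> convex_on UNIV f \<and> (\<forall>x y. \<bar>f x - f y\<bar> \<le> c * norm (x - y)) \<and> \<bar>f 0\<bar> \<le> c"

lemma Lipschitz_convex_add:
  assumes "Lipschitz_convex f c" "Lipschitz_convex g d"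
  shows "Lipschitz_convex (\<lambda>x. f x + g x) (c + d)"
  unfolding Lipschitz_convex_def
proof (intro conjI allI)
  show "convex_on UNIV (\<lambda>x. f x + g x)" using assms by (auto simp: Lipschitz_convex_def)
  show "\<bar>f 0 + g 0\<bar> \<le> c + d" using assms unfolding Lipschitz_convex_def by linarith
  fix x y
  have "\<bar>f x - f y\<bar> \<le> c * norm (x - y)" "\<bar>g x - g y\<bar> \<le> d * norm (x - y)"
    using assms by (auto simp: Lipschitz_convex_def)
  then show "\<bar>f x + g x - (f y + g y)\<bar> \<le> (c + d) * norm (x - y)" unfolding distrib_right by linarith
qed

lemma Lipschitz_convex_scale:
  assumes "Lipschitz_convex f c" "t > 0"
  shows "Lipschitz_convex (\<lambda>x. t * f x) (t * c)"
  unfolding Lipschitz_convex_def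
proof (intro conjI allI)
  show "convex_on UNIV (\<lambda>x. t * f x)" using assms by (auto simp: Lipschitz_convex_def)
  show "\<bar>t * f 0\<bar> \<le> t * c" using assms by (auto simp: Lipschitz_convex_def abs_mult)
  fix x y
  have "t * \<bar>f x - f y\<bar> \<le> t * (c * norm (x - y))" using assms by (auto simp: Lipschitz_convex_def)
  then show "\<bar>t * f x - t * f y\<bar> \<le> t * c * norm (x - y)"
    using assms(2) by (simp add: right_diff_distrib[symmetric] abs_mult mult.assoc)
qed

text \<open>If it failed, pairs scaled to constant 1 would agree at more and more points of a dense
  set and still have values more than \<open>\<eta>\<close> apart; their subsequential limits would
  agree on the ball that determines \<open>Y\<close>.\<close>

lemma finitely_many_points_determine:
  assumes r: "r > 0" and van: "\<And>f. convex_on UNIV f \<Longrightarrow> (\<And>x. x \<in> cball 0 r \<Longrightarrow> f x = 0) \<Longrightarrow> Y f = 0"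
    and \<eta>: "\<eta> > 0"
  obtains I where "finite I" "I \<subseteq> cball 0 (r + 2)"
    "\<And>f g c. Lipschitz_convex f c \<Longrightarrow> Lipschitz_convex g c \<Longrightarrow> (\<And>y. y \<in> I \<Longrightarrow> f y = g y) \<Longrightarrow> Y f - Y g \<le> \<eta> * c"
proof -
  obtain D :: "'a set" where D: "countable D" "\<And>X. open X \<Longrightarrow> X \<noteq> {} \<Longrightarrow> \<exists>d \<in> D. d \<in> X"
    using countable_dense_setE by metis
  have "D \<noteq> {}" using D(2)[of UNIV] by auto
  define e where "e = from_nat_into D"
  have e: "range e = D" unfolding e_def by (rule range_from_nat_into[OF \<open>D \<noteq> {}\<close> D(1)])
  \<comment> \<open>Radius \<open>r + 2\<close> makes the points dense around every point of the
    closed ball of radius \<open>r + 1\<close>, its boundary included.\<close>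
  define I where "I N = {y \<in> e ` {..<N}. norm y \<le> r + 2}" for N
  have "\<exists>N. \<forall>f g c. Lipschitz_convex f c \<longrightarrow> Lipschitz_convex g c \<longrightarrow> (\<forall>y\<in>I N. f y = g y) \<longrightarrow> Y f - Y g \<le> \<eta> * c"
  proof (rule ccontr)
    assume "\<not> ?thesis"
    then have "\<forall>N. \<exists>f g c. Lipschitz_convex f c \<and> Lipschitz_convex g c \<and> (\<forall>y\<in>I N. f y = g y) \<and> \<eta> * c < Y f - Y g"
      by (auto simp: not_le)
    then obtain f g c where fgc: "\<And>N. Lipschitz_convex (f N) (c N)" "\<And>N. Lipschitz_convex (g N) (c N)"
      "\<And>N y. y \<in> I N \<Longrightarrow> f N y = g N y" "\<And>N. \<eta> * c N < Y (f N) - Y (g N)" by metis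
    \<comment> \<open>Constant 0 forces both functions to vanish, so a violating pair can always be
      divided by \<open>c N\<close>.\<close>
    have c: "c N > 0" for N
    proof (rule ccontr)
      assume "\<not> c N > 0"
      moreover have "c N \<ge> 0" using fgc(1)[of N] unfolding Lipschitz_convex_def by linarith
      ultimately have c0: "c N = 0" by simp
      have "f N x = 0" "g N x = 0" for x
        using fgc(1,2)[of N] unfolding Lipschitz_convex_def c0 by (metis abs_le_zero_iff eq_iff_diff_eq_0 mult_zero_left)+
      then have "f N = (\<lambda>x. 0)" "g N = (\<lambda>x. 0)" by auto
      then show False using fgc(4)[of N] c0 by simp
    qed
    define F G where "F N x = 1 / c N * f N x" and "G N x = 1 / c N * g N x" for N x
    have "Lipschitz_convex (F N) (1 / c N * c N)" "Lipschitz_convex (G N) (1 / c N * c N)" for N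
      unfolding F_def G_def using c[of N] by (intro Lipschitz_convex_scale fgc; simp)+
    then have LF: "Lipschitz_convex (F N) 1" and LG: "Lipschitz_convex (G N) 1" for N
      using c[of N] by (metis less_irrefl nonzero_divide_eq_eq)+
    have cF: "convex_on UNIV (F N)" and cG: "convex_on UNIV (G N)" for N
      using LF LG by (auto simp: Lipschitz_convex_def)
    have gap: "\<eta> < Y (F N) - Y (G N)" for N
    proof -
      have "Y (F N) = 1 / c N * Y (f N)" "Y (G N) = 1 / c N * Y (g N)"
        unfolding F_def G_def using c[of N] fgc(1,2)[of N] by (auto intro!: hom simp: Lipschitz_convex_def simp del: times_divide_eq_left)
      then have "Y (F N) - Y (G N) = (Y (f N) - Y (g N)) / c N" by (simp add: diff_divide_distrib)
      moreover have "\<eta> < (Y (f N) - Y (g N)) / c N" using fgc(4)[of N] c[of N] by (simp only: pos_less_divide_eq)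
      ultimately show ?thesis by (simp only:)
    qed
    obtain p F' where p: "strict_mono (p :: nat \<Rightarrow> nat)" "convex_on UNIV F'" "\<And>x. (\<lambda>j. F (p j) x) \<longlonglongrightarrow> F' x"
      using Lipschitz_convex_subsequence[of F] LF by (auto simp: Lipschitz_convex_def)
    obtain q G' where q: "strict_mono (q :: nat \<Rightarrow> nat)" "convex_on UNIV G'" "\<And>x. (\<lambda>j. G (p (q j)) x) \<longlonglongrightarrow> G' x"
      using Lipschitz_convex_subsequence[of "\<lambda>j. G (p j)"] LG by (auto simp: Lipschitz_convex_def)
    have F': "(\<lambda>j. F (p (q j)) x) \<longlonglongrightarrow> F' x" for x
      using LIMSEQ_subseq_LIMSEQ[OF p(3) q(1)] by (simp add: o_def)
    have pq: "j \<le> p (q j)" for j using p(1) q(1) by (meson le_trans seq_suble)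
    have eqD: "F' x = G' x" if x: "x \<in> D" "norm x \<le> r + 2" for x
    proof -
      obtain i where i: "x = e i" using x e by blast
      have "\<forall>\<^sub>F j in sequentially. F (p (q j)) x = G (p (q j)) x"
      proof (rule eventually_sequentiallyI[of "Suc i"])
        fix j assume "Suc i \<le> j"
        then have "x \<in> I (p (q j))" using pq[of j] x i by (auto simp: I_def)
        then show "F (p (q j)) x = G (p (q j)) x" by (simp add: F_def G_def fgc(3))
      qed
      then have "(\<lambda>j. G (p (q j)) x) \<longlonglongrightarrow> F' x" using F'[of x] by (simp cong: tendsto_cong)
      then show ?thesis using q(3) LIMSEQ_unique by blast
    qed
    have eq: "F' x = G' x" if x: "x \<in> cball 0 (r + 1)" for x
    proof (rule ccontr)
      assume ne: "F' x \<noteq> G' x"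
      have "open (ball 0 (r + 2) \<inter> {z. F' z \<noteq> G' z})"
        by (intro open_Int open_ball open_Collect_neq convex_continuous p(2) q(2))
      moreover have "x \<in> ball 0 (r + 2) \<inter> {z. F' z \<noteq> G' z}" using ne x by simp
      ultimately obtain z where "z \<in> D" "z \<in> ball 0 (r + 2) \<inter> {z. F' z \<noteq> G' z}" using D(2) by blast
      then show False using eqD[of z] by simp
    qed
    have "Y F' = Y G'" by (rule eq_if_eq_on_cball[OF r van p(2) q(2) eq])
    moreover have "(\<lambda>j. Y (F (p (q j))) - Y (G (p (q j)))) \<longlonglongrightarrow> Y F' - Y G'"
      by (intro tendsto_diff cont cF cG p(2) q(2,3) F')
    then have "\<eta> \<le> Y F' - Y G'"
      by (rule LIMSEQ_le_const) (use gap less_imp_le in blast)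
    ultimately show False using \<eta> by simp
  qed
  then obtain N where N: "\<And>f g c. Lipschitz_convex f c \<Longrightarrow> Lipschitz_convex g c \<Longrightarrow> (\<forall>y\<in>I N. f y = g y) \<Longrightarrow> Y f - Y g \<le> \<eta> * c"
    by blast
  show thesis by (rule that[of "I N"]) (use N in \<open>auto simp: I_def\<close>)
qed

text \<open>On differences \<open>f - g\<close> that vanish on \<open>I\<close>, the functional
  \<open>Y f - Y g\<close> is at most \<open>\<eta> / 2\<close> times the seminorm. Subtracting
  suitable evaluations at the points of \<open>I\<close> extends this bound to all differences of
  Lipschitz convex functions.\<close>

lemma discrete_approximation:
  obtains \<rho> where "\<rho> \<ge> 1" "\<And>\<eta>. \<eta> > 0 \<Longrightarrow> \<exists>I d. finite I \<and> I \<subseteq> cball 0 \<rho> \<and>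
    (\<forall>f c. convex_on UNIV f \<longrightarrow> (\<forall>y\<in>cball 0 \<rho>. \<bar>f y\<bar> \<le> c) \<longrightarrow> \<bar>Y f - (\<Sum>y\<in>I. d y * f y)\<bar> \<le> \<eta> * c)"
proof -
  obtain r where r: "r > 0" and van: "\<And>f. convex_on UNIV f \<Longrightarrow> (\<And>x. x \<in> cball 0 r \<Longrightarrow> f x = 0) \<Longrightarrow> Y f = 0"
    using vanishes_off_ball by metis
  show thesis
  \<comment> \<open>The points of \<open>I\<close> have norm at most \<open>r + 2\<close>, and the
    Lipschitz extension from that ball uses bounds one unit further out. It costs a factor 2, which
    the \<open>\<eta> / 2\<close> below absorbs.\<close>
  proof (rule that[of "r + 3"])
    show "1 \<le> r + 3" using r by simp
    fix \<eta> :: real assume "\<eta> > 0"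
    then have "\<eta> / 2 > 0" by simp
    obtain I where I: "finite I" "I \<subseteq> cball 0 (r + 2)"
      "\<And>f g c. Lipschitz_convex f c \<Longrightarrow> Lipschitz_convex g c \<Longrightarrow> (\<And>y. y \<in> I \<Longrightarrow> f y = g y) \<Longrightarrow> Y f - Y g \<le> \<eta> / 2 * c"
      using finitely_many_points_determine[OF r van \<open>\<eta> / 2 > 0\<close>] by metis
    \<comment> \<open>A relation rather than a functional: it records every representation of a
      difference, so neither a choice of representatives nor a space of differences enters.\<close>
    define S where "S = {(\<lambda>y. f y - g y, Y f - Y g, \<eta> / 2 * c) | f g c. Lipschitz_convex f c \<and> Lipschitz_convex g c}"
    have SI: "(\<lambda>y. f y - g y, Y f - Y g, \<eta> / 2 * c) \<in> S" if "Lipschitz_convex f c" "Lipschitz_convex g c" for f g c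
      using that by (auto simp: S_def)
    have "\<exists>d. \<forall>(h, l, c)\<in>S. l - (\<Sum>i\<in>I. d i * h i) \<le> c"
    proof (rule finite_codimension_dominated[OF I(1)])
      fix h l c h' l' c' assume "(h, l, c) \<in> S" "(h', l', c') \<in> S"
      then obtain f g d f' g' d' where *: "h = (\<lambda>y. f y - g y)" "l = Y f - Y g" "c = \<eta> / 2 * d"
        "Lipschitz_convex f d" "Lipschitz_convex g d" "h' = (\<lambda>y. f' y - g' y)" "l' = Y f' - Y g'" "c' = \<eta> / 2 * d'"
        "Lipschitz_convex f' d'" "Lipschitz_convex g' d'" unfolding S_def by blast
      have "(\<lambda>i. h i + h' i, l + l', c + c') =
        (\<lambda>y. (f y + f' y) - (g y + g' y), Y (\<lambda>y. f y + f' y) - Y (\<lambda>y. g y + g' y), \<eta> / 2 * (d + d'))"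
        using * by (simp add: Lipschitz_convex_def add distrib_left fun_eq_iff)
      then show "(\<lambda>i. h i + h' i, l + l', c + c') \<in> S"
        using SI[OF Lipschitz_convex_add[OF *(4,9)] Lipschitz_convex_add[OF *(5,10)]] by (simp only:)
    next
      fix h l c and t :: real assume "(h, l, c) \<in> S" and t: "t > 0"
      then obtain f g d where *: "h = (\<lambda>y. f y - g y)" "l = Y f - Y g" "c = \<eta> / 2 * d"
        "Lipschitz_convex f d" "Lipschitz_convex g d" unfolding S_def by blast
      have "(\<lambda>i. t * h i, t * l, t * c) =
        (\<lambda>y. t * f y - t * g y, Y (\<lambda>y. t * f y) - Y (\<lambda>y. t * g y), \<eta> / 2 * (t * d))"
        using * t by (simp add: Lipschitz_convex_def hom right_diff_distrib fun_eq_iff)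
      then show "(\<lambda>i. t * h i, t * l, t * c) \<in> S"
        using SI[OF Lipschitz_convex_scale[OF *(4) t] Lipschitz_convex_scale[OF *(5) t]] by (simp only:)
    next
      fix h l c assume "(h, l, c) \<in> S"
      then obtain f g d where *: "h = (\<lambda>y. f y - g y)" "l = Y f - Y g" "c = \<eta> / 2 * d"
        "Lipschitz_convex f d" "Lipschitz_convex g d" unfolding S_def by blast
      then have "(\<lambda>i. - h i, - l, c) = (\<lambda>y. g y - f y, Y g - Y f, \<eta> / 2 * d)" by (simp add: fun_eq_iff)
      then show "(\<lambda>i. - h i, - l, c) \<in> S" using SI[OF *(5,4)] by (simp only:)
    next
      fix h l c assume "(h, l, c) \<in> S" and h: "\<forall>i\<in>I. h i = 0"
      then obtain f g d where *: "h = (\<lambda>y. f y - g y)" "l = Y f - Y g" "c = \<eta> / 2 * d"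
        "Lipschitz_convex f d" "Lipschitz_convex g d" unfolding S_def by blast
      then show "l \<le> c" using I(3)[OF *(4,5)] h by simp
    qed
    then obtain d where d: "\<And>h l c. (h, l, c) \<in> S \<Longrightarrow> l - (\<Sum>i\<in>I. d i * h i) \<le> c" by blast
    have bound: "\<bar>Y f - (\<Sum>y\<in>I. d y * f y)\<bar> \<le> \<eta> * c"
      if f: "convex_on UNIV f" and c: "\<forall>y\<in>cball 0 (r + 3). \<bar>f y\<bar> \<le> c" for f c
    proof -
      have "\<bar>f y\<bar> \<le> c" if "y \<in> cball 0 (r + 2 + 1)" for y using c that by simp
      then obtain g where g: "convex_on UNIV g" "\<And>x y. \<bar>g x - g y\<bar> \<le> 2 * c * norm (x - y)"
        "\<And>x. x \<in> cball 0 (r + 2) \<Longrightarrow> g x = f x"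
        using convex_Lipschitz_extension[OF f, of "r + 2" c] r by (metis add_nonneg_nonneg less_imp_le zero_le_numeral)
      have c0: "\<bar>f 0\<bar> \<le> c" using c r by simp
      have Lg: "Lipschitz_convex g (2 * c)"
        unfolding Lipschitz_convex_def using g(1,2) g(3)[of 0] c0 r by simp
      have L0: "Lipschitz_convex (\<lambda>x. 0) (2 * c)"
        unfolding Lipschitz_convex_def using c0 by (simp add: convex_on_const)
      have fg: "Y f = Y g" using g(3) by (intro eq_if_eq_on_cball[OF r van f g(1)]) auto
      have sum: "(\<Sum>y\<in>I. d y * f y) = (\<Sum>y\<in>I. d y * g y)" using I(2) g(3) by (intro sum.cong) auto
      have "Y g - 0 - (\<Sum>y\<in>I. d y * (g y - 0)) \<le> \<eta> / 2 * (2 * c)"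
        using d[OF SI[OF Lg L0]] zero by simp
      moreover have "0 - Y g - (\<Sum>y\<in>I. d y * (0 - g y)) \<le> \<eta> / 2 * (2 * c)"
        using d[OF SI[OF L0 Lg]] zero by simp
      ultimately show ?thesis unfolding fg sum by (simp add: sum_negf abs_le_iff)
    qed
    show "\<exists>I d. finite I \<and> I \<subseteq> cball 0 (r + 3) \<and> (\<forall>f c. convex_on UNIV f \<longrightarrow>
        (\<forall>y\<in>cball 0 (r + 3). \<bar>f y\<bar> \<le> c) \<longrightarrow> \<bar>Y f - (\<Sum>y\<in>I. d y * f y)\<bar> \<le> \<eta> * c)"
      using I(1,2) bound by (intro exI[of _ I] exI[of _ d]) auto
  qed
qed

end

subsection \<open>Thin tubes\<close>

text \<open>For a unit vector \<open>e\<close>, the solid cylinder of radius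
  \<open>\<epsilon>\<close> around the axis through \<open>0\<close> with direction
  \<open>e\<close>, between the levels \<open>a\<close> and \<open>b\<close>; in dimension one, an
  interval.\<close>

definition tube :: "'a::euclidean_space \<Rightarrow> real \<Rightarrow> real \<Rightarrow> real \<Rightarrow> 'a set" where
  "tube e \<epsilon> a b = {x. a \<le> e \<bullet> x \<and> e \<bullet> x \<le> b \<and> norm (x - (e \<bullet> x) *\<^sub>R e) \<le> \<epsilon>}"

lemma tube_eq: "tube e \<epsilon> a b = {x. e \<bullet> x \<ge> a} \<inter> {x. e \<bullet> x \<le> b} \<inter> (\<lambda>x. x - (e \<bullet> x) *\<^sub>R e) -` cball 0 \<epsilon>"
  by (auto simp: tube_def)

lemma convex_tube: "convex (tube e \<epsilon> a b)"
  unfolding tube_eq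
proof (intro convex_Int convex_halfspace_ge convex_halfspace_le convex_linear_vimage convex_cball)
  show "linear (\<lambda>x. x - (e \<bullet> x) *\<^sub>R e)"
    by (rule linearI) (simp_all add: inner_simps scaleR_add_left scaleR_diff_right)
qed

lemma compact_tube:
  assumes "norm e = 1"
  shows "compact (tube e \<epsilon> a b)"
proof -
  have "closed (tube e \<epsilon> a b)"
    unfolding tube_eq
    by (intro closed_Int closed_vimage closed_cball closed_halfspace_ge closed_halfspace_le continuous_intros)
  moreover have "bounded (tube e \<epsilon> a b)"
  proof (rule boundedI)
    fix x assume x: "x \<in> tube e \<epsilon> a b"
    have "norm x \<le> norm (x - (e \<bullet> x) *\<^sub>R e) + norm ((e \<bullet> x) *\<^sub>R e)"
      using norm_triangle_ineq[of "x - (e \<bullet> x) *\<^sub>R e" "(e \<bullet> x) *\<^sub>R e"] by simp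
    also have "\<dots> \<le> \<epsilon> + (\<bar>a\<bar> + \<bar>b\<bar>)" using x assms by (auto simp: tube_def intro!: add_mono)
    finally show "norm x \<le> \<epsilon> + (\<bar>a\<bar> + \<bar>b\<bar>)" .
  qed
  ultimately show ?thesis by (simp add: compact_eq_bounded_closed)
qed

lemma lmeasurable_tube: "norm e = 1 \<Longrightarrow> tube e \<epsilon> a b \<in> lmeasurable"
  by (intro lmeasurable_compact compact_tube)

lemma tube_translate:
  assumes e: "norm e = 1"
  shows "(+) (t *\<^sub>R e) ` tube e \<epsilon> a b = tube e \<epsilon> (a + t) (b + t)"
proof -
  have ee: "e \<bullet> e = 1" using e by (simp add: dot_square_norm)
  have *: "t *\<^sub>R e + x \<in> tube e \<epsilon> (a + t) (b + t) \<longleftrightarrow> x \<in> tube e \<epsilon> a b" for x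
    by (simp add: tube_def inner_simps ee algebra_simps)
  show ?thesis
  proof (intro equalityI subsetI)
    fix y assume "y \<in> tube e \<epsilon> (a + t) (b + t)"
    then have "y - t *\<^sub>R e \<in> tube e \<epsilon> a b" using *[of "y - t *\<^sub>R e"] by simp
    then show "y \<in> (+) (t *\<^sub>R e) ` tube e \<epsilon> a b" by (rule rev_image_eqI) simp
  qed (use * in auto)
qed

lemma negligible_level: "norm e = 1 \<Longrightarrow> negligible {x. e \<bullet> x = c}"
  by (intro negligible_hyperplane) auto

lemma measure_tube_eq_0: "norm e = 1 \<Longrightarrow> measure lebesgue (tube e \<epsilon> a a) = 0"
  by (intro negligible_imp_measure0 negligible_subset[OF negligible_level[of e a]]) (auto simp: tube_def)

lemma measure_tube_add:
  assumes e: "norm e = 1" and st: "0 \<le> s" "0 \<le> t"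
  shows "measure lebesgue (tube e \<epsilon> 0 s) + measure lebesgue (tube e \<epsilon> 0 t) = measure lebesgue (tube e \<epsilon> 0 (s + t))"
proof (rule measure_translate_add[where a = "s *\<^sub>R e"])
  have eq: "(+) (s *\<^sub>R e) ` tube e \<epsilon> 0 t = tube e \<epsilon> s (s + t)"
    using tube_translate[OF e, of s \<epsilon> 0 t] by (simp only: add_0 add.commute[of t s])
  show "tube e \<epsilon> 0 s \<union> (+) (s *\<^sub>R e) ` tube e \<epsilon> 0 t = tube e \<epsilon> 0 (s + t)"
    unfolding eq using st by (auto simp: tube_def)
  show "negligible (tube e \<epsilon> 0 s \<inter> (+) (s *\<^sub>R e) ` tube e \<epsilon> 0 t)"
    unfolding eq by (rule negligible_subset[OF negligible_level[OF e, of s]]) (auto simp: tube_def)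
qed (intro lmeasurable_tube e)+

text \<open>The volume is additive and monotone in the length and therefore linear; approximating
  \<open>t\<close> by multiples of \<open>1 / n\<close> takes the place of a product decomposition
  of Lebesgue measure.\<close>

lemma measure_tube_0:
  assumes e: "norm e = 1" and t: "0 \<le> t"
  shows "measure lebesgue (tube e \<epsilon> 0 t) = t * measure lebesgue (tube e \<epsilon> 0 1)"
proof -
  let ?V = "\<lambda>t. measure lebesgue (tube e \<epsilon> 0 t)"
  have mult: "?V (real n * s) = real n * ?V s" if "s \<ge> 0" for n s
  proof (induction n)
    case 0 then show ?case by (simp add: measure_tube_eq_0[OF e])
  next
    case (Suc n)
    then show ?case using measure_tube_add[OF e, of "real n * s" s \<epsilon>] that by (simp add: algebra_simps)
  qed
  have mono: "?V s \<le> ?V t" if "0 \<le> s" "s \<le> t" for s t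
    using measure_tube_add[OF e, of s "t - s" \<epsilon>] that by (smt (verit) measure_nonneg)
  have bound: "\<bar>?V t - t * ?V 1\<bar> \<le> ?V 1 * inverse (real (Suc n))" for n
  proof -
    let ?n = "real (Suc n)"
    define k where "k = nat \<lfloor>?n * t\<rfloor>"
    have nt: "0 \<le> ?n * t" using t by simp
    have k: "real k \<le> ?n * t" "?n * t \<le> real k + 1" using nt unfolding k_def by linarith+
    have "real k * ?V 1 \<le> ?V (?n * t)" using mono[of "real k * 1" "?n * t"] mult[of 1 k] k by simp
    moreover have "?V (?n * t) \<le> (real k + 1) * ?V 1"
      using mono[of "?n * t" "real (Suc k) * 1"] mult[of 1 "Suc k"] k nt by (simp add: add.commute)
    moreover have "?V (?n * t) = ?n * ?V t" by (rule mult[OF t])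
    moreover have "real k * ?V 1 \<le> (?n * t) * ?V 1" "(?n * t) * ?V 1 \<le> (real k + 1) * ?V 1"
      using k by (intro mult_right_mono; simp)+
    ultimately have "\<bar>?n * ?V t - (?n * t) * ?V 1\<bar> \<le> ?V 1" unfolding distrib_right by linarith
    then have "?n * \<bar>?V t - t * ?V 1\<bar> \<le> ?V 1"
      by (simp add: right_diff_distrib[symmetric] abs_mult mult.assoc del: of_nat_Suc)
    then show ?thesis by (simp add: field_simps del: of_nat_Suc)
  qed
  have "(\<lambda>n. ?V 1 * inverse (real (Suc n))) \<longlonglongrightarrow> 0"
    using tendsto_mult_right_zero[OF LIMSEQ_inverse_real_of_nat] .
  then have "\<bar>?V t - t * ?V 1\<bar> \<le> 0" by (rule LIMSEQ_le_const) (use bound in blast)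
  then show ?thesis by simp
qed

lemma measure_tube:
  assumes e: "norm e = 1" and ab: "a \<le> b"
  shows "measure lebesgue (tube e \<epsilon> a b) = (b - a) * measure lebesgue (tube e \<epsilon> 0 1)"
proof -
  have "tube e \<epsilon> a b = (+) (a *\<^sub>R e) ` tube e \<epsilon> 0 (b - a)" by (simp add: tube_translate[OF e])
  then show ?thesis using measure_tube_0[OF e, of "b - a"] ab by (simp add: measure_translation)
qed

lemma measure_tube_pos:
  assumes e: "norm e = 1" and \<epsilon>: "\<epsilon> > 0"
  shows "measure lebesgue (tube e \<epsilon> 0 1) > 0"
proof -
  define r where "r = min (1/2) (\<epsilon> / 2)"
  have r: "r > 0" "r \<le> 1/2" "2 * r \<le> \<epsilon>" using \<epsilon> by (auto simp: r_def)
  have ee: "e \<bullet> e = 1" using e by (simp add: dot_square_norm)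
  have "ball ((1/2) *\<^sub>R e) r \<subseteq> tube e \<epsilon> 0 1"
  proof
    fix x assume "x \<in> ball ((1/2) *\<^sub>R e) r"
    then have x: "norm (x - (1/2) *\<^sub>R e) < r" by (simp add: dist_norm norm_minus_commute)
    have d: "e \<bullet> (x - (1/2) *\<^sub>R e) = e \<bullet> x - 1/2" by (simp add: inner_simps ee)
    have "\<bar>e \<bullet> (x - (1/2) *\<^sub>R e)\<bar> \<le> norm e * norm (x - (1/2) *\<^sub>R e)" by (rule Cauchy_Schwarz_ineq2)
    then have ex: "\<bar>e \<bullet> x - 1/2\<bar> < r" using x e d by simp
    have "x - (e \<bullet> x) *\<^sub>R e = (x - (1/2) *\<^sub>R e) - (e \<bullet> x - 1/2) *\<^sub>R e" by (simp add: algebra_simps)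
    also have "norm \<dots> \<le> norm (x - (1/2) *\<^sub>R e) + norm ((e \<bullet> x - 1/2) *\<^sub>R e)" by (rule norm_triangle_ineq4)
    also have "\<dots> \<le> \<epsilon>" using x ex r e by simp
    finally show "x \<in> tube e \<epsilon> 0 1" using ex r by (auto simp: tube_def)
  qed
  moreover have "\<not> negligible (ball ((1/2) *\<^sub>R e) r)" by (intro open_not_negligible) (use r(1) in auto)
  ultimately have "\<not> negligible (tube e \<epsilon> 0 1)" using negligible_subset by blast
  then have "measure lebesgue (tube e \<epsilon> 0 1) \<noteq> 0"
    using negligible_iff_measure0[OF lmeasurable_tube[OF e]] by blast
  then show ?thesis by (simp add: zero_less_measure_iff)
qed

lemma measure_tube_mono:
  assumes e: "norm e = 1" and "\<epsilon> \<le> \<epsilon>'"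
  shows "measure lebesgue (tube e \<epsilon> 0 1) \<le> measure lebesgue (tube e \<epsilon>' 0 1)"
  by (rule measure_mono_fmeasurable)
     (use assms lmeasurable_tube[OF e] in \<open>auto simp: tube_def fmeasurableD\<close>)

text \<open>The hyperplane \<open>d \<bullet> (x - s *\<^sub>R e) = 0\<close> may be oblique, but the point reflection in \<open>s *\<^sub>R e\<close> shows that it
  cuts the tube into parts of the same volumes as the orthogonal hyperplane through this point does.\<close>

lemma measure_tube_halfspace:
  assumes e: "norm e = 1" and \<mu>: "0 \<le> \<mu>" "a \<le> s - \<mu>" "s + \<mu> \<le> b" and d: "d \<noteq> 0"
    and pos: "\<And>x. x \<in> tube e \<epsilon> a b \<Longrightarrow> e \<bullet> x > s + \<mu> \<Longrightarrow> d \<bullet> (x - s *\<^sub>R e) > 0"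
    and neg: "\<And>x. x \<in> tube e \<epsilon> a b \<Longrightarrow> e \<bullet> x < s - \<mu> \<Longrightarrow> d \<bullet> (x - s *\<^sub>R e) < 0"
  shows "tube e \<epsilon> a b \<inter> {x. d \<bullet> (x - s *\<^sub>R e) > 0} \<in> lmeasurable"
    and "measure lebesgue (tube e \<epsilon> a b \<inter> {x. d \<bullet> (x - s *\<^sub>R e) > 0}) = (b - s) * measure lebesgue (tube e \<epsilon> 0 1)"
proof -
  let ?H = "{x. d \<bullet> (x - s *\<^sub>R e) > 0}" and ?H' = "{x. d \<bullet> (x - s *\<^sub>R e) < 0}"
  let ?M = "tube e \<epsilon> (s - \<mu>) (s + \<mu>)" and ?\<kappa> = "measure lebesgue (tube e \<epsilon> 0 1)"
  have ee: "e \<bullet> e = 1" using e by (simp add: dot_square_norm)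
  have "open ?H" "open ?H'" by (intro open_Collect_less continuous_intros)+
  then have meas: "tube e \<epsilon> a' b' \<inter> ?H \<in> lmeasurable" "tube e \<epsilon> a' b' \<inter> ?H' \<in> lmeasurable" for a' b'
    by (intro fmeasurable_Int_fmeasurable lmeasurable_tube[OF e]; simp)+
  show "tube e \<epsilon> a b \<inter> ?H \<in> lmeasurable" by (rule meas)
  have null: "negligible {x. d \<bullet> (x - s *\<^sub>R e) = 0}"
  proof -
    have "{x. d \<bullet> (x - s *\<^sub>R e) = 0} = {x. d \<bullet> x = s * (d \<bullet> e)}" by (auto simp: inner_simps)
    then show ?thesis using negligible_hyperplane d by metis
  qed
  \<comment> \<open>This reflection preserves the middle section \<open>?M\<close> and exchanges the
    two sides of the oblique hyperplane. Outside \<open>?M\<close> the hypotheses \<open>pos\<close>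
    and \<open>neg\<close> already determine the side.\<close>
  define R where "R x = (- 1) *\<^sub>R x + (2 * s) *\<^sub>R e" for x
  have RR: "R (R x) = x" for x by (simp add: R_def)
  have R_M: "R x \<in> ?M \<longleftrightarrow> x \<in> ?M" for x
  proof -
    have eR: "e \<bullet> R x = 2 * s - e \<bullet> x" by (simp add: R_def inner_simps ee)
    have "R x - (e \<bullet> R x) *\<^sub>R e = - (x - (e \<bullet> x) *\<^sub>R e)" unfolding eR by (simp add: R_def algebra_simps)
    then have "norm (R x - (e \<bullet> R x) *\<^sub>R e) = norm (x - (e \<bullet> x) *\<^sub>R e)" by (metis norm_minus_cancel)
    then show ?thesis unfolding tube_def using eR by auto
  qed
  have R_d: "d \<bullet> (R x - s *\<^sub>R e) = - (d \<bullet> (x - s *\<^sub>R e))" for x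
    by (simp add: R_def inner_simps algebra_simps)
  have "R ` (?M \<inter> ?H) = ?M \<inter> ?H'"
  proof (intro equalityI subsetI)
    fix y assume "y \<in> R ` (?M \<inter> ?H)"
    then obtain x where "y = R x" "x \<in> ?M" "d \<bullet> (x - s *\<^sub>R e) > 0" by blast
    then show "y \<in> ?M \<inter> ?H'" using R_M[of x] R_d[of x] by simp
  next
    fix y assume y: "y \<in> ?M \<inter> ?H'"
    then have "R y \<in> ?M \<inter> ?H" using R_M[of y] R_d[of y] by simp
    then show "y \<in> R ` (?M \<inter> ?H)" by (rule rev_image_eqI) (simp add: RR)
  qed
  moreover have "measure lebesgue (R ` (?M \<inter> ?H)) = measure lebesgue (?M \<inter> ?H)"
    using measure_lebesgue_affine[of "- 1" "(2 * s) *\<^sub>R e" "?M \<inter> ?H"] by (simp add: R_def[abs_def])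
  ultimately have half: "measure lebesgue (?M \<inter> ?H') = measure lebesgue (?M \<inter> ?H)" by simp
  have "measure lebesgue ?M = measure lebesgue (?M \<inter> ?H) + measure lebesgue (?M \<inter> ?H') + measure lebesgue (?M \<inter> {x. d \<bullet> (x - s *\<^sub>R e) = 0})"
  proof (rule measure_Un3_negligible)
    show "?M \<inter> {x. d \<bullet> (x - s *\<^sub>R e) = 0} \<in> lmeasurable"
      by (intro negligible_imp_measurable negligible_subset[OF null]) auto
    have E: "?M \<inter> ?H \<inter> (?M \<inter> ?H') = {}" "?M \<inter> ?H \<inter> (?M \<inter> {x. d \<bullet> (x - s *\<^sub>R e) = 0}) = {}"
      "?M \<inter> ?H' \<inter> (?M \<inter> {x. d \<bullet> (x - s *\<^sub>R e) = 0}) = {}" by auto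
    show "negligible (?M \<inter> ?H \<inter> (?M \<inter> ?H'))" "negligible (?M \<inter> ?H \<inter> (?M \<inter> {x. d \<bullet> (x - s *\<^sub>R e) = 0}))"
      "negligible (?M \<inter> ?H' \<inter> (?M \<inter> {x. d \<bullet> (x - s *\<^sub>R e) = 0}))" unfolding E by simp_all
    show "?M \<inter> ?H \<union> ?M \<inter> ?H' \<union> ?M \<inter> {x. d \<bullet> (x - s *\<^sub>R e) = 0} = ?M" by auto
  qed (rule meas)+
  moreover have "measure lebesgue (?M \<inter> {x. d \<bullet> (x - s *\<^sub>R e) = 0}) = 0"
    by (intro negligible_imp_measure0 negligible_subset[OF null]) auto
  ultimately have M: "measure lebesgue (?M \<inter> ?H) = \<mu> * ?\<kappa>"
    using half measure_tube[OF e, of "s - \<mu>" "s + \<mu>" \<epsilon>] \<mu>(1) by simp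
  have "measure lebesgue (tube e \<epsilon> a b \<inter> ?H) = measure lebesgue (?M \<inter> ?H \<union> tube e \<epsilon> (s + \<mu>) b)"
  proof (rule measure_negligible_symdiff)
    show "?M \<inter> ?H \<union> tube e \<epsilon> (s + \<mu>) b \<in> lmeasurable" by (intro fmeasurable.Un meas lmeasurable_tube e)
    show "negligible (?M \<inter> ?H \<union> tube e \<epsilon> (s + \<mu>) b - tube e \<epsilon> a b \<inter> ?H \<union> (tube e \<epsilon> a b \<inter> ?H - (?M \<inter> ?H \<union> tube e \<epsilon> (s + \<mu>) b)))"
    proof (rule negligible_subset[OF negligible_level[OF e, of "s + \<mu>"]], rule subsetI)
      fix x assume x: "x \<in> ?M \<inter> ?H \<union> tube e \<epsilon> (s + \<mu>) b - tube e \<epsilon> a b \<inter> ?H \<union> (tube e \<epsilon> a b \<inter> ?H - (?M \<inter> ?H \<union> tube e \<epsilon> (s + \<mu>) b))"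
      have "x \<in> tube e \<epsilon> a b" using x \<mu> by (auto simp: tube_def)
      then show "x \<in> {x. e \<bullet> x = s + \<mu>}"
        using x pos[of x] neg[of x] \<mu> by (fastforce simp: tube_def not_le not_less)
    qed
  qed
  also have "\<dots> = measure lebesgue (?M \<inter> ?H) + measure lebesgue (tube e \<epsilon> (s + \<mu>) b)"
  proof -
    have "measure lebesgue (?M \<inter> ?H \<inter> tube e \<epsilon> (s + \<mu>) b) = 0"
      by (intro negligible_imp_measure0 negligible_subset[OF negligible_level[OF e, of "s + \<mu>"]]) (auto simp: tube_def)
    then show ?thesis by (simp add: measure_Un3 meas lmeasurable_tube[OF e])
  qed
  also have "\<dots> = (b - s) * ?\<kappa>" unfolding M using measure_tube[OF e \<mu>(3), of \<epsilon>] by (simp add: algebra_simps)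
  finally show "measure lebesgue (tube e \<epsilon> a b \<inter> ?H) = (b - s) * ?\<kappa>" .
qed

subsection \<open>Discrete measures as gradient images\<close>

lemma restriction_in_Conv_cd:
  fixes T :: "(real^'n) set"
  assumes T: "convex T" "compact T" "T \<noteq> {}" and f: "convex_on UNIV f"
  defines "l \<equiv> \<lambda>x. if x \<in> T then ereal (f x) else \<infinity>"
  shows "l \<in> Conv_cd" "eff_dom l = T"
proof -
  show dom: "eff_dom l = T" by (auto simp: eff_dom_def l_def)
  have "l \<in> Conv"
    unfolding Conv_def
  proof (intro CollectI conjI allI ballI)
    show "l x \<noteq> -\<infinity>" for x by (simp add: l_def)
    show "\<exists>x. l x \<noteq> \<infinity>" using T(3) by (auto simp: l_def)
  next
    fix x y and t :: real assume t: "t \<in> {0..1}"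
    show "l ((1 - t) *\<^sub>R x + t *\<^sub>R y) \<le> ereal (1 - t) * l x + ereal t * l y"
    proof (cases "t = 0 \<or> t = 1")
      case True
      then show ?thesis by (auto simp: zero_ereal_def[symmetric] one_ereal_def[symmetric])
    next
      case False
      then have t': "0 < t" "t < 1" using t by auto
      show ?thesis
      proof (cases "x \<in> T \<and> y \<in> T")
        case True
        then have "(1 - t) *\<^sub>R x + t *\<^sub>R y \<in> T" using T(1) t by (auto simp: convex_alt)
        then show ?thesis using True f t by (simp add: l_def convex_on_UNIV_iff_segment)
      next
        case False
        then have "ereal (1 - t) * l x + ereal t * l y = \<infinity>" using t' by (auto simp: l_def)
        then show ?thesis by (metis ereal_less_eq(1))
      qed
    qed
  next
    fix x show "l x \<le> Liminf (at x) l"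
    proof (cases "x \<in> T")
      case True
      have "isCont f x" using convex_continuous[OF f, of UNIV] by (simp add: continuous_on_eq_continuous_at)
      then have "((\<lambda>x. ereal (f x)) \<longlongrightarrow> ereal (f x)) (at x)" by (simp add: isCont_def)
      then have "Liminf (at x) (\<lambda>x. ereal (f x)) = ereal (f x)" by (intro lim_imp_Liminf) auto
      moreover have "Liminf (at x) (\<lambda>x. ereal (f x)) \<le> Liminf (at x) l"
        by (intro Liminf_mono always_eventually) (auto simp: l_def)
      ultimately show ?thesis using True by (simp add: l_def)
    next
      case False
      have "\<forall>\<^sub>F y in at x. y \<in> - T"
        using False T(2) by (intro eventually_at_topological[THEN iffD2] exI[of _ "- T"]) (auto simp: compact_imp_closed open_Compl)
      then have "\<forall>\<^sub>F y in at x. \<infinity> \<le> l y" by (rule eventually_mono) (auto simp: l_def)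
      then have "Liminf (at x) (\<lambda>_. \<infinity>) \<le> Liminf (at x) l" by (rule Liminf_mono)
      then show ?thesis by (simp add: Liminf_const)
    qed
  qed
  moreover have "((\<lambda>x. l x / ereal (norm x)) \<longlongrightarrow> \<infinity>) at_infinity"
    unfolding tendsto_PInfty
  proof
    fix r
    obtain B where B: "\<And>x. x \<in> T \<Longrightarrow> norm x \<le> B" using compact_imp_bounded[OF T(2)] by (auto simp: bounded_iff)
    show "\<forall>\<^sub>F x in at_infinity. ereal r < l x / ereal (norm x)"
      unfolding eventually_at_infinity
    proof (intro exI[of _ "\<bar>B\<bar> + 1"] allI impI)
      fix x :: "real^'n" assume x: "\<bar>B\<bar> + 1 \<le> norm x"
      then have "x \<notin> T" using B by fastforce
      moreover have "x \<noteq> 0" using x by auto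
      ultimately show "ereal r < l x / ereal (norm x)" by (simp add: l_def)
    qed
  qed
  ultimately show "l \<in> Conv_cd" using T(2) dom by (simp add: Conv_cd_def Conv_sc_def)
qed

text \<open>Inserting \<open>1\<close> covers the empty set, which occurs for a single point mass,
  and yields \<open>c \<le> 1\<close>, used for the radius of the tube.\<close>

lemma finite_pos_lower_bound:
  fixes f :: "'b \<Rightarrow> real"
  assumes "finite A" "\<And>x. x \<in> A \<Longrightarrow> f x > 0"
  obtains c where "c > 0" "c \<le> 1" "\<And>x. x \<in> A \<Longrightarrow> c \<le> f x"
proof (rule that[of "Min (insert 1 (f ` A))"])
  show "Min (insert 1 (f ` A)) > 0" using assms by (subst Min_gr_iff) auto
qed (use assms in \<open>auto intro!: Min_le\<close>)

text \<open>The directions to avoid fill finitely many hyperplanes, a null set. The origin is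
  excluded separately because there may be no pair of distinct points.\<close>

lemma injective_direction:
  fixes I :: "'a::euclidean_space set"
  assumes I: "finite I"
  obtains e where "norm e = 1" "inj_on (\<lambda>y. e \<bullet> y) I"
proof -
  define P where "P = {(y, z). y \<in> I \<and> z \<in> I \<and> y \<noteq> z}"
  have P: "finite P" by (rule finite_subset[of _ "I \<times> I"]) (use I in \<open>auto simp: P_def\<close>)
  have "negligible ({0} \<union> (\<Union>p\<in>P. {e. (fst p - snd p) \<bullet> e = 0}))"
    using P by (intro negligible_Un negligible_Union negligible_sing) (auto simp: P_def intro!: negligible_hyperplane)
  then have "{0} \<union> (\<Union>p\<in>P. {e. (fst p - snd p) \<bullet> e = 0}) \<noteq> (UNIV::'a set)" by (metis non_negligible_UNIV)
  then obtain e where e: "e \<noteq> 0" "\<And>p. p \<in> P \<Longrightarrow> (fst p - snd p) \<bullet> e \<noteq> 0" by auto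
  show thesis
  proof (rule that[of "e /\<^sub>R norm e"])
    show "norm (e /\<^sub>R norm e) = 1" using e(1) by simp
    show "inj_on (\<lambda>y. (e /\<^sub>R norm e) \<bullet> y) I"
    proof (rule inj_onI, rule ccontr)
      fix y z assume "y \<in> I" "z \<in> I" "(e /\<^sub>R norm e) \<bullet> y = (e /\<^sub>R norm e) \<bullet> z" "y \<noteq> z"
      then show False using e(2)[of "(y, z)"] e(1) by (simp add: P_def inner_simps inner_commute)
    qed
  qed
qed

lemma enumerate_by:
  fixes g :: "'a \<Rightarrow> real"
  assumes I: "finite I" "I \<noteq> {}" and inj: "inj_on g I"
  obtains n y where "bij_betw y {..n::nat} I" "\<And>i. i < n \<Longrightarrow> g (y i) < g (y (Suc i))"
proof -
  define xs where "xs = sorted_list_of_set (g ` I)"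
  have xs: "sorted_wrt (<) xs" "set xs = g ` I" "distinct xs" using I by (auto simp: xs_def)
  have "xs \<noteq> []" using xs(2) I(2) by auto
  define n where "n = length xs - 1"
  have len: "{..<length xs} = {..n}" using \<open>xs \<noteq> []\<close> by (cases xs) (auto simp: n_def)
  have b1: "bij_betw ((!) xs) {..n} (g ` I)" using bij_betw_nth[OF xs(3) refl refl] xs(2) len by simp
  have b2: "bij_betw (the_inv_into I g) (g ` I) I" using bij_betw_the_inv_into[OF inj_on_imp_bij_betw[OF inj]] .
  show thesis
  proof (rule that[of "the_inv_into I g \<circ> (!) xs"])
    show "bij_betw (the_inv_into I g \<circ> (!) xs) {..n} I" by (rule bij_betw_trans[OF b1 b2])
    fix i assume i: "i < n"
    then have i': "Suc i < length xs" by (simp add: n_def)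
    then have "xs ! i \<in> g ` I" "xs ! Suc i \<in> g ` I" using xs(2) nth_mem by (metis Suc_lessD)+
    then have "g (the_inv_into I g (xs ! i)) = xs ! i" "g (the_inv_into I g (xs ! Suc i)) = xs ! Suc i"
      using f_the_inv_into_f[OF inj] by auto
    moreover have "xs ! i < xs ! Suc i" using xs(1) i' by (simp add: sorted_wrt_iff_nth_less)
    ultimately show "g ((the_inv_into I g \<circ> (!) xs) i) < g ((the_inv_into I g \<circ> (!) xs) (Suc i))" by simp
  qed
qed

text \<open>By \<open>nested\<close> the kinks active at \<open>x\<close> form an initial segment,
  so their slopes telescope to \<open>y j\<close>. All signs persist near \<open>x\<close>, where
  \<open>l\<close> is therefore affine.\<close>

lemma grad_sum_of_kinks:
  fixes y p :: "nat \<Rightarrow> real^'n" and T :: "(real^'n) set" and n :: nat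
  defines "\<Delta> \<equiv> \<lambda>i x. (y (Suc i) - y i) \<bullet> (x - p i)"
  defines "l \<equiv> \<lambda>x. if x \<in> T then ereal (y 0 \<bullet> x + (\<Sum>i<n. max 0 (\<Delta> i x))) else \<infinity>"
  assumes x: "x \<in> interior T" and ne: "\<And>i. i < n \<Longrightarrow> \<Delta> i x \<noteq> 0"
    and nested: "\<And>i i'. i < n \<Longrightarrow> i' < i \<Longrightarrow> \<Delta> i x > 0 \<Longrightarrow> \<Delta> i' x > 0"
  obtains j where "j \<le> n" "grad l x = y j" "\<And>i. i < n \<Longrightarrow> \<Delta> i x > 0 \<longleftrightarrow> i < j"
proof -
  \<comment> \<open>The alternative \<open>i = n\<close> covers the case that all kinks are
    active.\<close>
  define j where "j = (LEAST i. i = n \<or> \<Delta> i x \<le> 0)"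
  have j1: "j = n \<or> \<Delta> j x \<le> 0" unfolding j_def by (rule LeastI[of _ n]) simp
  have jn: "j \<le> n" unfolding j_def by (rule Least_le) simp
  have j2: "\<Delta> i x > 0" if "i < j" for i using not_less_Least[of i "\<lambda>i. i = n \<or> \<Delta> i x \<le> 0"] that by (auto simp: j_def)
  have sgn: "\<Delta> i x > 0 \<longleftrightarrow> i < j" if i: "i < n" for i
  proof
    assume pos: "\<Delta> i x > 0"
    show "i < j"
    proof (rule ccontr)
      assume "\<not> i < j"
      then have "j \<le> i" "j < n" using i by auto
      then have "\<Delta> j x > 0" using nested[OF i _ pos, of j] pos by (cases "j = i") auto
      then show False using j1 \<open>j < n\<close> by simp
    qed
  qed (rule j2)
  define S where "S = interior T \<inter> (\<Inter>i<n. {z. 0 < \<Delta> i z * \<Delta> i x})"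
  have "open S"
    unfolding S_def \<Delta>_def by (intro open_Int open_interior open_INT ballI open_Collect_less continuous_intros) auto
  have "x \<in> S" using x ne by (auto simp: S_def zero_less_mult_iff linorder_neq_iff)
  define c where "c = (\<Sum>i<j. (y (Suc i) - y i) \<bullet> p i)"
  have eq: "real_of_ereal (l z) = y j \<bullet> z - c" if z: "z \<in> S" for z
  proof -
    have "z \<in> T" using z interior_subset by (auto simp: S_def)
    have "max 0 (\<Delta> i z) = (if i < j then \<Delta> i z else 0)" if "i < n" for i
    proof -
      have "0 < \<Delta> i z * \<Delta> i x" using z that by (auto simp: S_def)
      then show ?thesis using sgn[OF that] by (auto simp: zero_less_mult_iff)
    qed
    then have "(\<Sum>i<n. max 0 (\<Delta> i z)) = (\<Sum>i<n. if i < j then \<Delta> i z else 0)" by (intro sum.cong) auto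
    also have "\<dots> = (\<Sum>i\<in>{i \<in> {..<n}. i < j}. \<Delta> i z)" by (rule sum.inter_filter[symmetric]) simp
    also have "{i \<in> {..<n}. i < j} = {..<j}" using jn by auto
    also have "(\<Sum>i<j. \<Delta> i z) = (\<Sum>i<j. y (Suc i) \<bullet> z - y i \<bullet> z) - c"
      unfolding c_def \<Delta>_def by (simp add: sum_subtractf[symmetric] inner_diff_left inner_diff_right)
    also have "(\<Sum>i<j. y (Suc i) \<bullet> z - y i \<bullet> z) = y j \<bullet> z - y 0 \<bullet> z"
      by (rule sum_lessThan_telescope)
    finally show ?thesis using \<open>z \<in> T\<close> by (simp add: l_def)
  qed
  have "((\<lambda>z. y j \<bullet> z - c) has_derivative (\<lambda>h. h \<bullet> y j)) (at x)"
    by (auto intro!: derivative_eq_intros simp: inner_commute)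
  then have "((\<lambda>z. real_of_ereal (l z)) has_derivative (\<lambda>h. h \<bullet> y j)) (at x)"
    by (rule has_derivative_transform_within_open[OF _ \<open>open S\<close> \<open>x \<in> S\<close>]) (simp add: eq)
  then have D: "GDERIV (\<lambda>z. real_of_ereal (l z)) x :> y j" by (simp add: gderiv_def)
  have "grad l x = y j"
    unfolding grad_def
  proof (rule the_equality, rule D)
    fix D' assume "GDERIV (\<lambda>z. real_of_ereal (l z)) x :> D'"
    then have "(\<lambda>h. h \<bullet> D') = (\<lambda>h. h \<bullet> y j)"
      using D has_derivative_unique unfolding gderiv_def by blast
    then have "h \<bullet> D' = h \<bullet> y j" for h by metis
    then have "(D' - y j) \<bullet> (D' - y j) = 0" by (simp only: inner_diff_right)
    then show "D' = y j" by simp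
  qed
  then show thesis using that jn sgn by blast
qed

text \<open>Abel summation. On the left each jump of \<open>h\<close> is weighted by the length of
  the tube beyond its kink, on the right each value by the length between successive kinks.\<close>

lemma sum_by_parts_lessThan:
  fixes h s :: "nat \<Rightarrow> real"
  shows "h 0 * (S - s 0) + (\<Sum>i<n. (h (Suc i) - h i) * (S - s (Suc i)))
    = (\<Sum>i<n. h i * (s (Suc i) - s i)) + h n * (S - s n)"
  by (induction n) (simp_all add: algebra_simps)

text \<open>On a long thin tube in a direction \<open>e\<close> along which the points are separated, the kinks of a sum of
  functions \<open>max 0 (\<Delta> i)\<close> run one after the other across the tube, and their positions can be chosen freely.\<close>

lemma discrete_measure_is_gradient_image:
  fixes I :: "(real^'n) set"
  assumes I: "finite I" "I \<noteq> {}" and m: "\<And>y. y \<in> I \<Longrightarrow> m y > 0"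
  shows "\<exists>l\<in>Conv_cd. \<forall>h::real^'n \<Rightarrow> real. set_integrable lebesgue (eff_dom l) (\<lambda>x. h (grad l x)) \<and>
      (LINT x:eff_dom l|lebesgue. h (grad l x)) = (\<Sum>y\<in>I. m y * h y)"
proof -
  obtain e where e: "norm e = 1" "inj_on (\<lambda>y. e \<bullet> y) I" using injective_direction[OF I(1)] by metis
  obtain n y where y: "bij_betw y {..n::nat} I" "\<And>i. i < n \<Longrightarrow> e \<bullet> y i < e \<bullet> y (Suc i)"
    using enumerate_by[OF I e(2)] by metis
  have yI: "y i \<in> I" if "i \<le> n" for i using y(1) that by (auto simp: bij_betw_def)
  define d where "d i = y (Suc i) - y i" for i
  have de: "d i \<bullet> e > 0" if "i < n" for i using y(2)[OF that] by (simp add: d_def inner_simps inner_commute)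
  have nd: "d i \<noteq> 0" if "i < n" for i using de[OF that] by auto
  define \<kappa> where "\<kappa> \<epsilon> = measure lebesgue (tube e \<epsilon> 0 1)" for \<epsilon>
  have \<kappa>0: "\<epsilon> > 0 \<Longrightarrow> \<kappa> \<epsilon> > 0" for \<epsilon> unfolding \<kappa>_def by (rule measure_tube_pos[OF e(1)])
  \<comment> \<open>The radius \<open>\<epsilon>\<close> will depend on \<open>c\<close>, so the
    lower bound for the lengths of the pieces uses the volume for radius 1; a thinner tube only
    makes the pieces longer.\<close>
  have "m (y i) / \<kappa> 1 > 0" if "i \<in> {..n}" for i using m yI that \<kappa>0[of 1] by simp
  then obtain c where c: "c > 0" "\<And>i. i \<in> {..n} \<Longrightarrow> c \<le> m (y i) / \<kappa> 1"
    using finite_pos_lower_bound[of "{..n}" "\<lambda>i. m (y i) / \<kappa> 1"] by (metis finite_atMost)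
  \<comment> \<open>Each kink stays within \<open>\<mu>\<close> of its nominal level, so gaps of
    \<open>3 * \<mu>\<close> keep the kinks apart and away from the ends.\<close>
  define \<mu> where "\<mu> = c / 3"
  have \<mu>: "\<mu> > 0" using c by (simp add: \<mu>_def)
  \<comment> \<open>For this radius the component orthogonal to the axis contributes less than
    \<open>(d i \<bullet> e) * \<mu>\<close> to \<open>\<Delta> i\<close>, too little to change its
    sign at distance \<open>\<mu>\<close> from the level.\<close>
  have "(d i \<bullet> e) * \<mu> / (2 * norm (d i)) > 0" if "i \<in> {..<n}" for i using de nd \<mu> that by simp
  then obtain \<epsilon> where \<epsilon>: "\<epsilon> > 0" "\<epsilon> \<le> 1" "\<And>i. i \<in> {..<n} \<Longrightarrow> \<epsilon> \<le> (d i \<bullet> e) * \<mu> / (2 * norm (d i))"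
    using finite_pos_lower_bound[of "{..<n}" "\<lambda>i. (d i \<bullet> e) * \<mu> / (2 * norm (d i))"] by (metis finite_lessThan)
  define k where "k = \<kappa> \<epsilon>"
  have k: "k > 0" "k \<le> \<kappa> 1" using \<kappa>0 \<epsilon> measure_tube_mono[OF e(1) \<epsilon>(2)] by (auto simp: k_def \<kappa>_def)
  \<comment> \<open>A unit of length has volume \<open>k\<close>, so these levels give the piece
    with gradient \<open>y i\<close> the volume \<open>m (y i)\<close>.\<close>
  define s where "s i = (\<Sum>j<i. m (y j) / k)" for i
  have gap: "s i + 3 * \<mu> \<le> s (Suc i)" if "i \<le> n" for i
  proof -
    have "c \<le> m (y i) / \<kappa> 1" using c(2) that by simp
    also have "\<dots> \<le> m (y i) / k" using k m[OF yI[OF that]] by (intro divide_left_mono) auto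
    finally show ?thesis by (simp add: s_def \<mu>_def)
  qed
  have mono: "s i + 3 * \<mu> \<le> s i'" if "i < i'" "i' \<le> Suc n" for i i'
    using that
  proof (induction i')
    case (Suc i')
    then show ?case using gap[of i'] gap[of i] \<mu> by (cases "i = i'") auto
  qed simp
  have s0: "s 0 = 0" by (simp add: s_def)
  define T where "T = tube e \<epsilon> 0 (s (Suc n))"
  have T: "convex T" "compact T" "T \<in> lmeasurable" "closed T"
    unfolding T_def by (intro convex_tube compact_tube lmeasurable_tube compact_imp_closed e)+
  have Sn: "s 0 + 3 * \<mu> \<le> s (Suc n)" by (rule mono) auto
  have mT: "measure lebesgue T = s (Suc n) * k"
    unfolding T_def k_def \<kappa>_def using Sn s0 \<mu> by (subst measure_tube[OF e(1)]) auto
  define p where "p i = s (Suc i) *\<^sub>R e" for i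
  define \<Delta> where "\<Delta> i x = d i \<bullet> (x - p i)" for i x
  have ee: "e \<bullet> e = 1" using e by (simp add: dot_square_norm)
  have \<Delta>: "\<bar>\<Delta> i x - (d i \<bullet> e) * (e \<bullet> x - s (Suc i))\<bar> < (d i \<bullet> e) * \<mu>" if i: "i < n" and x: "x \<in> T" for i x
  proof -
    have "\<Delta> i x - (d i \<bullet> e) * (e \<bullet> x - s (Suc i)) = d i \<bullet> (x - (e \<bullet> x) *\<^sub>R e)"
      by (simp add: \<Delta>_def p_def inner_simps algebra_simps)
    also have "\<bar>\<dots>\<bar> \<le> norm (d i) * norm (x - (e \<bullet> x) *\<^sub>R e)" by (rule Cauchy_Schwarz_ineq2)
    also have "\<dots> \<le> norm (d i) * \<epsilon>" using x by (intro mult_left_mono) (auto simp: T_def tube_def)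
    also have "\<dots> \<le> norm (d i) * ((d i \<bullet> e) * \<mu> / (2 * norm (d i)))" using \<epsilon>(3) i by (intro mult_left_mono) auto
    also have "\<dots> = (d i \<bullet> e) * \<mu> / 2" using nd[OF i] by simp
    also have "\<dots> < (d i \<bullet> e) * \<mu>" using de[OF i] \<mu> by simp
    finally show ?thesis .
  qed
  have pos: "\<Delta> i x > 0" if i: "i < n" and x: "x \<in> T" "e \<bullet> x \<ge> s (Suc i) + \<mu>" for i x
  proof -
    have "(d i \<bullet> e) * \<mu> \<le> (d i \<bullet> e) * (e \<bullet> x - s (Suc i))" using de[OF i] x by (intro mult_left_mono) auto
    then show ?thesis using \<Delta>[OF i x(1)] by linarith
  qed
  have neg: "\<Delta> i x < 0" if i: "i < n" and x: "x \<in> T" "e \<bullet> x \<le> s (Suc i) - \<mu>" for i x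
  proof -
    have "(d i \<bullet> e) * (e \<bullet> x - s (Suc i)) \<le> (d i \<bullet> e) * (- \<mu>)" using de[OF i] x by (intro mult_left_mono) auto
    then show ?thesis using \<Delta>[OF i x(1)] by simp
  qed
  have nested: "\<Delta> i' x > 0" if "i < n" "i' < i" "\<Delta> i x > 0" "x \<in> T" for i i' x
  proof -
    have "e \<bullet> x > s (Suc i) - \<mu>" using neg[of i x] that by (meson not_less less_asym)
    moreover have "s (Suc i') + 3 * \<mu> \<le> s (Suc i)" using mono[of "Suc i'" "Suc i"] that by simp
    ultimately show ?thesis using pos[of i' x] that \<mu> by simp
  qed
  define f where "f x = y 0 \<bullet> x + (\<Sum>i<n. max 0 (\<Delta> i x))" for x
  have cf: "convex_on UNIV f"
  proof -
    have \<Delta>_eq: "\<Delta> i = (\<lambda>x. d i \<bullet> x + (- (d i \<bullet> p i)))" for i by (auto simp: \<Delta>_def inner_simps)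
    have "convex_on UNIV (\<lambda>x. max 0 (\<Delta> i x))" for i
      unfolding \<Delta>_eq by (intro convex_on_max convex_on_affine) (simp add: convex_on_const)
    then have "convex_on UNIV (\<lambda>x. \<Sum>i<N. max 0 (\<Delta> i x))" for N
      by (induction N) (auto simp: convex_on_const intro!: convex_on_add)
    then have "convex_on UNIV (\<lambda>x. (y 0 \<bullet> x + 0) + (\<Sum>i<n. max 0 (\<Delta> i x)))"
      by (intro convex_on_add convex_on_affine)
    then show ?thesis by (simp add: f_def[abs_def])
  qed
  define l where "l x = (if x \<in> T then ereal (f x) else \<infinity>)" for x
  have "0 \<in> T" using Sn s0 \<mu> \<epsilon>(1) by (simp add: T_def tube_def)
  then have l: "l \<in> Conv_cd" "eff_dom l = T"
    using restriction_in_Conv_cd[OF T(1,2) _ cf] unfolding l_def[abs_def] by blast+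
  show ?thesis
  proof (intro bexI[OF _ l(1)] allI)
    fix h :: "real^'n \<Rightarrow> real"
    define H where "H i = T \<inter> {x. \<Delta> i x > 0}" for i
    \<comment> \<open>\<open>h (grad l x)\<close> written as an initial value plus one jump per
      kink: the sets \<open>H i\<close> beyond the kinks are those of known volume. As a simple
      function, \<open>\<phi>\<close> also makes the integrand measurable for arbitrary
      \<open>h\<close>.\<close>
    define \<phi> where "\<phi> x = indicator T x * h (y 0) + (\<Sum>i<n. indicator (H i) x * (h (y (Suc i)) - h (y i)))" for x
    have H: "H i \<in> lmeasurable \<and> measure lebesgue (H i) = (s (Suc n) - s (Suc i)) * k" if i: "i < n" for i
    proof -
      have "s 0 + 3 * \<mu> \<le> s (Suc i)" "s (Suc i) + 3 * \<mu> \<le> s (Suc n)" using i by (auto intro!: mono)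
      then have *: "0 \<le> \<mu>" "0 \<le> s (Suc i) - \<mu>" "s (Suc i) + \<mu> \<le> s (Suc n)" using \<mu> s0 by auto
      have "d i \<bullet> (x - s (Suc i) *\<^sub>R e) > 0" if "x \<in> tube e \<epsilon> 0 (s (Suc n))" "e \<bullet> x > s (Suc i) + \<mu>" for x
        using pos[OF i, of x] that by (simp add: \<Delta>_def p_def T_def)
      moreover have "d i \<bullet> (x - s (Suc i) *\<^sub>R e) < 0" if "x \<in> tube e \<epsilon> 0 (s (Suc n))" "e \<bullet> x < s (Suc i) - \<mu>" for x
        using neg[OF i, of x] that by (simp add: \<Delta>_def p_def T_def)
      ultimately show ?thesis
        using measure_tube_halfspace[OF e(1) * nd[OF i], of \<epsilon>] by (simp add: H_def T_def \<Delta>_def p_def k_def \<kappa>_def)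
    qed
    have int: "has_bochner_integral lebesgue (\<lambda>x. indicator A x * c) (measure lebesgue A * c)"
      if "A \<in> lmeasurable" for A and c :: real
      using has_bochner_integral_indicator[of A lebesgue c] that by (auto simp: fmeasurable_def)
    have "has_bochner_integral lebesgue \<phi> (measure lebesgue T * h (y 0) + (\<Sum>i<n. measure lebesgue (H i) * (h (y (Suc i)) - h (y i))))"
      unfolding \<phi>_def by (intro has_bochner_integral_add has_bochner_integral_sum int T) (use H in auto)
    also have "measure lebesgue T * h (y 0) + (\<Sum>i<n. measure lebesgue (H i) * (h (y (Suc i)) - h (y i)))
      = k * (h (y 0) * (s (Suc n) - s 0) + (\<Sum>i<n. (h (y (Suc i)) - h (y i)) * (s (Suc n) - s (Suc i))))"
      unfolding mT s0 distrib_left sum_distrib_left using H by (intro arg_cong2[of _ _ _ _ "(+)"] sum.cong) (auto simp: mult_ac)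
    \<comment> \<open>The tube ends at \<open>s (Suc n)\<close>, so the boundary term of the
      summation by parts is the summand for \<open>i = n\<close>.\<close>
    also have "\<dots> = k * (\<Sum>i<Suc n. h (y i) * (s (Suc i) - s i))"
      by (subst sum_by_parts_lessThan) simp
    also have "\<dots> = (\<Sum>i\<le>n. m (y i) * h (y i))"
      unfolding sum_distrib_left lessThan_Suc_atMost using k(1) by (intro sum.cong) (auto simp: s_def)
    also have "\<dots> = (\<Sum>z\<in>I. m z * h z)"
      by (rule sum.reindex_bij_betw[OF y(1)])
    finally have \<phi>: "has_bochner_integral lebesgue \<phi> (\<Sum>z\<in>I. m z * h z)" .
    define N where "N = frontier T \<union> (\<Union>i<n. {x. d i \<bullet> x = d i \<bullet> p i})"
    have N: "negligible N"
      unfolding N_def using nd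
      by (intro negligible_Un negligible_convex_frontier T negligible_Union) (auto intro!: negligible_hyperplane)
    have eq: "\<phi> x = indicator T x *\<^sub>R h (grad l x)" if x: "x \<notin> N" for x
    proof (cases "x \<in> T")
      case False
      then show ?thesis by (simp add: \<phi>_def H_def)
    next
      case True
      then have int: "x \<in> interior T" using x T(4) by (auto simp: N_def frontier_def)
      have ne: "\<Delta> i x \<noteq> 0" if "i < n" for i using x that by (auto simp: N_def \<Delta>_def inner_diff_right)
      have leq: "(\<lambda>x. if x \<in> T then ereal (y 0 \<bullet> x + (\<Sum>i<n. max 0 ((y (Suc i) - y i) \<bullet> (x - p i)))) else \<infinity>) = l"
        by (simp add: l_def f_def \<Delta>_def d_def fun_eq_iff)
      obtain j where j: "j \<le> n" "grad l x = y j" "\<And>i. i < n \<Longrightarrow> \<Delta> i x > 0 \<longleftrightarrow> i < j"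
        using grad_sum_of_kinks[where y = y and p = p and T = T and n = n and x = x, unfolded leq] int ne nested True
        unfolding \<Delta>_def d_def by metis
      have "(\<Sum>i<n. indicator (H i) x * (h (y (Suc i)) - h (y i))) = (\<Sum>i<n. if i < j then h (y (Suc i)) - h (y i) else 0)"
        using j(3) True by (intro sum.cong) (auto simp: H_def)
      also have "\<dots> = (\<Sum>i\<in>{i \<in> {..<n}. i < j}. h (y (Suc i)) - h (y i))" by (rule sum.inter_filter[symmetric]) simp
      also have "{i \<in> {..<n}. i < j} = {..<j}" using j(1) by auto
      also have "(\<Sum>i<j. h (y (Suc i)) - h (y i)) = h (y j) - h (y 0)" by (rule sum_lessThan_telescope)
      finally show ?thesis using True j(2) by (simp add: \<phi>_def)
    qed
    have AE: "AE x in lebesgue. \<phi> x = indicator T x *\<^sub>R h (grad l x)"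
      by (rule AE_I'[of N]) (use N eq in \<open>auto simp: negligible_iff_null_sets\<close>)
    have "\<phi> \<in> borel_measurable lebesgue" using \<phi> by (rule borel_measurable_has_bochner_integral)
    then have "(\<lambda>x. indicator T x *\<^sub>R h (grad l x)) \<in> borel_measurable lebesgue"
      using AE by (rule borel_measurable_AE)
    then have "has_bochner_integral lebesgue (\<lambda>x. indicator T x *\<^sub>R h (grad l x)) (\<Sum>z\<in>I. m z * h z)"
      using \<phi> AE \<open>\<phi> \<in> borel_measurable lebesgue\<close> has_bochner_integral_cong_AE by blast
    then show "set_integrable lebesgue (eff_dom l) (\<lambda>x. h (grad l x)) \<and>
        (LINT x:eff_dom l|lebesgue. h (grad l x)) = (\<Sum>y\<in>I. m y * h y)"
      unfolding l(2) set_integrable_def set_lebesgue_integral_def has_bochner_integral_iff by simp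
  qed
qed

subsection \<open>Approximation of the valuation\<close>

text \<open>The transform turns pointwise limits, affine summands, positive multiples and maxima
  into epi-limits, epi-translations, epi-multiples and minima, so each property of \<open>Z\<close>
  yields one assumption of the locale.\<close>

lemma dual_valuation_fenchel:
  fixes Z :: "(real^'n \<Rightarrow> ereal) \<Rightarrow> real"
  assumes cont: "epi_continuous Z" and inv: "epi_translation_invariant Z"
    and val: "is_valuation Z" and hom: "epi_homogeneous 1 Z"
  shows "dual_valuation (\<lambda>f. Z (fenchel (\<lambda>x. ereal (f x))))"
proof
  fix F :: "nat \<Rightarrow> real^'n \<Rightarrow> real" and f
  assume "\<And>j. convex_on UNIV (F j)" "convex_on UNIV f" "\<And>x. (\<lambda>j. F j x) \<longlonglongrightarrow> f x"
  then show "(\<lambda>j. Z (fenchel (\<lambda>x. ereal (F j x)))) \<longlonglongrightarrow> Z (fenchel (\<lambda>x. ereal (f x)))"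
    by (intro epi_continuousD[OF cont] fenchel_in_Conv_sc epi_converges_fenchel)
next
  fix f :: "real^'n \<Rightarrow> real" and a b assume f: "convex_on UNIV f"
  show "Z (fenchel (\<lambda>x. ereal (f x + (a \<bullet> x + b)))) = Z (fenchel (\<lambda>x. ereal (f x)))"
    unfolding fenchel_add_affine using inv fenchel_in_Conv_sc[OF f] by (auto simp: epi_translation_invariant_def)
next
  fix f :: "real^'n \<Rightarrow> real" and t :: real assume f: "convex_on UNIV f" and t: "t > 0"
  show "Z (fenchel (\<lambda>x. ereal (t * f x))) = t * Z (fenchel (\<lambda>x. ereal (f x)))"
    unfolding fenchel_scale[OF t] using hom fenchel_in_Conv_sc[OF f] t by (auto simp: epi_homogeneous_def)
next
  fix f g :: "real^'n \<Rightarrow> real"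
  assume f: "convex_on UNIV f" and g: "convex_on UNIV g" and fg: "convex_on UNIV (\<lambda>x. min (f x) (g x))"
  let ?u = "fenchel (\<lambda>x. ereal (f x))" and ?v = "fenchel (\<lambda>x. ereal (g x))"
  have mx: "fenchel (\<lambda>x. ereal (max (f x) (g x))) = (\<lambda>y. min (?u y) (?v y))"
  proof
    fix y
    have "(\<lambda>x. min (ereal (f x)) (ereal (g x))) \<in> Conv" using Conv_ereal[OF fg] by (simp add: ereal_min)
    from fenchel_max[OF Conv_ereal[OF f] Conv_ereal[OF g] this]
    show "fenchel (\<lambda>x. ereal (max (f x) (g x))) y = min (?u y) (?v y)" by (simp add: ereal_max)
  qed
  have mn: "fenchel (\<lambda>x. ereal (min (f x) (g x))) = (\<lambda>y. max (?u y) (?v y))"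
    unfolding ereal_min by (rule ext) (rule fenchel_min)
  have "(\<lambda>y. min (?u y) (?v y)) \<in> Conv_sc" unfolding mx[symmetric] by (intro fenchel_in_Conv_sc convex_on_max f g)
  moreover have "(\<lambda>y. max (?u y) (?v y)) \<in> Conv_sc" unfolding mn[symmetric] by (intro fenchel_in_Conv_sc fg)
  ultimately show "Z (fenchel (\<lambda>x. ereal (max (f x) (g x)))) + Z (fenchel (\<lambda>x. ereal (min (f x) (g x)))) = Z ?u + Z ?v"
    unfolding mx mn using val fenchel_in_Conv_sc[OF f] fenchel_in_Conv_sc[OF g] unfolding is_valuation_def by blast
qed

text \<open>The discrete functionals are corrected so that they vanish on affine functions, as \<open>Y\<close> does.\<close>

lemma (in dual_valuation) discrete_approximation_balanced:
  obtains \<rho> where "\<And>\<eta>. \<eta> > 0 \<Longrightarrow> \<exists>I d. finite I \<and> I \<noteq> {} \<and> (\<Sum>y\<in>I. d y) = 0 \<and> (\<Sum>y\<in>I. d y *\<^sub>R y) = 0 \<and>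
    (\<forall>f c. convex_on UNIV f \<longrightarrow> (\<forall>y\<in>cball 0 \<rho>. \<bar>f y\<bar> \<le> c) \<longrightarrow> \<bar>Y f - (\<Sum>y\<in>I. d y * f y)\<bar> \<le> \<eta> * c)"
proof -
  obtain \<rho> where \<rho>: "\<rho> \<ge> 1" and approx: "\<And>\<eta>. \<eta> > 0 \<Longrightarrow> \<exists>I d. finite I \<and> I \<subseteq> cball 0 \<rho> \<and>
    (\<forall>f c. convex_on UNIV f \<longrightarrow> (\<forall>y\<in>cball 0 \<rho>. \<bar>f y\<bar> \<le> c) \<longrightarrow> \<bar>Y f - (\<Sum>y\<in>I. d y * f y)\<bar> \<le> \<eta> * c)"
    by (rule discrete_approximation) (rule that)
  show thesis
  proof (rule that[of \<rho>])
    fix \<eta> :: real assume \<eta>: "\<eta> > 0"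
    \<comment> \<open>Error budget: one unit for the approximation, one for the total mass
      \<open>A\<close>, and \<open>2 * \<rho>\<close> for each first moment, because
      \<open>f i - f 0\<close> may reach \<open>2 * c\<close>.\<close>
    define K where "K = 2 + 2 * \<rho> * DIM('a)"
    have K: "K > 0" using \<rho> by (simp add: K_def add_pos_nonneg)
    define \<theta> where "\<theta> = \<eta> / K"
    have \<theta>: "\<theta> > 0" "\<theta> * K = \<eta>" using \<eta> K by (auto simp: \<theta>_def)
    obtain I d where I: "finite I"
      and err: "\<And>f c. convex_on UNIV f \<Longrightarrow> (\<forall>y\<in>cball 0 \<rho>. \<bar>f y\<bar> \<le> c) \<Longrightarrow> \<bar>Y f - (\<Sum>y\<in>I. d y * f y)\<bar> \<le> \<theta> * c"
      using approx[OF \<theta>(1)] by blast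
    define A where "A = (\<Sum>y\<in>I. d y)"
    define B where "B i = (\<Sum>y\<in>I. d y * (i \<bullet> y))" for i
    have A: "\<bar>A\<bar> \<le> \<theta>"
      using err[of "\<lambda>x. 1" 1] affine_zero[of 0 1] by (simp add: convex_on_const A_def)
    have B: "\<bar>B i\<bar> \<le> \<theta> * \<rho>" if i: "i \<in> Basis" for i
    proof -
      have "\<bar>i \<bullet> y\<bar> \<le> \<rho>" if "y \<in> cball 0 \<rho>" for y
        using Basis_le_norm[OF i, of y] that by (simp add: inner_commute)
      then show ?thesis
        using err[of "\<lambda>x. i \<bullet> x" \<rho>] affine_zero[of i 0] convex_on_affine[of i 0] by (simp add: B_def)
    qed
    define J where "J = I \<union> {0} \<union> Basis"
    have J: "finite J" using I by (simp add: J_def)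
    \<comment> \<open>Removing the mass \<open>B i\<close> at each basis vector cancels the first
      moments but shifts the total; the mass \<open>a\<close> removed at \<open>0\<close> cancels
      the total without affecting the moments. As \<open>\<rho> \<ge> 1\<close>, the bound on
      \<open>f\<close> holds at all the new points.\<close>
    define a where "a = A - (\<Sum>i\<in>Basis. B i)"
    define b where "b y = (if y \<in> I then d y else 0) - (if y \<in> {0} then a else 0)
      - (if y \<in> Basis then B y else 0)" for y
    have sum: "(\<Sum>y\<in>J. b y * f y) = (\<Sum>y\<in>I. d y * f y) - a * f 0 - (\<Sum>i\<in>Basis. B i * f i)" for f
    proof -
      have "b y * f y = (if y \<in> I then d y * f y else 0) - (if y \<in> {0} then a * f y else 0)
        - (if y \<in> Basis then B y * f y else 0)" for y
        unfolding b_def left_diff_distrib by (simp only: if_distrib[of "\<lambda>x. x * f y"] mult_zero_left)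
      then have "(\<Sum>y\<in>J. b y * f y) = (\<Sum>y\<in>J \<inter> I. d y * f y) - (\<Sum>y\<in>J \<inter> {0}. a * f y)
          - (\<Sum>y\<in>J \<inter> Basis. B y * f y)"
        unfolding sum.inter_restrict[OF J] by (simp only: sum_subtractf)
      moreover have "J \<inter> I = I" "J \<inter> {0} = {0}" "J \<inter> Basis = Basis" by (auto simp: J_def)
      ultimately show ?thesis by simp
    qed
    have "(\<Sum>y\<in>J. b y) = 0" using sum[of "\<lambda>x. 1"] by (simp add: A_def a_def)
    moreover have "(\<Sum>y\<in>J. b y *\<^sub>R y) = 0"
    proof (rule euclidean_eqI)
      fix i :: 'a assume i: "i \<in> Basis"
      have "(\<Sum>k\<in>Basis. B k * (i \<bullet> k)) = (\<Sum>k\<in>Basis. if k = i then B k else 0)"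
        using i by (intro sum.cong) (auto simp: inner_Basis)
      then have "(\<Sum>y\<in>J. b y * (i \<bullet> y)) = 0" using sum[of "\<lambda>y. i \<bullet> y"] i by (simp add: B_def)
      then show "(\<Sum>y\<in>J. b y *\<^sub>R y) \<bullet> i = 0 \<bullet> i"
        by (simp add: inner_commute[of _ i] inner_sum_right)
    qed
    moreover have "\<bar>Y f - (\<Sum>y\<in>J. b y * f y)\<bar> \<le> \<eta> * c"
      if f: "convex_on UNIV f" and c: "\<forall>y\<in>cball 0 \<rho>. \<bar>f y\<bar> \<le> c" for f c
    proof -
      have c0: "\<bar>f 0\<bar> \<le> c" using c \<rho> by simp
      have ci: "\<bar>f i\<bar> \<le> c" if "i \<in> Basis" for i using c \<rho> that by simp
      have "Y f - (\<Sum>y\<in>J. b y * f y) = (Y f - (\<Sum>y\<in>I. d y * f y)) + A * f 0 + (\<Sum>i\<in>Basis. B i * (f i - f 0))"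
        unfolding sum a_def by (simp add: algebra_simps sum_subtractf sum_distrib_right sum_distrib_left)
      moreover have "\<bar>Y f - (\<Sum>y\<in>I. d y * f y)\<bar> \<le> \<theta> * c" by (rule err[OF f c])
      moreover have "\<bar>A * f 0\<bar> \<le> \<theta> * c" unfolding abs_mult using A c0 \<theta>(1) by (intro mult_mono) auto
      moreover have "\<bar>\<Sum>i\<in>Basis. B i * (f i - f 0)\<bar> \<le> (\<Sum>i\<in>(Basis::'a set). \<theta> * \<rho> * (2 * c))"
      proof (rule order_trans[OF sum_abs], rule sum_mono)
        fix i :: 'a assume i: "i \<in> Basis"
        have "\<bar>f i - f 0\<bar> \<le> 2 * c" using c0 ci[OF i] by linarith
        then show "\<bar>B i * (f i - f 0)\<bar> \<le> \<theta> * \<rho> * (2 * c)"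
          unfolding abs_mult using B[OF i] \<theta>(1) \<rho> by (intro mult_mono) auto
      qed
      moreover have "\<eta> * c = \<theta> * c + \<theta> * c + (\<Sum>i\<in>(Basis::'a set). \<theta> * \<rho> * (2 * c))"
        unfolding \<theta>(2)[symmetric] K_def by (simp add: algebra_simps)
      ultimately show ?thesis by linarith
    qed
    moreover have "J \<noteq> {}" by (simp add: J_def)
    ultimately show "\<exists>I d. finite I \<and> I \<noteq> {} \<and> (\<Sum>y\<in>I. d y) = 0 \<and> (\<Sum>y\<in>I. d y *\<^sub>R y) = 0 \<and>
      (\<forall>f c. convex_on UNIV f \<longrightarrow> (\<forall>y\<in>cball 0 \<rho>. \<bar>f y\<bar> \<le> c) \<longrightarrow> \<bar>Y f - (\<Sum>y\<in>I. d y * f y)\<bar> \<le> \<eta> * c)"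
      using J by blast
  qed
qed

text \<open>Compactness enters through the continuous evaluations, whose images of \<open>K\<close>
  are bounded; convexity makes these pointwise bounds uniform on a ball.\<close>

lemma compactin_real_fenchel_bounded:
  fixes K :: "(real^'n \<Rightarrow> ereal) set"
  assumes K: "compactin (epi_topology Conv_sc) K"
  obtains c where "\<And>u y. u \<in> K \<Longrightarrow> y \<in> cball 0 r \<Longrightarrow> \<bar>real_fenchel u y\<bar> \<le> c"
proof -
  have sub: "K \<subseteq> Conv_sc" using compactin_subset_topspace[OF K] by simp
  have "\<exists>c. \<forall>f\<in>real_fenchel ` K. \<bar>f y\<bar> \<le> c" for y
  proof -
    have "compactin euclideanreal ((\<lambda>u. real_fenchel u y) ` K)"
      using image_compactin[OF K] epi_continuous_real_fenchel[of y] unfolding epi_continuous_def by blast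
    then have "bounded ((\<lambda>u. real_fenchel u y) ` K)" by (simp add: compact_imp_bounded)
    then show ?thesis by (auto simp: bounded_iff)
  qed
  then obtain c where "\<And>f y. f \<in> real_fenchel ` K \<Longrightarrow> y \<in> cball 0 r \<Longrightarrow> \<bar>f y\<bar> \<le> c"
    using convex_family_bounded_on_cball[of "real_fenchel ` K" r] sub convex_on_real_fenchel by blast
  then show thesis using that by blast
qed

section \<open>The approximating valuations and their gradient representation\<close>

definition discrete_functional :: "(real^'n) set \<Rightarrow> (real^'n \<Rightarrow> real) \<Rightarrow> (real^'n \<Rightarrow> ereal) \<Rightarrow> real" where
  "discrete_functional I d u = (\<Sum>y\<in>I. d y * real_fenchel u y)"

lemma epi_continuous_discrete_functional:
  fixes I :: "(real^'n) set"
  shows "epi_continuous (discrete_functional I d)"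
  unfolding discrete_functional_def
  by (intro epi_continuousI tendsto_intros real_fenchel_tendsto)

lemma is_valuation_discrete_functional:
  fixes I :: "(real^'n) set"
  shows "is_valuation (discrete_functional I d)"
  unfolding is_valuation_def
proof (intro allI impI, elim conjE)
  fix u v :: "real^'n \<Rightarrow> ereal"
  assume uv: "u \<in> Conv_sc" "v \<in> Conv_sc" "(\<lambda>x. min (u x) (v x)) \<in> Conv_sc"
  then have C: "u \<in> Conv" "v \<in> Conv" "(\<lambda>x. min (u x) (v x)) \<in> Conv" by (auto simp: Conv_sc_def)
  have "real_fenchel (\<lambda>x. min (u x) (v x)) y = max (real_fenchel u y) (real_fenchel v y)"
    "real_fenchel (\<lambda>x. max (u x) (v x)) y = min (real_fenchel u y) (real_fenchel v y)" for y
    unfolding real_fenchel_def[of "\<lambda>x. min (u x) (v x)"] real_fenchel_def[of "\<lambda>x. max (u x) (v x)"]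
      fenchel_min fenchel_max[OF C] fenchel_eq_ereal[OF uv(1)] fenchel_eq_ereal[OF uv(2)]
    by (simp_all add: max_def min_def)
  moreover have "d y * max a b + d y * min a b = d y * a + d y * b" for y a b
    by (simp add: max_def min_def)
  ultimately show "discrete_functional I d (\<lambda>x. min (u x) (v x)) + discrete_functional I d (\<lambda>x. max (u x) (v x))
      = discrete_functional I d u + discrete_functional I d v"
    unfolding discrete_functional_def sum.distrib[symmetric] by (simp only:)
qed

text \<open>An epi-translation changes the transform by an affine function, which the two balance
  conditions annihilate.\<close>

lemma epi_translation_invariant_discrete_functional:
  fixes I :: "(real^'n) set"
  assumes "(\<Sum>y\<in>I. d y) = 0" "(\<Sum>y\<in>I. d y *\<^sub>R y) = 0"
  shows "epi_translation_invariant (discrete_functional I d)"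
  unfolding epi_translation_invariant_def
proof (intro ballI allI)
  fix u :: "real^'n \<Rightarrow> ereal" and x c assume u: "u \<in> Conv_sc"
  have *: "real_fenchel (\<lambda>y. u (y - x) + ereal c) z = real_fenchel u z + (x \<bullet> z - c)" for z
    unfolding real_fenchel_def[of "\<lambda>y. u (y - x) + ereal c"] fenchel_translate fenchel_eq_ereal[OF u] by simp
  have "discrete_functional I d (\<lambda>y. u (y - x) + ereal c)
      = (\<Sum>z\<in>I. d z * real_fenchel u z + (d z * (x \<bullet> z) - d z * c))"
    unfolding discrete_functional_def * distrib_left right_diff_distrib by (rule refl)
  also have "\<dots> = discrete_functional I d u + (x \<bullet> (\<Sum>z\<in>I. d z *\<^sub>R z) - (\<Sum>z\<in>I. d z) * c)"
    by (simp add: discrete_functional_def sum.distrib sum_subtractf inner_sum_right sum_distrib_right)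
  finally show "discrete_functional I d (\<lambda>y. u (y - x) + ereal c) = discrete_functional I d u"
    using assms by simp
qed

lemma discrete_functional_gradient_representation:
  fixes d :: "real^'n \<Rightarrow> real"
  assumes I: "finite I" "I \<noteq> {}"
  obtains l w where "l \<in> Conv_cd" "w \<in> Conv_cd"
    "\<And>u. set_integrable lebesgue (eff_dom l) (grad_integrand u l) \<and>
        set_integrable lebesgue (eff_dom w) (grad_integrand u w) \<and>
        discrete_functional I d u = (LINT x:eff_dom l|lebesgue. grad_integrand u l x)
               - (LINT x:eff_dom w|lebesgue. grad_integrand u w x)"
proof -
  have gi: "grad_integrand u l = (\<lambda>x. real_fenchel u (grad l x))" for u l :: "real^'n \<Rightarrow> ereal"
    by (auto simp: grad_integrand_def real_fenchel_def)
  \<comment> \<open>Two masses with difference \<open>d y\<close>, both strictly positive at every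
    point of \<open>I\<close>, as \<open>discrete_measure_is_gradient_image\<close> demands;
    positive and negative parts could vanish.\<close>
  have pos: "1 + \<bar>d y\<bar> + d y > 0" "1 + \<bar>d y\<bar> > 0" for y by linarith+
  obtain l where l: "l \<in> Conv_cd" "\<forall>h::real^'n \<Rightarrow> real. set_integrable lebesgue (eff_dom l) (\<lambda>x. h (grad l x)) \<and>
      (LINT x:eff_dom l|lebesgue. h (grad l x)) = (\<Sum>y\<in>I. (1 + \<bar>d y\<bar> + d y) * h y)"
    using discrete_measure_is_gradient_image[OF I, of "\<lambda>y. 1 + \<bar>d y\<bar> + d y", OF pos(1)] by blast
  obtain w where w: "w \<in> Conv_cd" "\<forall>h::real^'n \<Rightarrow> real. set_integrable lebesgue (eff_dom w) (\<lambda>x. h (grad w x)) \<and>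
      (LINT x:eff_dom w|lebesgue. h (grad w x)) = (\<Sum>y\<in>I. (1 + \<bar>d y\<bar>) * h y)"
    using discrete_measure_is_gradient_image[OF I, of "\<lambda>y. 1 + \<bar>d y\<bar>", OF pos(2)] by blast
  show thesis
  proof (rule that[OF l(1) w(1)])
    fix u
    have "discrete_functional I d u = (\<Sum>y\<in>I. (1 + \<bar>d y\<bar> + d y) * real_fenchel u y) - (\<Sum>y\<in>I. (1 + \<bar>d y\<bar>) * real_fenchel u y)"
      by (simp add: discrete_functional_def sum_subtractf[symmetric] algebra_simps)
    then show "set_integrable lebesgue (eff_dom l) (grad_integrand u l) \<and>
        set_integrable lebesgue (eff_dom w) (grad_integrand u w) \<and>
        discrete_functional I d u = (LINT x:eff_dom l|lebesgue. grad_integrand u l x)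
               - (LINT x:eff_dom w|lebesgue. grad_integrand u w x)"
      using l(2)[rule_format, of "real_fenchel u"] w(2)[rule_format, of "real_fenchel u"] by (simp add: gi)
  qed
qed

theorem theorem1p6:
  fixes Z :: "(real^'n \<Rightarrow> ereal) \<Rightarrow> real"
  assumes "epi_continuous Z"
    and "epi_translation_invariant Z"
    and "is_valuation Z"
    and "epi_homogeneous 1 Z"
  shows "\<exists>Zs :: nat \<Rightarrow> (real^'n \<Rightarrow> ereal) \<Rightarrow> real.
    (\<forall>K. compactin (epi_topology Conv_sc) K \<longrightarrow> uniform_limit K Zs Z sequentially) \<and>
    (\<forall>j. epi_continuous (Zs j) \<and> epi_translation_invariant (Zs j) \<and> is_valuation (Zs j)) \<and>
    (\<forall>j. \<exists>l w. l \<in> Conv_cd \<and> w \<in> Conv_cd \<and>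
      (\<forall>u\<in>Conv_cd.
        set_integrable lebesgue (eff_dom l) (grad_integrand u l) \<and>
        set_integrable lebesgue (eff_dom w) (grad_integrand u w) \<and>
        Zs j u = (LINT x:eff_dom l|lebesgue. grad_integrand u l x)
               - (LINT x:eff_dom w|lebesgue. grad_integrand u w x)))"
proof -
  interpret dual_valuation "\<lambda>f. Z (fenchel (\<lambda>x. ereal (f x)))"
    by (rule dual_valuation_fenchel[OF assms])
  obtain \<rho> where \<rho>: "\<And>\<eta>. \<eta> > 0 \<Longrightarrow> \<exists>I d. finite I \<and> I \<noteq> {} \<and> (\<Sum>y\<in>I. d y) = 0 \<and> (\<Sum>y\<in>I. d y *\<^sub>R y) = 0 \<and>
    (\<forall>f c. convex_on UNIV f \<longrightarrow> (\<forall>y\<in>cball 0 \<rho>. \<bar>f y\<bar> \<le> c) \<longrightarrow>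
      \<bar>Z (fenchel (\<lambda>x. ereal (f x))) - (\<Sum>y\<in>I. d y * f y)\<bar> \<le> \<eta> * c)"
    by (rule discrete_approximation_balanced) (rule that)
  define good where "good \<eta> I d \<longleftrightarrow> finite I \<and> I \<noteq> {} \<and> (\<Sum>y\<in>I. d y) = 0 \<and> (\<Sum>y\<in>I. d y *\<^sub>R y) = 0 \<and>
    (\<forall>f c. convex_on UNIV f \<longrightarrow> (\<forall>y\<in>cball 0 \<rho>. \<bar>f y\<bar> \<le> c) \<longrightarrow>
      \<bar>Z (fenchel (\<lambda>x. ereal (f x))) - (\<Sum>y\<in>I. d y * f y)\<bar> \<le> \<eta> * c)" for \<eta> I d
  have "\<exists>I d. good (inverse (real (Suc j))) I d" for j
    unfolding good_def by (rule \<rho>) simp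
  then obtain I d where "\<And>j. good (inverse (real (Suc j))) (I j) (d j)" by metis
  then have Id: "\<And>j. finite (I j)" "\<And>j. I j \<noteq> {}" "\<And>j. (\<Sum>y\<in>I j. d j y) = 0"
    "\<And>j. (\<Sum>y\<in>I j. d j y *\<^sub>R y) = 0"
    "\<And>j f c. convex_on UNIV f \<Longrightarrow> (\<forall>y\<in>cball 0 \<rho>. \<bar>f y\<bar> \<le> c) \<Longrightarrow>
      \<bar>Z (fenchel (\<lambda>x. ereal (f x))) - (\<Sum>y\<in>I j. d j y * f y)\<bar> \<le> inverse (real (Suc j)) * c"
    unfolding good_def by blast+
  define Zs where "Zs j = discrete_functional (I j) (d j)" for j
  have unif: "uniform_limit K Zs Z sequentially" if K: "compactin (epi_topology Conv_sc) K" for K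
  proof (rule uniform_limitI)
    fix e :: real assume "e > 0"
    obtain c where c: "\<And>u y. u \<in> K \<Longrightarrow> y \<in> cball 0 \<rho> \<Longrightarrow> \<bar>real_fenchel u y\<bar> \<le> c"
      using compactin_real_fenchel_bounded[OF K] by metis
    have "(\<lambda>j. inverse (real (Suc j)) * c) \<longlonglongrightarrow> 0" by (rule tendsto_mult_left_zero[OF LIMSEQ_inverse_real_of_nat])
    then have "\<forall>\<^sub>F j in sequentially. inverse (real (Suc j)) * c < e" using \<open>e > 0\<close> by (rule order_tendstoD(2))
    then show "\<forall>\<^sub>F j in sequentially. \<forall>u\<in>K. dist (Zs j u) (Z u) < e"
    proof (rule eventually_mono, intro ballI)
      fix j u assume j: "inverse (real (Suc j)) * c < e" and u: "u \<in> K"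
      have uC: "u \<in> Conv_sc" using compactin_subset_topspace[OF K] u by auto
      \<comment> \<open>Biconjugation turns the functional at \<open>real_fenchel u\<close> back
        into \<open>Z u\<close>, and the bound involves \<open>u\<close> only through
        \<open>c\<close>, which is common to all of \<open>K\<close>.\<close>
      have "\<bar>Z u - Zs j u\<bar> \<le> inverse (real (Suc j)) * c"
        using Id(5)[OF convex_on_real_fenchel[OF uC], of c j] c[OF u]
        unfolding fenchel_involution[OF uC] Zs_def discrete_functional_def by blast
      then show "dist (Zs j u) (Z u) < e" using j by (simp add: dist_real_def abs_minus_commute)
    qed
  qed
  have rep: "\<exists>l w. l \<in> Conv_cd \<and> w \<in> Conv_cd \<and>
      (\<forall>u\<in>Conv_cd.
        set_integrable lebesgue (eff_dom l) (grad_integrand u l) \<and>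
        set_integrable lebesgue (eff_dom w) (grad_integrand u w) \<and>
        Zs j u = (LINT x:eff_dom l|lebesgue. grad_integrand u l x)
               - (LINT x:eff_dom w|lebesgue. grad_integrand u w x))" for j
    by (rule discrete_functional_gradient_representation[OF Id(1,2), of j "d j"]) (unfold Zs_def, blast)
  show ?thesis
    using unif rep epi_continuous_discrete_functional is_valuation_discrete_functional
      epi_translation_invariant_discrete_functional[OF Id(3,4)]
    by (intro exI[of _ Zs]) (auto simp: Zs_def)
qed

end
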